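(* Let $U_{AB}$ be a unitary with $(\lambda_1,\lambda_2)$-controllable correlation. If a non-local quantum computation protocol using a pure resource state $|\Psi\rangle_{LR}$ gives an $\epsilon$-correct (in diamond norm distance, with $\epsilon<1/4$) implementation of $U_{AB}$, then \[ S(R)_\Psi\ \ge\ \frac{\lambda_1-\lambda_2}{2}-\Delta(2\sqrt{\epsilon},n_A),\qquad \Delta(x,n)=4nx+(1+2x)\,h\!\left(\frac{2x}{1+2x}\right). \]
   Context: A non-local quantum computation (NLQC) implementing a channel on $AB$ (with $A$ input and output on Alice's side and $B$ on Bob's side) is a channel of the form $(\mathcal{W}_{K_aM_a\to A}\otimes\mathcal{W}'_{K_bM_b\to B})\circ(\mathcal{V}_{AL\to K_aM_b}\otimes\mathcal{V}'_{RB\to M_aK_b})(\cdot\otimes\Psi_{LR})$ with shared resource state $\Psi_{LR}$ ($L$ Alice, $R$ Bob): local operations, one simultaneous round of quantum communication, local operations. It is an $\epsilon$-correct implementation of $U$ if its diamond-norm distance to $\rho\mapsto U\rho U^\dagger$ is at most $\epsilon$, where $\|\mathcal{N}-\mathcal{M}\|_\diamond=\sup_d\max_\Psi\|(\mathrm{id}_d\otimes\mathcal{N})(\Psi)-(\mathrm{id}_d\otimes\mathcal{M})(\Psi)\|_1$, $\|X\|_1=\mathrm{tr}|X|$. $S$ is von Neumann entropy (base 2), $I(X:Y)=S(X)+S(Y)-S(XY)$, $h(x)=-x\log x-(1-x)\log(1-x)$, and $n_A=\log_2\dim\mathcal{H}_A$. Controllable correlation: let $\bar Q$ be a reference system with $n_{\bar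 Q}=n_A$. For a state $P_{\bar QA}$ and states $\phi^1_B,\phi^2_B$ define $\rho^i_{\bar QAB}=U_{AB}(P_{\bar QA}\otimes\phi^i_B)U_{AB}^\dagger$. $U_{AB}$ has $(\lambda_1,\lambda_2)$-controllable correlation if there exist $P_{\bar QA},\phi^1_B,\phi^2_B$ with $\lambda_1=I(\bar Q:A)_{\rho^1}$, $\lambda_2=I(\bar Q:A)_{\rho^2}$ and $\lambda_1>\lambda_2$. *)

theory Defs
  imports "Jordan_Normal_Form.Char_Poly" "HOL-Computational_Algebra.Polynomial"
begin

text \<open>A system of dimension n is C^n; operators are complex n x n matrices.
  Composite systems use the Kronecker product, first factor = most significant index.\<close>

definition adj :: "complex mat \<Rightarrow> complex mat" where
  "adj A = mat (dim_col A) (dim_row A) (\<lambda>(i,j). cnj (A $$ (j,i)))"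

definition kron :: "complex mat \<Rightarrow> complex mat \<Rightarrow> complex mat" where
  "kron A B = mat (dim_row A * dim_row B) (dim_col A * dim_col B)
     (\<lambda>(i,j). A $$ (i div dim_row B, j div dim_col B) * B $$ (i mod dim_row B, j mod dim_col B))"

text \<open>swap m n : C^m (x) C^n -> C^n (x) C^m, |a>|b> |-> |b>|a>.\<close>
definition swap :: "nat \<Rightarrow> nat \<Rightarrow> complex mat" where
  "swap m n = mat (m*n) (m*n) (\<lambda>(i,j). if i = (j mod n) * m + j div n then 1 else 0)"

definition psd :: "complex mat \<Rightarrow> bool" where
  "psd A \<longleftrightarrow> dim_row A = dim_col A \<and>
     (\<forall>v :: nat \<Rightarrow> complex.
        (let q = (\<Sum>i<dim_row A. \<Sum>j<dim_row A. cnj (v i) * A $$ (i,j) * v j)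
         in Im q = 0 \<and> Re q \<ge> 0))"

definition mtrace :: "complex mat \<Rightarrow> complex" where
  "mtrace A = (\<Sum>i<dim_row A. A $$ (i,i))"

definition density :: "nat \<Rightarrow> complex mat \<Rightarrow> bool" where
  "density n \<rho> \<longleftrightarrow> \<rho> \<in> carrier_mat n n \<and> psd \<rho> \<and> mtrace \<rho> = 1"

definition unitary :: "nat \<Rightarrow> complex mat \<Rightarrow> bool" where
  "unitary n U \<longleftrightarrow> U \<in> carrier_mat n n \<and> U * adj U = 1\<^sub>m n \<and> adj U * U = 1\<^sub>m n"

definition unit_cvec :: "nat \<Rightarrow> complex vec \<Rightarrow> bool" where
  "unit_cvec n \<psi> \<longleftrightarrow> dim_vec \<psi> = n \<and> (\<Sum>i<n. (cmod (\<psi> $ i))\<^sup>2) = 1"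

definition outer :: "complex vec \<Rightarrow> complex mat" where
  "outer \<psi> = mat (dim_vec \<psi>) (dim_vec \<psi>) (\<lambda>(i,j). \<psi> $ i * cnj (\<psi> $ j))"

definition ptr_right :: "nat \<Rightarrow> nat \<Rightarrow> complex mat \<Rightarrow> complex mat" where
  "ptr_right m n M = mat m m (\<lambda>(i,j). \<Sum>k<n. M $$ (i*n+k, j*n+k))"

definition ptr_left :: "nat \<Rightarrow> nat \<Rightarrow> complex mat \<Rightarrow> complex mat" where
  "ptr_left m n M = mat n n (\<lambda>(i,j). \<Sum>k<m. M $$ (k*n+i, k*n+j))"

definition spec_sum :: "complex mat \<Rightarrow> (complex \<Rightarrow> real) \<Rightarrow> real" where
  "spec_sum A f = (\<Sum>a\<in>{a. poly (char_poly A) a = 0}. real (order a (char_poly A)) * f a)"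

definition eta :: "real \<Rightarrow> real" where
  "eta x = (if x > 0 then - x * log 2 x else 0)"

definition vN_entropy :: "complex mat \<Rightarrow> real" where
  "vN_entropy \<rho> = spec_sum \<rho> (\<lambda>a. eta (Re a))"

definition trace_norm :: "complex mat \<Rightarrow> real" where
  "trace_norm X = spec_sum (adj X * X) (\<lambda>a. sqrt (Re a))"

definition bin_entropy :: "real \<Rightarrow> real" where
  "bin_entropy x = eta x + eta (1 - x)"

definition Delta :: "real \<Rightarrow> real \<Rightarrow> real" where
  "Delta x n = 4 * n * x + (1 + 2*x) * bin_entropy (2*x / (1 + 2*x))"

definition kraus_channel :: "nat \<Rightarrow> nat \<Rightarrow> complex mat list \<Rightarrow> bool" where
  "kraus_channel din dout Ks \<longleftrightarrow> (\<forall>K\<in>set Ks. K \<in> carrier_mat dout din) \<and>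
     foldr (\<lambda>K acc. adj K * K + acc) Ks (0\<^sub>m din din) = 1\<^sub>m din"

definition kraus_apply :: "nat \<Rightarrow> complex mat list \<Rightarrow> complex mat \<Rightarrow> complex mat" where
  "kraus_apply dout Ks \<rho> = foldr (\<lambda>K acc. K * \<rho> * adj K + acc) Ks (0\<^sub>m dout dout)"

definition kron_list :: "complex mat list \<Rightarrow> complex mat list \<Rightarrow> complex mat list" where
  "kron_list Ks Ks' = concat (map (\<lambda>K. map (\<lambda>K'. kron K K') Ks') Ks)"

text \<open>(id_d (x) N)(X) for a linear map N on din x din matrices with dout x dout output,
  acting blockwise.\<close>
definition ext_id :: "nat \<Rightarrow> nat \<Rightarrow> nat \<Rightarrow> (complex mat \<Rightarrow> complex mat) \<Rightarrow> complex mat \<Rightarrow> complex mat" where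
  "ext_id d din dout N X = mat (d*dout) (d*dout) (\<lambda>(r,c).
     N (mat din din (\<lambda>(a,b). X $$ ((r div dout)*din + a, (c div dout)*din + b)))
       $$ (r mod dout, c mod dout))"

definition diamond_dist :: "nat \<Rightarrow> nat \<Rightarrow> (complex mat \<Rightarrow> complex mat) \<Rightarrow> (complex mat \<Rightarrow> complex mat) \<Rightarrow> real" where
  "diamond_dist din dout N M = Sup {trace_norm (ext_id d din dout N X - ext_id d din dout M X) | d X.
      density (d*din) X}"

text \<open>Channel on AB: rho_AB |-> (W (x) W') ((V (x) V') (rho_AB (x) Psi_LR)), with the
  needed reorderings of tensor factors. V : A L -> K_a M_b, V' : R B -> M_a K_b,
  W : K_a M_a -> A, W' : M_b K_b -> B.\<close>
definition nlqc_map ::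
  "nat \<Rightarrow> nat \<Rightarrow> nat \<Rightarrow> nat \<Rightarrow> nat \<Rightarrow> nat \<Rightarrow> nat \<Rightarrow> nat \<Rightarrow>
   complex mat list \<Rightarrow> complex mat list \<Rightarrow> complex mat list \<Rightarrow> complex mat list \<Rightarrow>
   complex mat \<Rightarrow> complex mat \<Rightarrow> complex mat" where
  "nlqc_map dA dB dL dR dKa dMa dKb dMb Vs Vs' Ws Ws' Psi \<rho> =
    (let \<rho>0 = kron \<rho> Psi;                                   \<comment> \<open>A B L R\<close>
         P1 = kron (1\<^sub>m dA) (swap dB (dL*dR));
         \<rho>1 = P1 * \<rho>0 * adj P1;                               \<comment> \<open>A L R B\<close>
         \<rho>2 = kraus_apply (dKa*dMb*dMa*dKb) (kron_list Vs Vs') \<rho>1;  \<comment> \<open>K_a M_b M_a K_b\<close>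
         P2 = kron (kron (1\<^sub>m dKa) (swap dMb dMa)) (1\<^sub>m dKb);
         \<rho>3 = P2 * \<rho>2 * adj P2                                \<comment> \<open>K_a M_a M_b K_b\<close>
     in kraus_apply (dA*dB) (kron_list Ws Ws') \<rho>3)"

definition mutual_info_QA :: "nat \<Rightarrow> nat \<Rightarrow> nat \<Rightarrow> complex mat \<Rightarrow> real" where
  "mutual_info_QA dQ dA dB \<rho> =
    (let \<rho>QA = ptr_right (dQ*dA) dB \<rho>
     in vN_entropy (ptr_right dQ dA \<rho>QA) + vN_entropy (ptr_left dQ dA \<rho>QA) - vN_entropy \<rho>QA)"

definition controllable_correlation :: "nat \<Rightarrow> nat \<Rightarrow> complex mat \<Rightarrow> real \<Rightarrow> real \<Rightarrow> bool" where
  "controllable_correlation dA dB U l1 l2 \<longleftrightarrow>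
    (\<exists>P \<phi>1 \<phi>2. density (dA*dA) P \<and> density dB \<phi>1 \<and> density dB \<phi>2 \<and>
       (let IU = kron (1\<^sub>m dA) U;
            \<rho>1 = IU * kron P \<phi>1 * adj IU;
            \<rho>2 = IU * kron P \<phi>2 * adj IU
        in l1 = mutual_info_QA dA dA dB \<rho>1 \<and> l2 = mutual_info_QA dA dA dB \<rho>2) \<and>
       l1 > l2)"

end

theory Submission
  imports Defs "Jordan_Normal_Form.Spectral_Radius"
begin

text \<open>Purify the inputs and dilate all channels, so that only pure states occur. Since the marginal
  on the reference Q does not depend on the input of B, the difference of the two mutual informations
  is a difference of conditional entropies S(Q|A). An implementation close to the unitary leaves the
  environment of the last local operation almost in a product state, so S(Q|A) for the ideal output
  agrees with S(Q | K M) for the message state just after communication, where K and M are the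
  systems that Alice keeps and receives, up to an Alicki-Fannes-Winter error whose dimension factor only
  involves Q. Without the message, the state of QK does not depend on the input of B; by strong
  subadditivity, S(Q | K M) is at most S(Q|K), and S(Q|K) is at most S(Q | K R) + 2 S(R), which is at
  most S(Q | K M) + 2 S(R) for the other input, because M arises from R by a local isometry.

  Strong subadditivity and the mixing inequalities all come from one fact: the integrand in the
  resolvent representation of relative entropy is a supremum of functionals linear in the two
  operators, and these functionals are compatible with partial traces, sums and operator order.\<close>

text \<open>The analytic part works with kernels over arbitrary finite index sets instead of
  matrices: regrouping tensor factors is then a bijection of tuples, and a vector indexed by a
  system and an environment serves as its own purification. Traces are left free, because the
  continuity argument splits one positive kernel in two ways into pieces of different traces.
  Logarithms of noncommuting operators are hard to compare directly; bounding the resolvent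
  functional for every t reduces such comparisons to a scalar monotonicity argument. The constants
  arise as follows: diamond distance \<epsilon> gives overlap at least 1 - \<epsilon> with the ideal
  pure output, hence vectors at distance at most sqrt (2\<epsilon>). Continuity is used once for
  each of the two inputs, and the two errors are halved together with the 2 S(R) from the resource.
  The error increases with the distance, so it is at most the one at distance 4 sqrt \<epsilon>,
  which is \<open>Delta (2 * sqrt \<epsilon>)\<close>.\<close>

definition kd :: "'a \<Rightarrow> 'a \<Rightarrow> complex" where
  "kd a b = (if a = b then 1 else 0)"

lemma kd_same [simp]: "kd a a = 1"
  and kd_diff: "a \<noteq> b \<Longrightarrow> kd a b = 0"
  and cnj_kd [simp]: "cnj (kd a b) = kd a b"
  and kd_pair: "kd (a, c) (b, d) = kd a b * kd c d"
  by (auto simp: kd_def)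

lemma kd_sym: "kd a b = kd b a"
  by (auto simp: kd_def)

text \<open>Folded Kronecker deltas contract sums without case splits; the four forms cover both
  positions of the delta and both orders of its arguments.\<close>

lemma sum_kd [simp]:
  assumes "finite I" "a \<in> I"
  shows "(\<Sum>b\<in>I. kd a b * f b) = f a" "(\<Sum>b\<in>I. kd b a * f b) = f a"
    "(\<Sum>b\<in>I. f b * kd a b) = f a" "(\<Sum>b\<in>I. f b * kd b a) = f a"
proof -
  have *: "(\<Sum>b\<in>I. if a = b then f b else 0) = f a" using assms by simp
  have "kd a b * f b = (if a = b then f b else 0)" "kd b a * f b = (if a = b then f b else 0)"
    "f b * kd a b = (if a = b then f b else 0)" "f b * kd b a = (if a = b then f b else 0)" for b
    by (auto simp: kd_def)
  then show "(\<Sum>b\<in>I. kd a b * f b) = f a" "(\<Sum>b\<in>I. kd b a * f b) = f a"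
    "(\<Sum>b\<in>I. f b * kd a b) = f a" "(\<Sum>b\<in>I. f b * kd b a) = f a"
    using * by simp_all
qed

lemma cnj_mult_self: "cnj z * z = of_real ((cmod z)\<^sup>2)"
  by (metis complex_norm_square mult.commute)

lemma mult_cnj_self: "z * cnj z = of_real ((cmod z)\<^sup>2)"
  by (metis complex_norm_square)

lemma sum_cnj_mult_self: "(\<Sum>a\<in>I. cnj (f a) * f a) = of_real (\<Sum>a\<in>I. (cmod (f a))\<^sup>2)"
  by (simp add: cnj_mult_self)

subsection \<open>Orthonormal bases and the spectral theorem\<close>

text \<open>Orthonormality and completeness are both recorded, since K and I are label sets of a
  priori unrelated size. A label set apart from I admits product and transported bases under their
  natural labels.\<close>

definition onb :: "'k set \<Rightarrow> 'a set \<Rightarrow> ('k \<Rightarrow> 'a \<Rightarrow> complex) \<Rightarrow> bool" where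
  "onb K I e \<longleftrightarrow> finite K \<and> finite I \<and>
     (\<forall>k\<in>K. \<forall>l\<in>K. (\<Sum>a\<in>I. cnj (e k a) * e l a) = kd k l) \<and>
     (\<forall>a\<in>I. \<forall>b\<in>I. (\<Sum>k\<in>K. e k a * cnj (e k b)) = kd a b)"

definition eigsys :: "'k set \<Rightarrow> 'a set \<Rightarrow> ('a \<Rightarrow> 'a \<Rightarrow> complex) \<Rightarrow> ('k \<Rightarrow> 'a \<Rightarrow> complex) \<Rightarrow> ('k \<Rightarrow> real) \<Rightarrow> bool" where
  "eigsys K I M e p \<longleftrightarrow> onb K I e \<and>
     (\<forall>a\<in>I. \<forall>b\<in>I. M a b = (\<Sum>k\<in>K. of_real (p k) * e k a * cnj (e k b)))"

definition herm :: "'a set \<Rightarrow> ('a \<Rightarrow> 'a \<Rightarrow> complex) \<Rightarrow> bool" where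
  "herm I M \<longleftrightarrow> (\<forall>a\<in>I. \<forall>b\<in>I. M b a = cnj (M a b))"

lemma onb_finite: "onb K I e \<Longrightarrow> finite K" "onb K I e \<Longrightarrow> finite I"
  by (auto simp: onb_def)

lemma onb_ortho: "onb K I e \<Longrightarrow> k \<in> K \<Longrightarrow> l \<in> K \<Longrightarrow> (\<Sum>a\<in>I. cnj (e k a) * e l a) = kd k l"
  and onb_complete: "onb K I e \<Longrightarrow> a \<in> I \<Longrightarrow> b \<in> I \<Longrightarrow> (\<Sum>k\<in>K. e k a * cnj (e k b)) = kd a b"
  by (auto simp: onb_def)

lemma onb_expand:
  assumes "onb K I e" "a \<in> I"
  shows "f a = (\<Sum>k\<in>K. e k a * (\<Sum>b\<in>I. cnj (e k b) * f b))"
proof -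
  have "(\<Sum>k\<in>K. e k a * (\<Sum>b\<in>I. cnj (e k b) * f b)) = (\<Sum>b\<in>I. (\<Sum>k\<in>K. e k a * cnj (e k b)) * f b)"
    by (simp add: sum_distrib_left sum_distrib_right mult.assoc) (rule sum.swap)
  also have "\<dots> = (\<Sum>b\<in>I. kd a b * f b)"
    using assms by (intro sum.cong) (auto simp: onb_complete)
  finally show ?thesis using assms by (simp add: onb_finite)
qed

lemma onb_cnj: "onb K I e \<Longrightarrow> onb K I (\<lambda>k a. cnj (e k a))"
  unfolding onb_def
proof (intro conjI ballI; elim conjE)
  fix k l assume k: "k \<in> K" "l \<in> K" and *: "\<forall>k\<in>K. \<forall>l\<in>K. (\<Sum>a\<in>I. cnj (e k a) * e l a) = kd k l"
  have "(\<Sum>a\<in>I. cnj (cnj (e k a)) * cnj (e l a)) = cnj (\<Sum>a\<in>I. cnj (e k a) * e l a)" by simp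
  then show "(\<Sum>a\<in>I. cnj (cnj (e k a)) * cnj (e l a)) = kd k l" using * k by simp
next
  fix k l assume k: "k \<in> I" "l \<in> I" and *: "\<forall>a\<in>I. \<forall>b\<in>I. (\<Sum>k\<in>K. e k a * cnj (e k b)) = kd a b"
  have "(\<Sum>a\<in>K. cnj (e a k) * cnj (cnj (e a l))) = cnj (\<Sum>a\<in>K. e a k * cnj (e a l))" by simp
  then show "(\<Sum>a\<in>K. cnj (e a k) * cnj (cnj (e a l))) = kd k l" using * k by simp
qed simp_all

text \<open>Parseval's identity in polarised form.\<close>

lemma onb_bilinear:
  assumes "onb K I e"
  shows "(\<Sum>k\<in>K. cnj (\<Sum>b\<in>I. cnj (e k b) * f b) * (\<Sum>b\<in>I. cnj (e k b) * g b)) = (\<Sum>b\<in>I. cnj (f b) * g b)"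
proof -
  have "(\<Sum>b\<in>I. cnj (f b) * g b) = (\<Sum>b\<in>I. cnj (f b) * (\<Sum>k\<in>K. e k b * (\<Sum>c\<in>I. cnj (e k c) * g c)))"
    by (intro sum.cong refl arg_cong2[where f="(*)"] onb_expand[OF assms])
  also have "\<dots> = (\<Sum>b\<in>I. \<Sum>k\<in>K. cnj (f b) * e k b * (\<Sum>c\<in>I. cnj (e k c) * g c))"
    by (simp add: sum_distrib_left mult.assoc)
  also have "\<dots> = (\<Sum>k\<in>K. \<Sum>b\<in>I. cnj (f b) * e k b * (\<Sum>c\<in>I. cnj (e k c) * g c))"
    by (rule sum.swap)
  also have "\<dots> = (\<Sum>k\<in>K. cnj (\<Sum>b\<in>I. cnj (e k b) * f b) * (\<Sum>c\<in>I. cnj (e k c) * g c))"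
    unfolding sum_distrib_right cnj_sum complex_cnj_mult complex_cnj_cnj by (intro sum.cong refl) (simp only: mult_ac)
  finally show ?thesis by simp
qed

lemma onb_parseval:
  assumes "onb K I e"
  shows "(\<Sum>k\<in>K. (cmod (\<Sum>b\<in>I. cnj (e k b) * f b))\<^sup>2) = (\<Sum>b\<in>I. (cmod (f b))\<^sup>2)"
proof -
  have "complex_of_real (\<Sum>k\<in>K. (cmod (\<Sum>b\<in>I. cnj (e k b) * f b))\<^sup>2) = of_real (\<Sum>b\<in>I. (cmod (f b))\<^sup>2)"
    using onb_bilinear[OF assms, of f f] by (simp add: cnj_mult_self del: cnj_sum)
  then show ?thesis by (simp only: of_real_eq_iff)
qed

lemma onb_parseval':
  assumes "onb K I e"
  shows "(\<Sum>k\<in>K. (cmod (\<Sum>b\<in>I. e k b * f b))\<^sup>2) = (\<Sum>b\<in>I. (cmod (f b))\<^sup>2)"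
  using onb_parseval[OF onb_cnj[OF assms], of f] by simp

lemma eigsys_onb: "eigsys K I M e p \<Longrightarrow> onb K I e"
  and eigsys_eq: "eigsys K I M e p \<Longrightarrow> a \<in> I \<Longrightarrow> b \<in> I \<Longrightarrow> M a b = (\<Sum>k\<in>K. of_real (p k) * e k a * cnj (e k b))"
  by (auto simp: eigsys_def)

lemma eigsys_cong:
  assumes "eigsys K I M e p" "\<And>a b. a \<in> I \<Longrightarrow> b \<in> I \<Longrightarrow> M a b = N a b"
  shows "eigsys K I N e p"
  using assms by (auto simp: eigsys_def)

lemma eigsys_herm: "eigsys K I M e p \<Longrightarrow> herm I M"
  unfolding herm_def by (auto simp: eigsys_eq intro!: sum.cong)

lemma eigsys_apply:
  assumes "eigsys K I M e p" "k \<in> K" "a \<in> I"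
  shows "(\<Sum>b\<in>I. M a b * e k b) = of_real (p k) * e k a"
proof -
  note o = eigsys_onb[OF assms(1)]
  have "(\<Sum>b\<in>I. M a b * e k b) = (\<Sum>b\<in>I. \<Sum>l\<in>K. of_real (p l) * e l a * cnj (e l b) * e k b)"
    using assms by (simp add: eigsys_eq sum_distrib_right)
  also have "\<dots> = (\<Sum>l\<in>K. of_real (p l) * e l a * (\<Sum>b\<in>I. cnj (e l b) * e k b))"
    by (subst sum.swap) (simp add: sum_distrib_left mult.assoc)
  also have "\<dots> = (\<Sum>l\<in>K. of_real (p l) * e l a * kd l k)"
    using assms(2) by (intro sum.cong) (auto simp: onb_ortho[OF o])
  finally show ?thesis using assms(2) onb_finite[OF o] by simp
qed

lemma eigsys_apply_left:
  assumes "eigsys K I M e p" "k \<in> K" "b \<in> I"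
  shows "(\<Sum>a\<in>I. cnj (e k a) * M a b) = of_real (p k) * cnj (e k b)"
proof -
  have "cnj (M b a) = M a b" if "a \<in> I" for a
    using eigsys_herm[OF assms(1)] assms(3) that unfolding herm_def by metis
  then have "(\<Sum>a\<in>I. cnj (e k a) * M a b) = cnj (\<Sum>a\<in>I. M b a * e k a)"
    by (simp add: mult.commute cong: sum.cong)
  then show ?thesis using eigsys_apply[OF assms] by simp
qed

text \<open>\<open>M'\<close> is the matrix of M in the basis u, so its eigenvectors are coefficient
  vectors with respect to u.\<close>

lemma eigsys_change_basis:
  assumes u: "onb C I u" and e: "eigsys K C M' e p"
    and M: "\<And>a b. a \<in> I \<Longrightarrow> b \<in> I \<Longrightarrow> M a b = (\<Sum>c\<in>C. \<Sum>d\<in>C. u c a * M' c d * cnj (u d b))"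
  shows "eigsys K I M (\<lambda>k a. \<Sum>c\<in>C. e k c * u c a) p"
proof -
  note oe = eigsys_onb[OF e]
  have fin: "finite C" "finite I" "finite K" using u oe by (auto simp: onb_def)
  have 1: "(\<Sum>a\<in>I. cnj (\<Sum>c\<in>C. e k c * u c a) * (\<Sum>c\<in>C. e l c * u c a)) = kd k l" if "k \<in> K" "l \<in> K" for k l
  proof -
    have "(\<Sum>a\<in>I. cnj (\<Sum>c\<in>C. e k c * u c a) * (\<Sum>c\<in>C. e l c * u c a))
      = (\<Sum>a\<in>I. \<Sum>c\<in>C. \<Sum>d\<in>C. cnj (e k c) * e l d * (cnj (u c a) * u d a))"
      unfolding cnj_sum complex_cnj_mult sum_product by (intro sum.cong refl) (simp only: mult_ac)
    also have "\<dots> = (\<Sum>c\<in>C. \<Sum>d\<in>C. cnj (e k c) * e l d * (\<Sum>a\<in>I. cnj (u c a) * u d a))"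
      by (subst sum.swap, intro sum.cong refl, subst sum.swap) (simp add: sum_distrib_left)
    also have "\<dots> = (\<Sum>c\<in>C. cnj (e k c) * (\<Sum>d\<in>C. e l d * kd c d))"
      by (auto simp: onb_ortho[OF u] sum_distrib_left mult.assoc intro!: sum.cong)
    also have "\<dots> = (\<Sum>c\<in>C. cnj (e k c) * e l c)"
      using fin by (intro sum.cong refl) simp
    finally show ?thesis using that oe by (simp add: onb_ortho)
  qed
  \<comment> \<open>One computation with free weights \<open>r\<close>: weight 1 gives completeness
    and weight \<open>p\<close> the spectral expansion.\<close>
  have gen: "(\<Sum>k\<in>K. of_real (r k) * (\<Sum>c\<in>C. e k c * u c a) * cnj (\<Sum>c\<in>C. e k c * u c b))
     = (\<Sum>c\<in>C. \<Sum>d\<in>C. u c a * (\<Sum>k\<in>K. of_real (r k) * e k c * cnj (e k d)) * cnj (u d b))" for a b and r :: "_ \<Rightarrow> real"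
  proof -
    have "(\<Sum>k\<in>K. of_real (r k) * (\<Sum>c\<in>C. e k c * u c a) * cnj (\<Sum>c\<in>C. e k c * u c b))
      = (\<Sum>k\<in>K. \<Sum>c\<in>C. \<Sum>d\<in>C. u c a * (of_real (r k) * e k c * cnj (e k d)) * cnj (u d b))"
      unfolding cnj_sum mult.assoc unfolding sum_product unfolding sum_distrib_left complex_cnj_mult
      by (intro sum.cong refl) (simp only: mult_ac)
    also have "\<dots> = (\<Sum>c\<in>C. \<Sum>d\<in>C. \<Sum>k\<in>K. u c a * (of_real (r k) * e k c * cnj (e k d)) * cnj (u d b))"
      by (subst sum.swap, intro sum.cong refl, subst sum.swap) simp
    finally show ?thesis by (simp add: sum_distrib_left sum_distrib_right)
  qed
  have 2: "(\<Sum>k\<in>K. (\<Sum>c\<in>C. e k c * u c a) * cnj (\<Sum>c\<in>C. e k c * u c b)) = kd a b" if "a \<in> I" "b \<in> I" for a b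
  proof -
    have "(\<Sum>k\<in>K. (\<Sum>c\<in>C. e k c * u c a) * cnj (\<Sum>c\<in>C. e k c * u c b))
       = (\<Sum>c\<in>C. \<Sum>d\<in>C. u c a * (\<Sum>k\<in>K. e k c * cnj (e k d)) * cnj (u d b))"
      using gen[of "\<lambda>_. 1" a b] by simp
    also have "\<dots> = (\<Sum>c\<in>C. u c a * (\<Sum>d\<in>C. kd c d * cnj (u d b)))"
      by (auto simp: onb_complete[OF oe] sum_distrib_left mult.assoc intro!: sum.cong)
    also have "\<dots> = (\<Sum>c\<in>C. u c a * cnj (u c b))"
      using fin by (intro sum.cong refl) simp
    finally show ?thesis using that u by (simp add: onb_complete)
  qed
  have 3: "M a b = (\<Sum>k\<in>K. of_real (p k) * (\<Sum>c\<in>C. e k c * u c a) * cnj (\<Sum>c\<in>C. e k c * u c b))" if "a \<in> I" "b \<in> I" for a b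
    using that by (subst gen) (auto simp: M eigsys_eq[OF e] intro!: sum.cong)
  show ?thesis unfolding eigsys_def onb_def using 1 2 3 fin by blast
qed

text \<open>Direct sum of a one-dimensional block at k with the block on J: the shape that a
  Hermitian kernel takes once an eigenvector has been split off.\<close>

lemma eigsys_insert:
  assumes k: "k \<notin> J" and e: "eigsys J J M e p"
    and M: "M k k = of_real \<mu>" "\<And>b. b \<in> J \<Longrightarrow> M k b = 0" "\<And>b. b \<in> J \<Longrightarrow> M b k = 0"
  shows "eigsys (insert k J) (insert k J) M (\<lambda>j a. if j = k \<or> a = k then kd j a else e j a) (p(k := \<mu>))"
proof -
  note o = eigsys_onb[OF e]
  have fin: "finite J" using o by (simp add: onb_def)
  let ?e = "\<lambda>j a. if j = k \<or> a = k then kd j a else e j a"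
  have e1: "?e k = kd k" "\<And>j. ?e j k = kd j k" "\<And>j a. j \<in> J \<Longrightarrow> a \<in> J \<Longrightarrow> ?e j a = e j a"
    using k by (auto simp: fun_eq_iff)
  have kk: "kd k x = 0" "kd x k = 0" if "x \<in> J" for x using that k by (auto simp: kd_def)
  have p1: "(p(k := \<mu>)) k = \<mu>" "\<And>j. j \<in> J \<Longrightarrow> (p(k := \<mu>)) j = p j" using k by auto
  have split: "(\<Sum>a\<in>insert k J. f a) = f k + (\<Sum>a\<in>J. f a)" for f :: "'a \<Rightarrow> complex"
    using fin k by simp
  show ?thesis unfolding eigsys_def onb_def split
  proof (intro conjI ballI)
    fix i l assume "i \<in> insert k J" "l \<in> insert k J"
    then consider "i = k" "l = k" | "i = k" "l \<in> J" | "i \<in> J" "l = k" | "i \<in> J" "l \<in> J" by auto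
    then show "cnj (?e i k) * ?e l k + (\<Sum>a\<in>J. cnj (?e i a) * ?e l a) = kd i l"
      by cases (simp_all add: e1 kk onb_ortho[OF o] del: sum_kd cong: sum.cong)
    from \<open>i \<in> insert k J\<close> \<open>l \<in> insert k J\<close>
    consider "i = k" "l = k" | "i = k" "l \<in> J" | "i \<in> J" "l = k" | "i \<in> J" "l \<in> J" by auto
    then show "?e k i * cnj (?e k l) + (\<Sum>j\<in>J. ?e j i * cnj (?e j l)) = kd i l"
      by cases (simp_all add: e1 kk onb_complete[OF o] del: sum_kd cong: sum.cong)
    from \<open>i \<in> insert k J\<close> \<open>l \<in> insert k J\<close>
    consider "i = k" "l = k" | "i = k" "l \<in> J" | "i \<in> J" "l = k" | "i \<in> J" "l \<in> J" by auto
    then show "M i l = of_real ((p(k := \<mu>)) k) * ?e k i * cnj (?e k l)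
        + (\<Sum>j\<in>J. of_real ((p(k := \<mu>)) j) * ?e j i * cnj (?e j l))"
      by cases (simp_all add: e1 kk p1 M eigsys_eq[OF e] del: sum_kd fun_upd_apply cong: sum.cong)
  qed (use fin in auto)
qed

text \<open>An enumeration of I turns the kernel into a matrix, whose characteristic polynomial has
  a root because the complex field is algebraically closed.\<close>

lemma eigenvector_exists:
  fixes M :: "'a \<Rightarrow> 'a \<Rightarrow> complex"
  assumes "finite I" "I \<noteq> {}"
  obtains v \<mu> where "\<exists>a\<in>I. v a \<noteq> 0" "\<And>a. a \<in> I \<Longrightarrow> (\<Sum>b\<in>I. M a b * v b) = \<mu> * v a"
proof -
  define n where "n = card I"
  obtain h where h: "bij_betw h {0..<n} I"
    using ex_bij_betw_nat_finite[OF assms(1)] n_def by blast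
  define A where "A = mat n n (\<lambda>(i, j). M (h i) (h j))"
  have A: "A \<in> carrier_mat n n" by (simp add: A_def)
  have "n \<noteq> 0" using assms by (simp add: n_def)
  then obtain \<mu> where "eigenvalue A \<mu>"
    using spectrum_non_empty[OF A] by (auto simp: spectrum_def)
  then obtain x where x: "x \<in> carrier_vec n" "x \<noteq> 0\<^sub>v n" "A *\<^sub>v x = \<mu> \<cdot>\<^sub>v x"
    using A by (auto simp: eigenvalue_def eigenvector_def)
  define g where "g = inv_into {0..<n} h"
  have g: "g (h i) = i" if "i < n" for i
    using h that by (auto simp: g_def bij_betw_def inv_into_f_f)
  have surj: "\<exists>i<n. a = h i" if "a \<in> I" for a
    using h that by (auto simp: bij_betw_def)
  obtain i where i: "i < n" "x $ i \<noteq> 0"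
    using x(1,2) by (metis carrier_vecD eq_vecI index_zero_vec(1) index_zero_vec(2))
  have hi: "h i \<in> I" if "i < n" for i using h that by (auto simp: bij_betw_def)
  show ?thesis
  proof (rule that[of "\<lambda>a. x $ (g a)" \<mu>])
    show "\<exists>a\<in>I. x $ g a \<noteq> 0" using i g hi by (intro bexI[of _ "h i"]) auto
    fix a assume "a \<in> I"
    then obtain i where i: "i < n" "a = h i" using surj by blast
    have "(\<Sum>b\<in>I. M a b * x $ g b) = (\<Sum>j\<in>{0..<n}. M a (h j) * x $ g (h j))"
      by (rule sum.reindex_bij_betw[symmetric, OF h])
    also have "\<dots> = (\<Sum>j\<in>{0..<n}. M a (h j) * x $ j)" by (simp add: g)
    also have "\<dots> = (A *\<^sub>v x) $ i" using i x(1) by (simp add: A_def scalar_prod_def)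
    also have "\<dots> = \<mu> * x $ g a" using i x g by simp
    finally show "(\<Sum>b\<in>I. M a b * x $ g b) = \<mu> * x $ g a" .
  qed
qed

text \<open>The Householder reflection exchanging the k-th unit vector and v.\<close>
lemma onb_extending_vector:
  fixes v :: "'a \<Rightarrow> complex"
  assumes fin: "finite I" and k: "k \<in> I" and v: "(\<Sum>a\<in>I. (cmod (v a))\<^sup>2) = 1" and real: "Im (v k) = 0"
  obtains u where "onb I I u" "\<And>a. a \<in> I \<Longrightarrow> u k a = v a"
proof -
  define w where "w a = v a - kd k a" for a
  define W where "W = (\<Sum>a\<in>I. cnj (w a) * w a)"
  define u where "u b a = kd b a - 2 / W * w a * cnj (w b)" for a b
  \<comment> \<open>A reflection is Hermitian, so it can carry the k-th unit vector to v only if the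
    entry v k is real.\<close>
  have cv: "cnj (v k) = v k" using real by (simp add: complex_eq_iff)
  have cW: "cnj W = W" by (simp add: W_def mult.commute)
  have vv: "(\<Sum>a\<in>I. cnj (v a) * v a) = 1"
    by (simp only: sum_cnj_mult_self v of_real_1)
  have "W = (\<Sum>a\<in>I. cnj (v a) * v a - kd k a * v a - cnj (v a) * kd k a + kd k a * kd k a)"
    unfolding W_def by (intro sum.cong refl) (simp add: w_def algebra_simps)
  also have "\<dots> = 2 - 2 * v k"
    using fin k by (simp add: sum_subtractf sum.distrib vv cv)
  finally have W: "W = 2 - 2 * v k" .
  \<comment> \<open>If W = 0, then v is the k-th unit vector, division by zero returns 0 and the
    reflection degenerates to the identity; this case is carried along below.\<close>
  have w0: "w a = 0" if "W = 0" "a \<in> I" for a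
  proof -
    have "(\<Sum>a\<in>I. (cmod (w a))\<^sup>2) = 0" using that(1) unfolding W_def
      by (simp only: sum_cnj_mult_self of_real_eq_0_iff)
    then show ?thesis using fin that by (subst (asm) sum_nonneg_eq_0_iff) auto
  qed
  have uk: "u k a = v a" if "a \<in> I" for a
  proof (cases "W = 0")
    case True
    then show ?thesis using w0[OF True that] by (simp add: u_def w_def)
  next
    case False
    have "2 * cnj (w k) = - W" by (simp add: w_def cv W)
    then have "2 / W * w a * cnj (w k) = - W / W * w a"
      by (metis (no_types) mult.assoc mult.commute times_divide_eq_left)
    then have "2 / W * w a * cnj (w k) = - w a" using False by simp
    then show ?thesis by (simp add: u_def w_def)
  qed
  have *: "(\<Sum>a\<in>I. cnj (u b a) * u c a) = kd b c" if "b \<in> I" "c \<in> I" for b c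
  proof -
    have "(\<Sum>a\<in>I. cnj (u b a) * u c a) = (\<Sum>a\<in>I. kd b a * kd c a - 2 / W * (cnj (w a) * kd c a) * w b
        - 2 / W * (kd b a * w a) * cnj (w c) + 4 / (W * W) * (cnj (w a) * w a) * (w b * cnj (w c)))"
      by (intro sum.cong refl) (simp add: u_def cW algebra_simps)
    also have "\<dots> = kd b c - 2 / W * cnj (w c) * w b - 2 / W * w b * cnj (w c) + 4 / (W * W) * W * (w b * cnj (w c))"
      unfolding sum_subtractf sum.distrib sum_distrib_left[symmetric] sum_distrib_right[symmetric] W_def[symmetric]
      using fin that by (simp add: kd_sym)
    also have "\<dots> = kd b c" by (cases "W = 0") (auto simp: field_simps)
    finally show ?thesis .
  qed
  have s: "cnj (u b a) = u a b" for a b by (simp add: u_def cW kd_sym mult_ac)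
  have "onb I I u" unfolding onb_def
  proof (intro conjI ballI)
    fix a b assume "a \<in> I" "b \<in> I"
    then show "(\<Sum>k\<in>I. u k a * cnj (u k b)) = kd a b" using *[of a b] by (simp add: s)
  qed (use * fin in auto)
  then show ?thesis using that uk by blast
qed

text \<open>Induction on the index set: an eigenvector is rotated onto one coordinate, and
  hermiticity decouples that coordinate from the rest.\<close>

theorem spectral_theorem:
  assumes "finite I" "herm I M"
  shows "\<exists>e p. eigsys I I M e p"
  using assms
proof (induction I arbitrary: M rule: finite_induct)
  case empty
  show ?case by (intro exI[of _ undefined]) (auto simp: eigsys_def onb_def)
next
  case (insert k J)
  let ?I = "insert k J"
  have fin: "finite ?I" and kI: "k \<in> ?I" using insert by auto
  obtain v0 \<mu> where v0: "\<exists>a\<in>?I. v0 a \<noteq> 0" and ev0: "\<And>a. a \<in> ?I \<Longrightarrow> (\<Sum>b\<in>?I. M a b * v0 b) = \<mu> * v0 a"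
    using eigenvector_exists[of ?I M] fin by blast
  define N where "N = (\<Sum>a\<in>?I. (cmod (v0 a))\<^sup>2)"
  have N: "N > 0" unfolding N_def using v0 fin
    by (meson sum_pos2 zero_less_norm_iff zero_less_power zero_le_power2)
  \<comment> \<open>The phase of \<open>v0 k\<close> is removed so that the entry at k becomes real;
    if that entry vanishes, any phase will do.\<close>
  define c where "c = (if v0 k = 0 then 1 else cnj (v0 k) / of_real (cmod (v0 k)))"
  have c: "cmod c = 1" by (auto simp: c_def norm_divide)
  have ck: "c * v0 k = of_real (cmod (v0 k))"
    by (auto simp: c_def cnj_mult_self power2_eq_square)
  define v where "v a = c * v0 a / of_real (sqrt N)" for a
  have "(cmod (v a))\<^sup>2 = (cmod (v0 a))\<^sup>2 / N" for a
    using N by (simp add: v_def norm_mult norm_divide c power_divide)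
  then have vn: "(\<Sum>a\<in>?I. (cmod (v a))\<^sup>2) = 1"
    using N by (simp only: sum_divide_distrib[symmetric] N_def[symmetric])  simp
  have vk: "Im (v k) = 0" by (simp only: v_def ck) (simp add: flip: of_real_divide)
  have ev: "(\<Sum>b\<in>?I. M a b * v b) = \<mu> * v a" if "a \<in> ?I" for a
  proof -
    have "(\<Sum>b\<in>?I. M a b * v b) = (c / of_real (sqrt N)) * (\<Sum>b\<in>?I. M a b * v0 b)"
      unfolding sum_distrib_left by (intro sum.cong refl) (simp add: v_def)
    then show ?thesis using ev0[OF that] by (simp add: v_def)
  qed
  obtain u where u: "onb ?I ?I u" and uk: "\<And>a. a \<in> ?I \<Longrightarrow> u k a = v a"
    using onb_extending_vector[OF fin kI vn vk] by blast
  \<comment> \<open>The matrix of M in the rotated basis. Its column k is \<mu> times a unit vector,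
    and hermiticity gives the same for the row.\<close>
  define M' where "M' c d = (\<Sum>a\<in>?I. \<Sum>b\<in>?I. cnj (u c a) * M a b * u d b)" for c d
  have hM: "cnj (M a b) = M b a" if "a \<in> ?I" "b \<in> ?I" for a b
    using insert.prems that unfolding herm_def by metis
  have herm': "M' d c = cnj (M' c d)" for c d
  proof -
    have "cnj (M' c d) = (\<Sum>a\<in>?I. \<Sum>b\<in>?I. u c a * M b a * cnj (u d b))"
      unfolding M'_def cnj_sum by (intro sum.cong refl) (simp add: hM)
    also have "\<dots> = M' d c" unfolding M'_def
      by (subst sum.swap, intro sum.cong refl) (simp add: mult_ac)
    finally show ?thesis by simp
  qed
  have col: "M' c k = \<mu> * kd c k" if "c \<in> ?I" for c
  proof -
    have "M' c k = (\<Sum>a\<in>?I. cnj (u c a) * (\<Sum>b\<in>?I. M a b * v b))"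
      unfolding M'_def sum_distrib_left by (intro sum.cong refl) (simp add: uk mult.assoc)
    also have "\<dots> = (\<Sum>a\<in>?I. cnj (u c a) * (\<mu> * u k a))"
      by (intro sum.cong refl) (simp only: ev uk)
    also have "\<dots> = \<mu> * (\<Sum>a\<in>?I. cnj (u c a) * u k a)"
      unfolding sum_distrib_left by (intro sum.cong refl) simp
    finally show ?thesis using onb_ortho[OF u that kI] by simp
  qed
  have mu: "\<mu> = of_real (Re \<mu>)" using herm'[of k k] col[OF kI] by (simp add: complex_eq_iff)
  obtain e p where e: "eigsys J J M' e p"
    using insert.IH[of M'] herm' unfolding herm_def by blast
  have "eigsys ?I ?I M' (\<lambda>j a. if j = k \<or> a = k then kd j a else e j a) (p(k := Re \<mu>))"
  proof (rule eigsys_insert[OF insert.hyps(2) e])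
    show "M' k k = complex_of_real (Re \<mu>)" using col[OF kI] mu by simp
    show *: "M' b k = 0" if "b \<in> J" for b using col[of b] that insert.hyps by (auto simp: kd_def)
    show "M' k b = 0" if "b \<in> J" for b using *[OF that] herm'[of k b] by simp
  qed
  moreover have "M a b = (\<Sum>c\<in>?I. \<Sum>d\<in>?I. u c a * M' c d * cnj (u d b))" if ab: "a \<in> ?I" "b \<in> ?I" for a b
  proof -
    have 1: "(\<Sum>c\<in>?I. u c a * M' c d) = (\<Sum>b\<in>?I. M a b * u d b)" for d
    proof -
      have "M' c d = (\<Sum>x\<in>?I. cnj (u c x) * (\<Sum>b\<in>?I. M x b * u d b))" for c
        unfolding M'_def sum_distrib_left by (simp add: mult.assoc)
      then show ?thesis using onb_expand[OF u ab(1), of "\<lambda>x. \<Sum>b\<in>?I. M x b * u d b"] by simp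
    qed
    have "(\<Sum>c\<in>?I. \<Sum>d\<in>?I. u c a * M' c d * cnj (u d b)) = (\<Sum>d\<in>?I. (\<Sum>c\<in>?I. u c a * M' c d) * cnj (u d b))"
      by (subst sum.swap) (simp only: sum_distrib_right)
    also have "\<dots> = (\<Sum>d\<in>?I. cnj (u d b) * (\<Sum>x\<in>?I. u d x * M a x))"
      unfolding 1 by (intro sum.cong refl) (simp only: mult.commute)
    also have "\<dots> = M a b"
      using onb_expand[OF onb_cnj[OF u] ab(2), of "M a"] by (simp only: complex_cnj_cnj)
    finally show ?thesis by simp
  qed
  ultimately show ?case using eigsys_change_basis[OF u] by blast
qed

subsection \<open>Entropy of Hermitian kernels\<close>

lemma onb_norm: "onb K I e \<Longrightarrow> k \<in> K \<Longrightarrow> (\<Sum>a\<in>I. (cmod (e k a))\<^sup>2) = 1"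
  using onb_ortho[of K I e k k] unfolding sum_cnj_mult_self by (metis kd_same of_real_eq_1_iff)

text \<open>The squared overlaps of the two eigenbases form a doubly stochastic array supported
  where the eigenvalues agree, so spectral sums coincide without matching eigenspaces.\<close>

lemma eigsys_sum_unique:
  fixes \<phi> :: "real \<Rightarrow> real"
  assumes e: "eigsys K I M e p" and f: "eigsys L I M f q"
  shows "(\<Sum>k\<in>K. \<phi> (p k)) = (\<Sum>l\<in>L. \<phi> (q l))"
proof -
  note oe = eigsys_onb[OF e] and of = eigsys_onb[OF f]
  define g where "g k l = (\<Sum>a\<in>I. cnj (e k a) * f l a)" for k l
  have pq: "(cmod (g k l))\<^sup>2 * \<phi> (p k) = (cmod (g k l))\<^sup>2 * \<phi> (q l)" if "k \<in> K" "l \<in> L" for k l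
  proof -
    have "of_real (p k) * g k l = (\<Sum>b\<in>I. (\<Sum>a\<in>I. cnj (e k a) * M a b) * f l b)"
      unfolding g_def sum_distrib_left
      by (intro sum.cong refl) (simp add: eigsys_apply_left[OF e that(1)])
    also have "\<dots> = (\<Sum>a\<in>I. cnj (e k a) * (\<Sum>b\<in>I. M a b * f l b))"
      unfolding sum_distrib_left sum_distrib_right mult.assoc by (rule sum.swap)
    also have "\<dots> = of_real (q l) * g k l"
      unfolding g_def sum_distrib_left[of "of_real (q l)"]
      by (intro sum.cong refl) (simp add: eigsys_apply[OF f that(2)])
    finally have "g k l = 0 \<or> p k = q l" by simp
    then show ?thesis by auto
  qed
  have 1: "(\<Sum>l\<in>L. (cmod (g k l))\<^sup>2) = 1" if "k \<in> K" for k
  proof -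
    have "(\<Sum>l\<in>L. (cmod (g k l))\<^sup>2) = (\<Sum>l\<in>L. (cmod (\<Sum>a\<in>I. f l a * cnj (e k a)))\<^sup>2)"
      by (simp add: g_def mult.commute)
    then show ?thesis using onb_norm[OF oe that] by (simp add: onb_parseval'[OF of])
  qed
  have 2: "(\<Sum>k\<in>K. (cmod (g k l))\<^sup>2) = 1" if "l \<in> L" for l
    unfolding g_def onb_parseval[OF oe] using onb_norm[OF of that] .
  have "(\<Sum>k\<in>K. \<phi> (p k)) = (\<Sum>k\<in>K. \<Sum>l\<in>L. (cmod (g k l))\<^sup>2 * \<phi> (p k))"
    by (intro sum.cong refl) (simp add: 1 flip: sum_distrib_right)
  also have "\<dots> = (\<Sum>k\<in>K. \<Sum>l\<in>L. (cmod (g k l))\<^sup>2 * \<phi> (q l))"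
    by (intro sum.cong refl pq)
  also have "\<dots> = (\<Sum>l\<in>L. \<Sum>k\<in>K. (cmod (g k l))\<^sup>2 * \<phi> (q l))" by (rule sum.swap)
  also have "\<dots> = (\<Sum>l\<in>L. \<phi> (q l))"
    by (intro sum.cong refl) (simp add: 2 flip: sum_distrib_right)
  finally show ?thesis .
qed

text \<open>For a Hermitian kernel on a finite set every eigensystem gives the same sum, also one
  with another label set, so the choice does not matter. No normalisation of the trace is built
  in.\<close>

definition ent :: "'a set \<Rightarrow> ('a \<Rightarrow> 'a \<Rightarrow> complex) \<Rightarrow> real" where
  "ent I M = (SOME s. \<exists>e p. eigsys I I M e p \<and> s = (\<Sum>k\<in>I. eta (p k)))"

lemma ent_eq:
  assumes "eigsys K I M e p"
  shows "ent I M = (\<Sum>k\<in>K. eta (p k))"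
proof -
  obtain e' p' where e': "eigsys I I M e' p'"
    using spectral_theorem[OF _ eigsys_herm[OF assms]] onb_finite[OF eigsys_onb[OF assms]] by blast
  have "\<exists>e p. eigsys I I M e p \<and> ent I M = (\<Sum>k\<in>I. eta (p k))"
    unfolding ent_def by (rule someI_ex) (use e' in blast)
  then obtain e'' p'' where *: "eigsys I I M e'' p''" "ent I M = (\<Sum>k\<in>I. eta (p'' k))" by blast
  then show ?thesis using eigsys_sum_unique[OF assms *(1), of eta] by simp
qed

lemma ent_cong:
  assumes "\<And>a b. a \<in> I \<Longrightarrow> b \<in> I \<Longrightarrow> M a b = N a b"
  shows "ent I M = ent I N"
proof -
  have "eigsys I I M = eigsys I I N" using assms by (auto simp: fun_eq_iff eigsys_def)
  then show ?thesis by (simp add: ent_def)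
qed

text \<open>For a vector \<psi> on a system and an environment R this is the partial trace over R;
  with R a mere label set, it writes a positive kernel as a sum of rank-one terms.\<close>

definition red :: "'r set \<Rightarrow> ('a \<Rightarrow> 'r \<Rightarrow> complex) \<Rightarrow> 'a \<Rightarrow> 'a \<Rightarrow> complex" where
  "red R \<psi> a b = (\<Sum>r\<in>R. \<psi> a r * cnj (\<psi> b r))"

lemma herm_red: "herm I (red R \<psi>)"
  by (simp add: herm_def red_def mult.commute)

text \<open>The squared moduli of \<open>g k l\<close> have row sums \<open>p k\<close> and column
  sums \<open>q l\<close> and vanish unless the two eigenvalues agree. As eta x is x times a
  function of x, both entropies become the same weighted double sum, from which zero eigenvalues
  drop out by themselves.\<close>

theorem ent_schmidt:
  assumes "finite A" "finite B"
  shows "ent A (red B \<psi>) = ent B (red A (\<lambda>b a. \<psi> a b))"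
proof -
  let ?M = "red B \<psi>" and ?N = "red A (\<lambda>b a. \<psi> a b)"
  obtain e p where e: "eigsys A A ?M e p" using spectral_theorem[OF assms(1) herm_red] by blast
  obtain f q where f: "eigsys B B ?N f q" using spectral_theorem[OF assms(2) herm_red] by blast
  note oe = eigsys_onb[OF e] and of = eigsys_onb[OF f]
  define y where "y k b = (\<Sum>a\<in>A. cnj (e k a) * \<psi> a b)" for k b
  define g where "g k l = (\<Sum>b\<in>B. cnj (f l b) * y k b)" for k l
  define \<theta> where "\<theta> x = (if x > 0 then - log 2 x else 0)" for x :: real
  have eta: "eta x = x * \<theta> x" for x by (simp add: eta_def \<theta>_def)
  have py: "of_real (p k) * y k b = (\<Sum>b'\<in>B. ?N b b' * y k b')" if "k \<in> A" "b \<in> B" for k b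
  proof -
    have "of_real (p k) * y k b = (\<Sum>a\<in>A. (\<Sum>a'\<in>A. cnj (e k a') * ?M a' a) * \<psi> a b)"
      unfolding y_def sum_distrib_left
      by (intro sum.cong refl) (simp add: eigsys_apply_left[OF e that(1)])
    also have "\<dots> = (\<Sum>a\<in>A. \<Sum>a'\<in>A. \<Sum>b'\<in>B. \<psi> a b * cnj (\<psi> a b') * (cnj (e k a') * \<psi> a' b'))"
      unfolding red_def sum_distrib_left sum_distrib_right by (intro sum.cong refl) (simp only: mult_ac)
    also have "\<dots> = (\<Sum>b'\<in>B. \<Sum>a\<in>A. \<Sum>a'\<in>A. \<psi> a b * cnj (\<psi> a b') * (cnj (e k a') * \<psi> a' b'))"
      by (subst sum.swap[of _ B A], intro sum.cong refl sum.swap)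
    also have "\<dots> = (\<Sum>b'\<in>B. ?N b b' * y k b')"
      unfolding red_def y_def sum_product by (intro sum.cong refl)
    finally show ?thesis .
  qed
  have pq: "(cmod (g k l))\<^sup>2 * \<theta> (p k) = (cmod (g k l))\<^sup>2 * \<theta> (q l)" if "k \<in> A" "l \<in> B" for k l
  proof -
    have "of_real (p k) * g k l = (\<Sum>b\<in>B. cnj (f l b) * (\<Sum>b'\<in>B. ?N b b' * y k b'))"
      unfolding g_def sum_distrib_left[of "of_real (p k)"]
      by (intro sum.cong refl) (simp add: mult.left_commute py[OF that(1), symmetric])
    also have "\<dots> = (\<Sum>b'\<in>B. (\<Sum>b\<in>B. cnj (f l b) * ?N b b') * y k b')"
      unfolding sum_distrib_left sum_distrib_right mult.assoc by (rule sum.swap)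
    also have "\<dots> = of_real (q l) * g k l"
      unfolding g_def sum_distrib_left[of "of_real (q l)"]
      by (intro sum.cong refl) (simp add: eigsys_apply_left[OF f that(2)])
    finally have "g k l = 0 \<or> p k = q l" by simp
    then show ?thesis by auto
  qed
  have 1: "(\<Sum>l\<in>B. (cmod (g k l))\<^sup>2) = p k" if k: "k \<in> A" for k
  proof -
    have "of_real (p k) = of_real (p k) * (\<Sum>a\<in>A. cnj (e k a) * e k a)"
      using onb_ortho[OF oe k k] by simp
    also have "\<dots> = (\<Sum>a\<in>A. (\<Sum>a'\<in>A. cnj (e k a') * ?M a' a) * e k a)"
      unfolding sum_distrib_left by (intro sum.cong refl) (simp add: eigsys_apply_left[OF e k])
    also have "\<dots> = (\<Sum>a\<in>A. \<Sum>a'\<in>A. \<Sum>b\<in>B. (cnj (\<psi> a b) * e k a) * (cnj (e k a') * \<psi> a' b))"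
      unfolding red_def sum_distrib_left sum_distrib_right by (intro sum.cong refl) (simp only: mult_ac)
    also have "\<dots> = (\<Sum>b\<in>B. \<Sum>a\<in>A. \<Sum>a'\<in>A. (cnj (\<psi> a b) * e k a) * (cnj (e k a') * \<psi> a' b))"
      by (subst sum.swap[of _ B A], intro sum.cong refl sum.swap)
    also have "\<dots> = (\<Sum>b\<in>B. cnj (y k b) * y k b)"
      unfolding y_def cnj_sum sum_product by (intro sum.cong refl) simp
    finally have "p k = (\<Sum>b\<in>B. (cmod (y k b))\<^sup>2)" unfolding sum_cnj_mult_self by (simp only: of_real_eq_iff)
    then show ?thesis unfolding g_def onb_parseval[OF of] by simp
  qed
  have 2: "(\<Sum>k\<in>A. (cmod (g k l))\<^sup>2) = q l" if l: "l \<in> B" for l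
  proof -
    have "g k l = (\<Sum>a\<in>A. cnj (e k a) * (\<Sum>b\<in>B. cnj (f l b) * \<psi> a b))" for k
      unfolding g_def y_def sum_distrib_left by (subst sum.swap) (intro sum.cong refl, simp only: mult_ac)
    then have *: "(\<Sum>k\<in>A. (cmod (g k l))\<^sup>2) = (\<Sum>a\<in>A. (cmod (\<Sum>b\<in>B. cnj (f l b) * \<psi> a b))\<^sup>2)"
      by (simp only: onb_parseval[OF oe])
    have "of_real (q l) = of_real (q l) * (\<Sum>b\<in>B. cnj (f l b) * f l b)"
      using onb_ortho[OF of l l] by simp
    also have "\<dots> = (\<Sum>b\<in>B. (\<Sum>b'\<in>B. cnj (f l b') * ?N b' b) * f l b)"
      unfolding sum_distrib_left by (intro sum.cong refl) (simp add: eigsys_apply_left[OF f l])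
    also have "\<dots> = (\<Sum>b\<in>B. \<Sum>b'\<in>B. \<Sum>a\<in>A. (f l b * cnj (\<psi> a b)) * (cnj (f l b') * \<psi> a b'))"
      unfolding red_def sum_distrib_left sum_distrib_right by (intro sum.cong refl) (simp only: mult_ac)
    also have "\<dots> = (\<Sum>a\<in>A. \<Sum>b\<in>B. \<Sum>b'\<in>B. (f l b * cnj (\<psi> a b)) * (cnj (f l b') * \<psi> a b'))"
      by (subst sum.swap[of _ A B], intro sum.cong refl sum.swap)
    also have "\<dots> = (\<Sum>a\<in>A. cnj (\<Sum>b\<in>B. cnj (f l b) * \<psi> a b) * (\<Sum>b\<in>B. cnj (f l b) * \<psi> a b))"
      unfolding cnj_sum sum_product by (intro sum.cong refl) simp
    finally show ?thesis unfolding sum_cnj_mult_self * by (simp only: of_real_eq_iff)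
  qed
  have "ent A ?M = (\<Sum>k\<in>A. \<Sum>l\<in>B. (cmod (g k l))\<^sup>2 * \<theta> (p k))"
    unfolding ent_eq[OF e] eta by (intro sum.cong refl) (simp add: 1 flip: sum_distrib_right)
  also have "\<dots> = (\<Sum>k\<in>A. \<Sum>l\<in>B. (cmod (g k l))\<^sup>2 * \<theta> (q l))"
    by (intro sum.cong refl pq)
  also have "\<dots> = (\<Sum>l\<in>B. \<Sum>k\<in>A. (cmod (g k l))\<^sup>2 * \<theta> (q l))" by (rule sum.swap)
  also have "\<dots> = ent B ?N"
    unfolding ent_eq[OF f] eta by (intro sum.cong refl) (simp add: 2 flip: sum_distrib_right)
  finally show ?thesis .
qed

text \<open>By the Schmidt symmetry the entropy depends only on the Gram matrix taken over the
  system, which is unchanged when the system is embedded isometrically elsewhere.\<close>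

lemma ent_gram_eq:
  assumes "finite A" "finite A'" "finite B"
    and "\<And>b b'. b \<in> B \<Longrightarrow> b' \<in> B \<Longrightarrow> (\<Sum>a\<in>A. \<psi> a b * cnj (\<psi> a b')) = (\<Sum>a\<in>A'. \<psi>' a b * cnj (\<psi>' a b'))"
  shows "ent A (red B \<psi>) = ent A' (red B \<psi>')"
  unfolding ent_schmidt[OF assms(1,3)] ent_schmidt[OF assms(2,3)]
  by (rule ent_cong) (simp add: red_def assms(4))

lemma eigsys_reindex:
  assumes h: "bij_betw h I J" and e: "eigsys K J M e p"
  shows "eigsys K I (\<lambda>a b. M (h a) (h b)) (\<lambda>k a. e k (h a)) p"
proof -
  note o = eigsys_onb[OF e]
  have fin: "finite K" "finite I" using onb_finite[OF o] bij_betw_finite[OF h] by auto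
  have hI: "h a \<in> J" if "a \<in> I" for a using h that by (auto simp: bij_betw_def)
  have kd: "kd (h a) (h b) = kd a b" if "a \<in> I" "b \<in> I" for a b
    using h that by (auto simp: kd_def bij_betw_def inj_on_def)
  have r: "(\<Sum>a\<in>I. F (h a)) = (\<Sum>a\<in>J. F a)" for F :: "_ \<Rightarrow> complex"
    by (rule sum.reindex_bij_betw[OF h])
  show ?thesis unfolding eigsys_def onb_def
  proof (intro conjI ballI)
    fix k l assume "k \<in> K" "l \<in> K"
    then show "(\<Sum>a\<in>I. cnj (e k (h a)) * e l (h a)) = kd k l"
      using r[of "\<lambda>a. cnj (e k a) * e l a"] by (simp add: onb_ortho[OF o])
  next
    fix a b assume "a \<in> I" "b \<in> I"
    then show "(\<Sum>k\<in>K. e k (h a) * cnj (e k (h b))) = kd a b"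
      "M (h a) (h b) = (\<Sum>k\<in>K. of_real (p k) * e k (h a) * cnj (e k (h b)))"
      by (simp_all add: onb_complete[OF o] hI kd eigsys_eq[OF e])
  qed (use fin in auto)
qed

lemma ent_reindex:
  assumes "bij_betw h I J" "finite J" "herm J M"
  shows "ent I (\<lambda>a b. M (h a) (h b)) = ent J M"
proof -
  obtain e p where e: "eigsys J J M e p" using spectral_theorem[OF assms(2,3)] by blast
  show ?thesis using ent_eq[OF e] ent_eq[OF eigsys_reindex[OF assms(1) e]] by simp
qed

definition qf :: "'a set \<Rightarrow> ('a \<Rightarrow> 'a \<Rightarrow> complex) \<Rightarrow> ('a \<Rightarrow> complex) \<Rightarrow> real" where
  "qf I M v = Re (\<Sum>a\<in>I. \<Sum>b\<in>I. cnj (v a) * M a b * v b)"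

text \<open>Hermiticity is a separate clause because \<open>qf\<close> records only the real part of
  the form, which an anti-Hermitian summand leaves unchanged.\<close>

definition pos :: "'a set \<Rightarrow> ('a \<Rightarrow> 'a \<Rightarrow> complex) \<Rightarrow> bool" where
  "pos I M \<longleftrightarrow> herm I M \<and> (\<forall>v. 0 \<le> qf I M v)"

definition tr :: "'a set \<Rightarrow> ('a \<Rightarrow> 'a \<Rightarrow> complex) \<Rightarrow> real" where
  "tr I M = (\<Sum>a\<in>I. Re (M a a))"

lemma qf_cong: "(\<And>a b. a \<in> I \<Longrightarrow> b \<in> I \<Longrightarrow> M a b = N a b) \<Longrightarrow> (\<And>a. a \<in> I \<Longrightarrow> v a = w a) \<Longrightarrow> qf I M v = qf I N w"
  unfolding qf_def by (intro arg_cong[where f=Re] sum.cong) auto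

lemma qf_eigsys:
  assumes e: "eigsys K I M e p"
  shows "qf I M v = (\<Sum>k\<in>K. p k * (cmod (\<Sum>a\<in>I. cnj (e k a) * v a))\<^sup>2)"
proof -
  have "(\<Sum>a\<in>I. \<Sum>b\<in>I. cnj (v a) * M a b * v b)
      = (\<Sum>a\<in>I. \<Sum>b\<in>I. \<Sum>k\<in>K. of_real (p k) * ((cnj (v a) * e k a) * (cnj (e k b) * v b)))"
    by (intro sum.cong refl) (simp add: eigsys_eq[OF e] sum_distrib_left sum_distrib_right mult_ac)
  also have "\<dots> = (\<Sum>k\<in>K. \<Sum>a\<in>I. \<Sum>b\<in>I. of_real (p k) * ((cnj (v a) * e k a) * (cnj (e k b) * v b)))"
    by (subst sum.swap[of _ K I], intro sum.cong refl sum.swap)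
  also have "\<dots> = (\<Sum>k\<in>K. of_real (p k) * (cnj (\<Sum>a\<in>I. cnj (e k a) * v a) * (\<Sum>b\<in>I. cnj (e k b) * v b)))"
    unfolding cnj_sum unfolding sum_product unfolding sum_distrib_left by (intro sum.cong refl) (simp add: mult.commute)
  also have "\<dots> = of_real (\<Sum>k\<in>K. p k * (cmod (\<Sum>a\<in>I. cnj (e k a) * v a))\<^sup>2)"
    unfolding cnj_mult_self by simp
  finally show ?thesis unfolding qf_def by (simp only: Re_complex_of_real)
qed

lemma qf_eigenvector:
  assumes e: "eigsys K I M e p" and k: "k \<in> K"
  shows "qf I M (e k) = p k"
proof -
  note o = eigsys_onb[OF e]
  have "qf I M (e k) = (\<Sum>l\<in>K. if l = k then p l else 0)"
    unfolding qf_eigsys[OF e] by (intro sum.cong refl) (auto simp: onb_ortho[OF o] k kd_def)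
  then show ?thesis using k onb_finite[OF o] by simp
qed

lemma pos_eigen_nonneg:
  assumes "pos I M" "eigsys K I M e p" "k \<in> K"
  shows "0 \<le> p k"
  using assms(1) unfolding qf_eigenvector[OF assms(2,3), symmetric] pos_def by blast

lemma pos_obtain_eigsys:
  assumes "finite I" "pos I M"
  obtains e p where "eigsys I I M e p" "\<And>k. k \<in> I \<Longrightarrow> 0 \<le> p k"
  using spectral_theorem[of I M] pos_eigen_nonneg[of I M] assms by (metis pos_def)

lemma qf_red: "qf I (red R \<psi>) v = (\<Sum>r\<in>R. (cmod (\<Sum>a\<in>I. cnj (v a) * \<psi> a r))\<^sup>2)"
proof -
  have "(\<Sum>a\<in>I. \<Sum>b\<in>I. cnj (v a) * red R \<psi> a b * v b)
      = (\<Sum>a\<in>I. \<Sum>b\<in>I. \<Sum>r\<in>R. (cnj (v a) * \<psi> a r) * (v b * cnj (\<psi> b r)))"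
    unfolding red_def sum_distrib_left sum_distrib_right by (intro sum.cong refl) (simp only: mult_ac)
  also have "\<dots> = (\<Sum>r\<in>R. \<Sum>a\<in>I. \<Sum>b\<in>I. (cnj (v a) * \<psi> a r) * (v b * cnj (\<psi> b r)))"
    by (subst sum.swap[of _ R I], intro sum.cong refl sum.swap)
  also have "\<dots> = (\<Sum>r\<in>R. (\<Sum>a\<in>I. cnj (v a) * \<psi> a r) * cnj (\<Sum>a\<in>I. cnj (v a) * \<psi> a r))"
    unfolding cnj_sum sum_product by (intro sum.cong refl) simp
  finally show ?thesis unfolding qf_def mult_cnj_self by simp
qed

lemma pos_red: "pos I (red R \<psi>)"
  by (simp add: pos_def herm_red qf_red sum_nonneg)

lemma pos_cong: "pos I M \<Longrightarrow> (\<And>a b. a \<in> I \<Longrightarrow> b \<in> I \<Longrightarrow> M a b = N a b) \<Longrightarrow> pos I N"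
  using qf_cong[of I M N] unfolding pos_def herm_def by metis

lemma tr_eigsys:
  assumes e: "eigsys K I M e p"
  shows "tr I M = (\<Sum>k\<in>K. p k)"
proof -
  note o = eigsys_onb[OF e]
  have "tr I M = (\<Sum>a\<in>I. \<Sum>k\<in>K. p k * (cmod (e k a))\<^sup>2)"
    unfolding tr_def by (intro sum.cong refl) (simp add: eigsys_eq[OF e] mult.assoc mult_cnj_self flip: of_real_power of_real_mult)
  also have "\<dots> = (\<Sum>k\<in>K. \<Sum>a\<in>I. p k * (cmod (e k a))\<^sup>2)" by (rule sum.swap)
  also have "\<dots> = (\<Sum>k\<in>K. p k)"
    by (intro sum.cong refl) (simp add: onb_norm[OF o] flip: sum_distrib_left)
  finally show ?thesis .
qed

subsection \<open>A variational form of relative entropy\<close>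

text \<open>The resolvent-type functional whose supremum over Z is, for each t, the integrand
  of the relative entropy of \<rho> and \<sigma> in its integral representation
  ln x = \<integral> 1/(1+t) - 1/(x+t) dt.  Everything about relative entropy that is needed follows because
  this functional is linear in the pair \<rho>, \<sigma>.\<close>
definition resf :: "real \<Rightarrow> 'a set \<Rightarrow> ('a \<Rightarrow> 'a \<Rightarrow> complex) \<Rightarrow> ('a \<Rightarrow> 'a \<Rightarrow> complex) \<Rightarrow> ('a \<Rightarrow> 'a \<Rightarrow> complex) \<Rightarrow> real" where
  "resf t I \<rho> \<sigma> Z = 2 * Re (\<Sum>a\<in>I. \<Sum>b\<in>I. cnj (Z a b) * \<rho> a b)
     - (\<Sum>b\<in>I. qf I \<sigma> (\<lambda>a. Z a b)) - t * (\<Sum>a\<in>I. qf I \<rho> (\<lambda>b. cnj (Z a b)))"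

text \<open>In the eigenbases e of \<rho> and f of \<sigma> the functional splits into one scalar
  quadratic for each pair (i, j), whose variable x i j is the entry of Z between f j and e
  i.\<close>

lemma resf_eigsys:
  fixes Z :: "'a \<Rightarrow> 'a \<Rightarrow> complex"
  assumes e: "eigsys K I \<rho> e p" and f: "eigsys J I \<sigma> f q"
  defines "x \<equiv> \<lambda>i j. \<Sum>a\<in>I. cnj (f j a) * (\<Sum>b\<in>I. Z a b * e i b)"
    and "g \<equiv> \<lambda>i j. \<Sum>a\<in>I. cnj (f j a) * e i a"
  shows "resf t I \<rho> \<sigma> Z = (\<Sum>i\<in>K. \<Sum>j\<in>J. 2 * p i * Re (cnj (x i j) * g i j)
    - q j * (cmod (x i j))\<^sup>2 - t * (p i * (cmod (x i j))\<^sup>2))"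
proof -
  note oe = eigsys_onb[OF e] and of = eigsys_onb[OF f]
  have 1: "(\<Sum>a\<in>I. \<Sum>b\<in>I. cnj (Z a b) * \<rho> a b) = (\<Sum>i\<in>K. of_real (p i) * (\<Sum>j\<in>J. cnj (x i j) * g i j))"
  proof -
    have "(\<Sum>i\<in>K. of_real (p i) * (\<Sum>j\<in>J. cnj (x i j) * g i j))
      = (\<Sum>i\<in>K. of_real (p i) * (\<Sum>a\<in>I. cnj (\<Sum>b\<in>I. Z a b * e i b) * e i a))"
      unfolding x_def g_def onb_bilinear[OF of] ..
    also have "\<dots> = (\<Sum>i\<in>K. \<Sum>a\<in>I. \<Sum>b\<in>I. cnj (Z a b) * (of_real (p i) * e i a * cnj (e i b)))"
      unfolding sum_distrib_left sum_distrib_right cnj_sum by (intro sum.cong refl) simp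
    also have "\<dots> = (\<Sum>a\<in>I. \<Sum>b\<in>I. \<Sum>i\<in>K. cnj (Z a b) * (of_real (p i) * e i a * cnj (e i b)))"
      by (subst sum.swap[of _ I K], intro sum.cong refl sum.swap)
    also have "\<dots> = (\<Sum>a\<in>I. \<Sum>b\<in>I. cnj (Z a b) * \<rho> a b)"
      by (intro sum.cong refl) (simp add: eigsys_eq[OF e] sum_distrib_left)
    finally show ?thesis by simp
  qed
  have 2: "(\<Sum>b\<in>I. qf I \<sigma> (\<lambda>a. Z a b)) = (\<Sum>i\<in>K. \<Sum>j\<in>J. q j * (cmod (x i j))\<^sup>2)"
  proof -
    have "(\<Sum>b\<in>I. qf I \<sigma> (\<lambda>a. Z a b)) = (\<Sum>j\<in>J. q j * (\<Sum>b\<in>I. (cmod (\<Sum>a\<in>I. cnj (f j a) * Z a b))\<^sup>2))"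
      unfolding qf_eigsys[OF f] sum_distrib_left by (rule sum.swap)
    also have "\<dots> = (\<Sum>j\<in>J. q j * (\<Sum>i\<in>K. (cmod (\<Sum>b\<in>I. e i b * (\<Sum>a\<in>I. cnj (f j a) * Z a b)))\<^sup>2))"
      unfolding onb_parseval'[OF oe] ..
    also have "\<dots> = (\<Sum>j\<in>J. q j * (\<Sum>i\<in>K. (cmod (x i j))\<^sup>2))"
    proof (intro sum.cong refl arg_cong2[where f="(*)"] arg_cong[where f="\<lambda>x. (cmod x)\<^sup>2"])
      fix i j
      show "(\<Sum>b\<in>I. e i b * (\<Sum>a\<in>I. cnj (f j a) * Z a b)) = x i j"
        unfolding x_def sum_distrib_left by (subst sum.swap, intro sum.cong refl) (simp only: mult_ac)
    qed
    also have "\<dots> = (\<Sum>i\<in>K. \<Sum>j\<in>J. q j * (cmod (x i j))\<^sup>2)"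
      unfolding sum_distrib_left by (rule sum.swap)
    finally show ?thesis .
  qed
  have 3: "(\<Sum>a\<in>I. qf I \<rho> (\<lambda>b. cnj (Z a b))) = (\<Sum>i\<in>K. \<Sum>j\<in>J. p i * (cmod (x i j))\<^sup>2)"
  proof -
    have "(\<Sum>a\<in>I. qf I \<rho> (\<lambda>b. cnj (Z a b)))
       = (\<Sum>i\<in>K. p i * (\<Sum>a\<in>I. (cmod (\<Sum>b\<in>I. cnj (e i b) * cnj (Z a b)))\<^sup>2))"
      unfolding qf_eigsys[OF e] sum_distrib_left by (rule sum.swap)
    also have "\<dots> = (\<Sum>i\<in>K. p i * (\<Sum>a\<in>I. (cmod (\<Sum>b\<in>I. Z a b * e i b))\<^sup>2))"
    proof (intro sum.cong refl arg_cong2[where f="(*)"])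
      fix i a
      have "(\<Sum>b\<in>I. cnj (e i b) * cnj (Z a b)) = cnj (\<Sum>b\<in>I. Z a b * e i b)" by (simp add: mult.commute)
      then show "(cmod (\<Sum>b\<in>I. cnj (e i b) * cnj (Z a b)))\<^sup>2 = (cmod (\<Sum>b\<in>I. Z a b * e i b))\<^sup>2"
        by (simp only: complex_mod_cnj)
    qed
    also have "\<dots> = (\<Sum>i\<in>K. p i * (\<Sum>j\<in>J. (cmod (x i j))\<^sup>2))"
      unfolding x_def onb_parseval[OF of] ..
    finally show ?thesis by (simp only: sum_distrib_left)
  qed
  have "2 * Re (\<Sum>i\<in>K. of_real (p i) * (\<Sum>j\<in>J. cnj (x i j) * g i j))
    = (\<Sum>i\<in>K. \<Sum>j\<in>J. 2 * p i * Re (cnj (x i j) * g i j))"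
    by (simp add: sum_distrib_left mult.assoc)
  then show ?thesis unfolding resf_def 1 2 3
    by (simp only: sum_subtractf sum_distrib_left)
qed

text \<open>Models a finite measure with masses w at the points r: the spectral distribution of the
  relative modular operator, whose eigenvalues are ratios of eigenvalues of \<sigma> and \<rho>. The
  last two clauses say that the maximum of \<open>resf\<close> over Z is the Stieltjes transform of
  this measure, and d is its logarithmic integral.\<close>

definition relrep :: "'a set \<Rightarrow> ('a \<Rightarrow> 'a \<Rightarrow> complex) \<Rightarrow> ('a \<Rightarrow> 'a \<Rightarrow> complex) \<Rightarrow> real
    \<Rightarrow> 's set \<Rightarrow> ('s \<Rightarrow> real) \<Rightarrow> ('s \<Rightarrow> real) \<Rightarrow> bool" where
  "relrep I \<rho> \<sigma> d S w r \<longleftrightarrow> (\<forall>s\<in>S. w s > 0 \<and> r s > 0) \<and>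
     sum w S = tr I \<rho> \<and> d = (\<Sum>s\<in>S. w s * ln (r s)) \<and>
     (\<forall>t>0. \<forall>Z. resf t I \<rho> \<sigma> Z \<le> (\<Sum>s\<in>S. w s / (r s + t))) \<and>
     (\<forall>t>0. \<exists>Z. resf t I \<rho> \<sigma> Z = (\<Sum>s\<in>S. w s / (r s + t)))"

text \<open>The number d is minus the (natural) relative entropy of \<rho> and \<sigma>.\<close>
definition reldata :: "'a set \<Rightarrow> ('a \<Rightarrow> 'a \<Rightarrow> complex) \<Rightarrow> ('a \<Rightarrow> 'a \<Rightarrow> complex) \<Rightarrow> real \<Rightarrow> bool" where
  "reldata I \<rho> \<sigma> d \<longleftrightarrow> (\<exists>(S :: ('a \<times> 'a) set) w r. relrep I \<rho> \<sigma> d S w r)"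

text \<open>The pair (i, j) gets mass p i times the squared overlap of the eigenvectors, placed at q
  j / p i. The support condition excludes positive mass at q j = 0, where the logarithm would
  diverge.\<close>

lemma reldata_eigsys:
  fixes I :: "'a set"
  assumes e: "eigsys I I \<rho> e p" and f: "eigsys I I \<sigma> f q"
    and p: "\<And>i. i \<in> I \<Longrightarrow> 0 \<le> p i" and q: "\<And>j. j \<in> I \<Longrightarrow> 0 \<le> q j"
    and supp: "\<And>j. j \<in> I \<Longrightarrow> q j = 0 \<Longrightarrow> qf I \<rho> (f j) = 0"
  shows "reldata I \<rho> \<sigma> ((\<Sum>j\<in>I. ln (q j) * qf I \<rho> (f j)) - (\<Sum>i\<in>I. p i * ln (p i)))"
proof -
  note oe = eigsys_onb[OF e] and of = eigsys_onb[OF f]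
  have fin: "finite I" using onb_finite[OF oe] by simp
  define g where "g i j = (\<Sum>a\<in>I. cnj (f j a) * e i a)" for i j
  define c where "c i j = (cmod (g i j))\<^sup>2" for i j
  have qf: "qf I \<rho> (f j) = (\<Sum>i\<in>I. p i * c i j)" for j
  proof -
    have "cmod (\<Sum>a\<in>I. cnj (e i a) * f j a) = cmod (g i j)" for i
    proof -
      have "(\<Sum>a\<in>I. cnj (e i a) * f j a) = cnj (g i j)" by (simp add: g_def mult.commute)
      then show ?thesis by simp
    qed
    then show ?thesis by (simp add: qf_eigsys[OF e] c_def)
  qed
  have c1: "(\<Sum>j\<in>I. c i j) = 1" if "i \<in> I" for i
    unfolding c_def g_def onb_parseval[OF of] using onb_norm[OF oe that] .
  have qpos: "q j > 0" if "i \<in> I" "j \<in> I" "p i * c i j \<noteq> 0" for i j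
  proof (rule ccontr)
    assume "\<not> q j > 0"
    then have "(\<Sum>i\<in>I. p i * c i j) = 0" using q[OF that(2)] supp[OF that(2)] qf by simp
    then have "\<forall>i\<in>I. p i * c i j = 0"
      using fin p by (subst (asm) sum_nonneg_eq_0_iff) (auto simp: c_def)
    then show False using that by auto
  qed
  \<comment> \<open>Pairs without mass are removed; on the remaining ones both p i and q j are
    positive.\<close>
  define S where "S = {s \<in> I \<times> I. p (fst s) * c (fst s) (snd s) \<noteq> 0}"
  define w where "w s = p (fst s) * c (fst s) (snd s)" for s
  define r where "r s = q (snd s) / p (fst s)" for s
  have S: "finite S" "S \<subseteq> I \<times> I" using fin by (auto simp: S_def)
  have ext: "(\<Sum>s\<in>S. F s) = (\<Sum>i\<in>I. \<Sum>j\<in>I. F (i, j))" if "\<And>s. w s = 0 \<Longrightarrow> s \<in> I \<times> I \<Longrightarrow> F s = 0" for F :: "_ \<Rightarrow> real"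
    unfolding sum.cartesian_product using fin that
    by (subst sum.mono_neutral_left[of "I \<times> I" S F]) (auto simp: S_def w_def)
  have pp: "p i > 0" if "i \<in> I" "w (i, j) \<noteq> 0" for i j
    using p[OF that(1)] that(2) by (cases "p i = 0") (auto simp: w_def)
  have qq: "q j > 0" if "i \<in> I" "j \<in> I" "w (i, j) \<noteq> 0" for i j
    using qpos[of i j] that by (simp add: w_def)
  have wn: "0 \<le> w (i, j)" if "i \<in> I" for i j
    using p[OF that] by (simp add: w_def c_def)
  have pos: "w s > 0 \<and> r s > 0" if "s \<in> S" for s
  proof -
    have "fst s \<in> I" "snd s \<in> I" "w s \<noteq> 0" using that by (auto simp: S_def w_def)
    then show ?thesis using pp[of "fst s" "snd s"] qq[of "fst s" "snd s"] wn[of "fst s" "snd s"]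
      by (simp add: r_def)
  qed
  have sumw: "sum w S = tr I \<rho>"
    by (subst ext) (auto simp: tr_eigsys[OF e] w_def c1 simp flip: sum_distrib_left)
  have d: "(\<Sum>j\<in>I. ln (q j) * qf I \<rho> (f j)) - (\<Sum>i\<in>I. p i * ln (p i)) = (\<Sum>s\<in>S. w s * ln (r s))"
  proof -
    have "(\<Sum>s\<in>S. w s * ln (r s)) = (\<Sum>i\<in>I. \<Sum>j\<in>I. w (i, j) * ln (q j) - w (i, j) * ln (p i))"
    proof (subst ext, simp, intro sum.cong refl)
      fix i j assume ij: "i \<in> I" "j \<in> I"
      show "w (i, j) * ln (r (i, j)) = w (i, j) * ln (q j) - w (i, j) * ln (p i)"
      proof (cases "w (i, j) = 0")
        case False
        then show ?thesis using pp[OF ij(1) False] qq[OF ij False]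
          by (simp add: r_def ln_div right_diff_distrib)
      qed simp
    qed
    also have "\<dots> = (\<Sum>i\<in>I. \<Sum>j\<in>I. w (i, j) * ln (q j)) - (\<Sum>i\<in>I. \<Sum>j\<in>I. w (i, j) * ln (p i))"
      by (simp only: sum_subtractf)
    also have "(\<Sum>i\<in>I. \<Sum>j\<in>I. w (i, j) * ln (q j)) = (\<Sum>j\<in>I. ln (q j) * qf I \<rho> (f j))"
      unfolding qf sum_distrib_left by (subst sum.swap) (simp add: w_def mult_ac)
    also have "(\<Sum>i\<in>I. \<Sum>j\<in>I. w (i, j) * ln (p i)) = (\<Sum>i\<in>I. p i * ln (p i))"
    proof (intro sum.cong refl)
      fix i assume "i \<in> I"
      have "(\<Sum>j\<in>I. w (i, j) * ln (p i)) = p i * ln (p i) * (\<Sum>j\<in>I. c i j)"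
        unfolding sum_distrib_left by (intro sum.cong refl) (simp add: w_def)
      then show "(\<Sum>j\<in>I. w (i, j) * ln (p i)) = p i * ln (p i)" using c1[OF \<open>i \<in> I\<close>] by simp
    qed
    finally show ?thesis by simp
  qed
  have term_eq: "w (i, j) / (r (i, j) + t) = (p i)\<^sup>2 * c i j / (q j + t * p i)" if "i \<in> I" "p i \<noteq> 0" for i j t
    using that by (simp add: w_def r_def field_simps power2_eq_square)
  have upper: "resf t I \<rho> \<sigma> Z \<le> (\<Sum>s\<in>S. w s / (r s + t))" if t: "t > 0" for t Z
  proof -
    define x where "x i j = (\<Sum>a\<in>I. cnj (f j a) * (\<Sum>b\<in>I. Z a b * e i b))" for i j
    have "resf t I \<rho> \<sigma> Z = (\<Sum>i\<in>I. \<Sum>j\<in>I. 2 * p i * Re (cnj (x i j) * g i j)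
      - q j * (cmod (x i j))\<^sup>2 - t * (p i * (cmod (x i j))\<^sup>2))"
      unfolding x_def g_def by (rule resf_eigsys[OF e f])
    also have "\<dots> \<le> (\<Sum>i\<in>I. \<Sum>j\<in>I. w (i, j) / (r (i, j) + t))"
    proof (intro sum_mono)
      fix i j assume ij: "i \<in> I" "j \<in> I"
      show "2 * p i * Re (cnj (x i j) * g i j) - q j * (cmod (x i j))\<^sup>2 - t * (p i * (cmod (x i j))\<^sup>2)
         \<le> w (i, j) / (r (i, j) + t)"
      proof (cases "p i = 0")
        case True
        then show ?thesis using q[OF ij(2)] by (simp add: w_def)
      next
        case False
        define D where "D = q j + t * p i"
        define X where "X = cmod (x i j)"
        define G where "G = cmod (g i j)"
        have p0: "p i > 0" using False p[OF ij(1)] by simp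
        then have D: "D > 0" using q[OF ij(2)] t by (auto simp: D_def intro: add_nonneg_pos)
        have "Re (cnj (x i j) * g i j) \<le> X * G"
          using complex_Re_le_cmod[of "cnj (x i j) * g i j"] by (simp add: norm_mult X_def G_def)
        then have "2 * p i * Re (cnj (x i j) * g i j) \<le> 2 * p i * (X * G)"
          using p0 by simp
        then have "2 * p i * Re (cnj (x i j) * g i j) - q j * X\<^sup>2 - t * (p i * X\<^sup>2) \<le> 2 * p i * (X * G) - D * X\<^sup>2"
          by (simp add: D_def algebra_simps)
        \<comment> \<open>Completing the square in X; equality holds at X = p i * G / D.\<close>
        also have "\<dots> \<le> (p i)\<^sup>2 * G\<^sup>2 / D"
        proof -
          have "(2 * p i * (X * G) - D * X\<^sup>2) * D = (p i)\<^sup>2 * G\<^sup>2 - (p i * G - D * X)\<^sup>2"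
            by (simp add: power2_eq_square algebra_simps)
          also have "\<dots> \<le> (p i)\<^sup>2 * G\<^sup>2" by simp
          finally show ?thesis using D by (simp add: pos_le_divide_eq)
        qed
        also have "\<dots> = w (i, j) / (r (i, j) + t)"
          using term_eq[OF ij(1) False] by (simp add: D_def G_def c_def)
        finally show ?thesis by (simp add: X_def)
      qed
    qed
    also have "\<dots> = (\<Sum>s\<in>S. w s / (r s + t))" by (rule ext[symmetric]) simp
    finally show ?thesis .
  qed
  have attain: "\<exists>Z. resf t I \<rho> \<sigma> Z = (\<Sum>s\<in>S. w s / (r s + t))" if t: "t > 0" for t
  proof -
    \<comment> \<open>The maximiser of each scalar quadratic, reassembled into a kernel Z from its
      coefficients in the two bases. For p i = 0 the quadratic has its maximum 0 at 0.\<close>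
    define y where "y i j = (if p i = 0 then 0 else of_real (p i / (q j + t * p i)) * g i j)" for i j
    define Z where "Z a b = (\<Sum>i\<in>I. (\<Sum>j\<in>I. f j a * y i j) * cnj (e i b))" for a b
    have x: "(\<Sum>a\<in>I. cnj (f j a) * (\<Sum>b\<in>I. Z a b * e i b)) = y i j" if ij: "i \<in> I" "j \<in> I" for i j
    proof -
      have 1: "(\<Sum>b\<in>I. Z a b * e i b) = (\<Sum>j\<in>I. f j a * y i j)" for a
      proof -
        have "(\<Sum>b\<in>I. Z a b * e i b) = (\<Sum>k\<in>I. (\<Sum>j\<in>I. f j a * y k j) * (\<Sum>b\<in>I. cnj (e k b) * e i b))"
          unfolding Z_def sum_distrib_right[of _ _ "e i _"] unfolding sum_distrib_left[of _ _ I] mult.assoc by (rule sum.swap)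
        also have "\<dots> = (\<Sum>k\<in>I. (\<Sum>j\<in>I. f j a * y k j) * kd k i)"
          by (intro sum.cong refl) (simp add: onb_ortho[OF oe] ij)
        finally show ?thesis using fin ij by simp
      qed
      have "(\<Sum>a\<in>I. cnj (f j a) * (\<Sum>j\<in>I. f j a * y i j)) = (\<Sum>k\<in>I. (\<Sum>a\<in>I. cnj (f j a) * f k a) * y i k)"
        unfolding sum_distrib_left sum_distrib_right mult.assoc by (rule sum.swap)
      also have "\<dots> = (\<Sum>k\<in>I. kd j k * y i k)"
        by (intro sum.cong refl) (simp add: onb_ortho[OF of] ij)
      finally show ?thesis unfolding 1 using fin ij by simp
    qed
    have "resf t I \<rho> \<sigma> Z = (\<Sum>i\<in>I. \<Sum>j\<in>I. 2 * p i * Re (cnj (y i j) * g i j)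
      - q j * (cmod (y i j))\<^sup>2 - t * (p i * (cmod (y i j))\<^sup>2))"
      unfolding resf_eigsys[OF e f] g_def by (intro sum.cong refl) (simp add: x)
    also have "\<dots> = (\<Sum>i\<in>I. \<Sum>j\<in>I. w (i, j) / (r (i, j) + t))"
    proof (intro sum.cong refl)
      fix i j assume ij: "i \<in> I" "j \<in> I"
      show "2 * p i * Re (cnj (y i j) * g i j) - q j * (cmod (y i j))\<^sup>2 - t * (p i * (cmod (y i j))\<^sup>2)
         = w (i, j) / (r (i, j) + t)"
      proof (cases "p i = 0")
        case True
        then show ?thesis by (simp add: w_def y_def)
      next
        case False
        define D where "D = q j + t * p i"
        define u where "u = p i / D"
        have p0: "p i > 0" using False p[OF ij(1)] by simp
        then have D: "D > 0" using q[OF ij(2)] t by (auto simp: D_def intro: add_nonneg_pos)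
        have y: "y i j = of_real u * g i j" using False by (simp add: y_def u_def D_def)
        have "cnj (y i j) * g i j = of_real (u * c i j)"
          unfolding y c_def by (simp add: mult.assoc cnj_mult_self)
        then have 1: "Re (cnj (y i j) * g i j) = u * c i j" by (simp only: Re_complex_of_real)
        have 2: "(cmod (y i j))\<^sup>2 = u\<^sup>2 * c i j" unfolding y c_def by (simp add: norm_mult power_mult_distrib)
        have "2 * p i * (u * c i j) - q j * (u\<^sup>2 * c i j) - t * (p i * (u\<^sup>2 * c i j)) = c i j * (2 * p i * u - D * u * u)"
          by (simp add: D_def power2_eq_square algebra_simps)
        also have "D * u = p i" using D by (simp add: u_def)
        also have "c i j * (2 * p i * u - p i * u) = (p i)\<^sup>2 * c i j / D" by (simp add: u_def power2_eq_square)
        finally show ?thesis unfolding 1 2 term_eq[OF ij(1) False] D_def .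
      qed
    qed
    also have "\<dots> = (\<Sum>s\<in>S. w s / (r s + t))" by (rule ext[symmetric]) simp
    finally show ?thesis by blast
  qed
  have "relrep I \<rho> \<sigma> ((\<Sum>j\<in>I. ln (q j) * qf I \<rho> (f j)) - (\<Sum>i\<in>I. p i * ln (p i))) S w r"
    unfolding relrep_def using pos sumw d upper attain by simp
  then show ?thesis unfolding reldata_def by blast
qed

text \<open>Serves as the second summand of \<open>reldata_mono\<close> when only one pair is to be
  compared.\<close>

lemma reldata_empty: "reldata {} \<rho> \<sigma> 0"
  unfolding reldata_def relrep_def
  by (rule exI[of _ "{}"]) (simp add: tr_def resf_def)

section \<open>From resolvent inequalities to logarithmic inequalities\<close>

lemma DERIV_sum_ln:
  fixes v u :: "'z \<Rightarrow> real"
  assumes "\<forall>s\<in>A. v s > 0 \<and> u s > 0" "t \<ge> 0"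
  shows "((\<lambda>t. \<Sum>s\<in>A. v s * ln (u s + t)) has_real_derivative (\<Sum>s\<in>A. v s / (u s + t))) (at t)"
proof (intro DERIV_sum)
  fix s assume "s \<in> A"
  then have "u s + t > 0" using assms by (auto intro: add_pos_nonneg)
  then show "((\<lambda>t. v s * ln (u s + t)) has_real_derivative v s / (u s + t)) (at t)"
    by (auto intro!: derivative_eq_intros)
qed

lemma tendsto_sum_ln_shift:
  fixes v u :: "'z \<Rightarrow> real"
  assumes "\<forall>s\<in>A. v s > 0 \<and> u s > 0"
  shows "((\<lambda>t. \<Sum>s\<in>A. v s * (ln (u s + t) - ln t)) \<longlongrightarrow> 0) at_top"
proof -
  have "((\<lambda>t. \<Sum>s\<in>A. v s * (ln (u s + t) - ln t)) \<longlongrightarrow> (\<Sum>s\<in>A. v s * 0)) at_top"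
  proof (intro tendsto_sum tendsto_mult tendsto_const)
    fix s assume "s \<in> A"
    have "((\<lambda>t. u s / t) \<longlongrightarrow> 0) at_top"
      by (intro tendsto_divide_0[OF tendsto_const] filterlim_at_top_imp_at_infinity filterlim_ident)
    then have "((\<lambda>t. ln (u s / t + 1)) \<longlongrightarrow> ln (0 + 1)) at_top"
      by (intro tendsto_ln tendsto_add tendsto_const) simp_all
    moreover have "\<forall>\<^sub>F t in at_top. ln (u s / t + 1) = ln (u s + t) - ln t"
      using eventually_gt_at_top[of 0]
    proof eventually_elim
      case (elim t)
      then have "u s / t + 1 = (u s + t) / t" by (simp add: field_simps)
      moreover have "u s + t > 0" using elim assms \<open>s \<in> A\<close> by (auto intro: add_pos_pos)
      ultimately show ?case using elim by (simp add: ln_div)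
    qed
    ultimately show "((\<lambda>t. ln (u s + t) - ln t) \<longlongrightarrow> 0) at_top"
      using tendsto_cong[of "\<lambda>t. ln (u s / t + 1)"] by simp
  qed
  then show ?thesis by simp
qed

text \<open>The difference h of the logarithmic sums, with all points shifted by t, has as
  derivative the difference of the resolvent sums and is therefore increasing. Equal total masses
  cancel the ln t growth, so h tends to 0 and h 0 is at most 0. This plays the part of the integral
  representation of the logarithm.\<close>

lemma sum_ln_mono:
  fixes w r :: "'x \<Rightarrow> real" and w1 r1 :: "'y \<Rightarrow> real" and w2 r2 :: "'z \<Rightarrow> real"
  assumes pos: "\<forall>s\<in>S. w s > 0 \<and> r s > 0" "\<forall>s\<in>S1. w1 s > 0 \<and> r1 s > 0" "\<forall>s\<in>S2. w2 s > 0 \<and> r2 s > 0"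
    and tot: "sum w S = sum w1 S1 + sum w2 S2"
    and le: "\<And>t. t > 0 \<Longrightarrow> (\<Sum>s\<in>S. w s / (r s + t)) \<le> (\<Sum>s\<in>S1. w1 s / (r1 s + t)) + (\<Sum>s\<in>S2. w2 s / (r2 s + t))"
  shows "(\<Sum>s\<in>S1. w1 s * ln (r1 s)) + (\<Sum>s\<in>S2. w2 s * ln (r2 s)) \<le> (\<Sum>s\<in>S. w s * ln (r s))"
proof -
  define h where "h t = (\<Sum>s\<in>S1. w1 s * ln (r1 s + t)) + (\<Sum>s\<in>S2. w2 s * ln (r2 s + t)) - (\<Sum>s\<in>S. w s * ln (r s + t))" for t
  have der: "(h has_real_derivative ((\<Sum>s\<in>S1. w1 s / (r1 s + t)) + (\<Sum>s\<in>S2. w2 s / (r2 s + t)) - (\<Sum>s\<in>S. w s / (r s + t)))) (at t)"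
    if "t \<ge> 0" for t
    unfolding h_def using pos that by (intro DERIV_diff DERIV_add DERIV_sum_ln)
  have mono: "h 0 \<le> h T" if "T > 0" for T
  proof (rule DERIV_nonneg_imp_increasing_open[of 0 T h])
    show "continuous_on {0..T} h"
      by (intro continuous_at_imp_continuous_on ballI DERIV_isCont[OF der]) auto
    show "\<exists>y. (h has_real_derivative y) (at x) \<and> 0 \<le> y" if "0 < x" "x < T" for x
      using der[of x] le[of x] that by (intro exI conjI) auto
  qed (use that in auto)
  have lim: "(h \<longlongrightarrow> 0) at_top"
  proof -
    have "h = (\<lambda>t. (\<Sum>s\<in>S1. w1 s * (ln (r1 s + t) - ln t)) + (\<Sum>s\<in>S2. w2 s * (ln (r2 s + t) - ln t))
        - (\<Sum>s\<in>S. w s * (ln (r s + t) - ln t)))"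
      unfolding fun_eq_iff h_def right_diff_distrib sum_subtractf sum_distrib_right[symmetric] tot
      by (simp add: algebra_simps)
    moreover have "((\<lambda>t. (\<Sum>s\<in>S1. w1 s * (ln (r1 s + t) - ln t)) + (\<Sum>s\<in>S2. w2 s * (ln (r2 s + t) - ln t))
        - (\<Sum>s\<in>S. w s * (ln (r s + t) - ln t))) \<longlongrightarrow> 0 + 0 - 0) at_top"
      using pos by (intro tendsto_diff tendsto_add tendsto_sum_ln_shift)
    ultimately show ?thesis by simp
  qed
  have "h 0 \<le> 0"
  proof (rule tendsto_lowerbound[OF lim])
    show "\<forall>\<^sub>F T in at_top. h 0 \<le> h T"
      using eventually_gt_at_top[of 0] by eventually_elim (rule mono)
  qed simp
  then show ?thesis by (simp add: h_def)
qed

text \<open>For each t a maximiser on I is turned into test kernels on the other two sides, where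
  \<open>resf\<close> is a lower bound of the resolvent sum. Two summands give joint convexity of
  relative entropy; an empty second one gives monotonicity under partial trace.\<close>

theorem reldata_mono:
  fixes I :: "'a set" and I1 :: "'b set" and I2 :: "'c set"
  assumes d: "reldata I \<rho> \<sigma> d" and d1: "reldata I1 \<rho>1 \<sigma>1 d1" and d2: "reldata I2 \<rho>2 \<sigma>2 d2"
    and tr: "tr I \<rho> = tr I1 \<rho>1 + tr I2 \<rho>2"
    and le: "\<And>t Z. t > 0 \<Longrightarrow> \<exists>Z1 Z2. resf t I \<rho> \<sigma> Z \<le> resf t I1 \<rho>1 \<sigma>1 Z1 + resf t I2 \<rho>2 \<sigma>2 Z2"
  shows "d1 + d2 \<le> d"
proof -
  obtain S :: "('a \<times> 'a) set" and w r where *: "relrep I \<rho> \<sigma> d S w r"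
    using d unfolding reldata_def by blast
  then have S: "\<forall>s\<in>S. w s > 0 \<and> r s > 0" "sum w S = tr I \<rho>" "d = (\<Sum>s\<in>S. w s * ln (r s))"
    "\<And>t. t > 0 \<Longrightarrow> \<exists>Z. resf t I \<rho> \<sigma> Z = (\<Sum>s\<in>S. w s / (r s + t))"
    unfolding relrep_def by simp_all
  obtain S1 :: "('b \<times> 'b) set" and w1 r1 where *: "relrep I1 \<rho>1 \<sigma>1 d1 S1 w1 r1"
    using d1 unfolding reldata_def by blast
  then have S1: "\<forall>s\<in>S1. w1 s > 0 \<and> r1 s > 0" "sum w1 S1 = tr I1 \<rho>1" "d1 = (\<Sum>s\<in>S1. w1 s * ln (r1 s))"
    "\<And>t Z. t > 0 \<Longrightarrow> resf t I1 \<rho>1 \<sigma>1 Z \<le> (\<Sum>s\<in>S1. w1 s / (r1 s + t))"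
    unfolding relrep_def by simp_all
  obtain S2 :: "('c \<times> 'c) set" and w2 r2 where *: "relrep I2 \<rho>2 \<sigma>2 d2 S2 w2 r2"
    using d2 unfolding reldata_def by blast
  then have S2: "\<forall>s\<in>S2. w2 s > 0 \<and> r2 s > 0" "sum w2 S2 = tr I2 \<rho>2" "d2 = (\<Sum>s\<in>S2. w2 s * ln (r2 s))"
    "\<And>t Z. t > 0 \<Longrightarrow> resf t I2 \<rho>2 \<sigma>2 Z \<le> (\<Sum>s\<in>S2. w2 s / (r2 s + t))"
    unfolding relrep_def by simp_all
  show ?thesis unfolding S(3) S1(3) S2(3)
  proof (rule sum_ln_mono[OF S(1) S1(1) S2(1)])
    show "sum w S = sum w1 S1 + sum w2 S2" by (simp only: S(2) S1(2) S2(2) tr)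
    fix t :: real assume t: "t > 0"
    obtain Z where Z: "resf t I \<rho> \<sigma> Z = (\<Sum>s\<in>S. w s / (r s + t))" using S(4)[OF t] by blast
    obtain Z1 Z2 where "resf t I \<rho> \<sigma> Z \<le> resf t I1 \<rho>1 \<sigma>1 Z1 + resf t I2 \<rho>2 \<sigma>2 Z2" using le[OF t] by blast
    then show "(\<Sum>s\<in>S. w s / (r s + t)) \<le> (\<Sum>s\<in>S1. w1 s / (r1 s + t)) + (\<Sum>s\<in>S2. w2 s / (r2 s + t))"
      using Z S1(4)[OF t, of Z1] S2(4)[OF t, of Z2] by linarith
  qed
qed

subsection \<open>Conditional entropy and strong subadditivity\<close>

lemma sum_Times: "(\<Sum>a\<in>A \<times> B. f a) = (\<Sum>x\<in>A. \<Sum>y\<in>B. f (x, y))"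
  by (simp add: sum.cartesian_product)

lemma eta_ln: "0 \<le> x \<Longrightarrow> x * ln x = - ln 2 * eta x"
  by (simp add: eta_def log_def)

lemma eta_0 [simp]: "eta 0 = 0" and eta_1 [simp]: "eta 1 = 0"
  by (simp_all add: eta_def)

definition marg :: "'q set \<Rightarrow> ('q \<times> 'x \<Rightarrow> 'q \<times> 'x \<Rightarrow> complex) \<Rightarrow> 'x \<Rightarrow> 'x \<Rightarrow> complex" where
  "marg Q \<rho> x x' = (\<Sum>q\<in>Q. \<rho> (q, x) (q, x'))"

definition margR :: "'y set \<Rightarrow> ('x \<times> 'y \<Rightarrow> 'x \<times> 'y \<Rightarrow> complex) \<Rightarrow> 'x \<Rightarrow> 'x \<Rightarrow> complex" where
  "margR Y \<rho> x x' = (\<Sum>y\<in>Y. \<rho> (x, y) (x', y))"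

definition idt :: "('x \<Rightarrow> 'x \<Rightarrow> complex) \<Rightarrow> 'q \<times> 'x \<Rightarrow> 'q \<times> 'x \<Rightarrow> complex" where
  "idt \<sigma> a b = kd (fst a) (fst b) * \<sigma> (snd a) (snd b)"

text \<open>The conditional entropy S(Q|X). Under positive scaling of a positive kernel both
  entropies pick up the same trace term, so the difference is homogeneous of degree one and suits
  unnormalised kernels.\<close>

definition cent :: "'q set \<Rightarrow> 'x set \<Rightarrow> ('q \<times> 'x \<Rightarrow> 'q \<times> 'x \<Rightarrow> complex) \<Rightarrow> real" where
  "cent Q X \<rho> = ent (Q \<times> X) \<rho> - ent X (marg Q \<rho>)"

lemma herm_sym: "herm I M \<Longrightarrow> a \<in> I \<Longrightarrow> b \<in> I \<Longrightarrow> cnj (M a b) = M b a"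
  unfolding herm_def by metis

lemma qf_reindex:
  assumes h: "bij_betw h I J"
  shows "qf J M v = qf I (\<lambda>a b. M (h a) (h b)) (\<lambda>a. v (h a))"
proof -
  have "(\<Sum>a\<in>J. \<Sum>b\<in>J. cnj (v a) * M a b * v b) = (\<Sum>a\<in>I. \<Sum>b\<in>J. cnj (v (h a)) * M (h a) b * v b)"
    by (rule sum.reindex_bij_betw[symmetric, OF h])
  also have "\<dots> = (\<Sum>a\<in>I. \<Sum>b\<in>I. cnj (v (h a)) * M (h a) (h b) * v (h b))"
    by (intro sum.cong refl sum.reindex_bij_betw[symmetric, OF h])
  finally show ?thesis by (simp add: qf_def)
qed

lemma pos_reindex:
  assumes h: "bij_betw h I J" and "pos J M"
  shows "pos I (\<lambda>a b. M (h a) (h b))"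
proof -
  have hI: "h a \<in> J" if "a \<in> I" for a using h that by (auto simp: bij_betw_def)
  have "qf I (\<lambda>a b. M (h a) (h b)) v = qf J M (\<lambda>a. v (inv_into I h a))" for v
    unfolding qf_reindex[OF h] using h by (intro qf_cong) (auto simp: bij_betw_def inv_into_f_f)
  moreover have "herm I (\<lambda>a b. M (h a) (h b))"
    using assms(2) hI unfolding pos_def herm_def by blast
  ultimately show ?thesis using assms(2) by (simp add: pos_def)
qed

lemma qf_swap:
  "qf (X \<times> Y) M v = qf (Y \<times> X) (\<lambda>a b. M (prod.swap a) (prod.swap b)) (\<lambda>a. v (prod.swap a))"
  by (rule qf_reindex) (auto simp: bij_betw_def inj_on_def image_iff)

text \<open>A partial trace is a sum of compressions to the slices v tensor e_y; positivity of
  marginals and the behaviour of \<open>resf\<close> under partial trace are read off from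
  this.\<close>

lemma qf_margR:
  assumes "finite Y"
  shows "qf X (margR Y M) v = (\<Sum>y\<in>Y. qf (X \<times> Y) M (\<lambda>a. v (fst a) * kd (snd a) y))"
proof -
  have 1: "qf (X \<times> Y) M (\<lambda>a. v (fst a) * kd (snd a) y) = Re (\<Sum>x\<in>X. \<Sum>x'\<in>X. cnj (v x) * M (x, y) (x', y) * v x')"
    if y: "y \<in> Y" for y
  proof -
    have "(\<Sum>x'\<in>X. \<Sum>z\<in>Y. cnj (v x * kd u y) * M (x, u) (x', z) * (v x' * kd z y))
        = kd u y * (\<Sum>x'\<in>X. cnj (v x) * M (x, u) (x', y) * v x')" for x u
      using assms y by (simp add: mult.assoc[symmetric] sum_distrib_left) (simp add: mult_ac)
    then have "(\<Sum>u\<in>Y. \<Sum>x'\<in>X. \<Sum>z\<in>Y. cnj (v x * kd u y) * M (x, u) (x', z) * (v x' * kd z y))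
        = (\<Sum>x'\<in>X. cnj (v x) * M (x, y) (x', y) * v x')" for x
      using assms y by simp
    then show ?thesis unfolding qf_def sum_Times by simp
  qed
  have "(\<Sum>x\<in>X. \<Sum>x'\<in>X. cnj (v x) * margR Y M x x' * v x')
      = (\<Sum>x\<in>X. \<Sum>x'\<in>X. \<Sum>y\<in>Y. cnj (v x) * M (x, y) (x', y) * v x')"
    unfolding margR_def sum_distrib_left sum_distrib_right ..
  also have "\<dots> = (\<Sum>y\<in>Y. \<Sum>x\<in>X. \<Sum>x'\<in>X. cnj (v x) * M (x, y) (x', y) * v x')"
    by (subst sum.swap[of _ Y X], intro sum.cong refl sum.swap)
  finally show ?thesis by (simp add: 1 qf_def[of X])
qed

lemma qf_marg:
  assumes "finite Q"
  shows "qf X (marg Q M) v = (\<Sum>q\<in>Q. qf (Q \<times> X) M (\<lambda>a. kd (fst a) q * v (snd a)))"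
proof -
  have "marg Q M = margR Q (\<lambda>a b. M (prod.swap a) (prod.swap b))"
    by (simp add: fun_eq_iff marg_def margR_def)
  then show ?thesis by (simp add: qf_margR[OF assms] qf_swap[of Q X] mult.commute)
qed

lemma pos_marg:
  assumes "finite Q" "pos (Q \<times> X) M"
  shows "pos X (marg Q M)"
proof -
  have h: "herm (Q \<times> X) M" using assms by (simp add: pos_def)
  have "herm X (marg Q M)" unfolding herm_def marg_def cnj_sum
    by (intro ballI sum.cong refl) (subst herm_sym[OF h], auto)
  then show ?thesis using assms by (simp add: pos_def qf_marg sum_nonneg)
qed

lemma pos_margR:
  assumes "finite Y" "pos (X \<times> Y) M"
  shows "pos X (margR Y M)"
proof -
  have h: "herm (X \<times> Y) M" using assms by (simp add: pos_def)
  have "herm X (margR Y M)" unfolding herm_def margR_def cnj_sum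
    by (intro ballI sum.cong refl) (subst herm_sym[OF h], auto)
  then show ?thesis using assms by (simp add: pos_def qf_margR sum_nonneg)
qed

lemma tr_marg: "tr X (marg Q M) = tr (Q \<times> X) M"
  unfolding tr_def marg_def sum_Times Re_sum by (rule sum.swap)

lemma tr_margR: "tr X (margR Y M) = tr (X \<times> Y) M"
  unfolding tr_def margR_def sum_Times Re_sum ..

lemma eigsys_idt:
  assumes f: "eigsys J X \<sigma> f q" and Q: "finite Q"
  shows "eigsys (Q \<times> J) (Q \<times> X) (idt \<sigma>) (\<lambda>k a. kd (fst a) (fst k) * f (snd k) (snd a)) (\<lambda>k. q (snd k))"
proof -
  note o = eigsys_onb[OF f]
  have c: "(\<Sum>k\<in>Q \<times> J. F (snd k) * (kd (fst a) (fst k) * f (snd k) (snd a)) * cnj (kd (fst b) (fst k) * f (snd k) (snd b)))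
    = kd (fst a) (fst b) * (\<Sum>j\<in>J. F j * f j (snd a) * cnj (f j (snd b)))"
    if "a \<in> Q \<times> X" "b \<in> Q \<times> X" for a b F
  proof -
    have "(\<Sum>k\<in>Q \<times> J. F (snd k) * (kd (fst a) (fst k) * f (snd k) (snd a)) * cnj (kd (fst b) (fst k) * f (snd k) (snd b)))
      = (\<Sum>r\<in>Q. kd (fst a) r * (kd (fst b) r * (\<Sum>j\<in>J. F j * f j (snd a) * cnj (f j (snd b)))))"
      unfolding sum_Times sum_distrib_left by (intro sum.cong refl) simp
    then show ?thesis using that Q by (auto simp: kd_sym)
  qed
  show ?thesis unfolding eigsys_def onb_def
  proof (intro conjI ballI)
    fix k l assume kl: "k \<in> Q \<times> J" "l \<in> Q \<times> J"
    have "(\<Sum>a\<in>Q \<times> X. cnj (kd (fst a) (fst k) * f (snd k) (snd a)) * (kd (fst a) (fst l) * f (snd l) (snd a)))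
      = (\<Sum>r\<in>Q. kd r (fst k) * (kd r (fst l) * (\<Sum>x\<in>X. cnj (f (snd k) x) * f (snd l) x)))"
      unfolding sum_Times sum_distrib_left by (intro sum.cong refl) simp
    also have "\<dots> = kd (fst k) (fst l) * kd (snd k) (snd l)"
      using kl Q by (auto simp: onb_ortho[OF o])
    finally show "(\<Sum>a\<in>Q \<times> X. cnj (kd (fst a) (fst k) * f (snd k) (snd a)) * (kd (fst a) (fst l) * f (snd l) (snd a))) = kd k l"
      by (simp flip: kd_pair)
  next
    fix a b assume ab: "a \<in> Q \<times> X" "b \<in> Q \<times> X"
    show "(\<Sum>k\<in>Q \<times> J. kd (fst a) (fst k) * f (snd k) (snd a) * cnj (kd (fst b) (fst k) * f (snd k) (snd b))) = kd a b"
      using c[OF ab, of "\<lambda>_. 1"] ab by (auto simp: onb_complete[OF o] simp flip: kd_pair)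
    show "idt \<sigma> a b = (\<Sum>k\<in>Q \<times> J. complex_of_real (q (snd k)) * (kd (fst a) (fst k) * f (snd k) (snd a))
        * cnj (kd (fst b) (fst k) * f (snd k) (snd b)))"
      using c[OF ab, of "\<lambda>j. of_real (q j)"] ab by (auto simp: idt_def eigsys_eq[OF f])
  qed (use Q onb_finite[OF o] in auto)
qed

lemma qf_idt:
  assumes "finite Q"
  shows "qf (Q \<times> X) (idt \<sigma>) v = (\<Sum>q\<in>Q. qf X \<sigma> (\<lambda>x. v (q, x)))"
proof -
  have "(\<Sum>a\<in>Q \<times> X. \<Sum>b\<in>Q \<times> X. cnj (v a) * idt \<sigma> a b * v b)
     = (\<Sum>q\<in>Q. \<Sum>x\<in>X. \<Sum>r\<in>Q. kd q r * (\<Sum>x'\<in>X. cnj (v (q, x)) * \<sigma> x x' * v (r, x')))"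
    unfolding sum_Times sum_distrib_left by (intro sum.cong refl) (simp add: idt_def)
  also have "\<dots> = (\<Sum>q\<in>Q. \<Sum>x\<in>X. \<Sum>x'\<in>X. cnj (v (q, x)) * \<sigma> x x' * v (q, x'))"
    using assms by (intro sum.cong refl) simp
  finally show ?thesis by (simp add: qf_def)
qed

text \<open>S(Q|X) is minus the relative entropy of \<rho> with respect to the identity tensor its
  marginal, and ln 2 converts the base. The support condition holds because an eigenvalue of the
  marginal is a sum of nonnegative values of the form of \<rho>, which all vanish with it.\<close>

lemma cent_reldata:
  assumes fin: "finite Q" "finite X" and pos: "pos (Q \<times> X) \<rho>"
  shows "reldata (Q \<times> X) \<rho> (idt (marg Q \<rho>)) (ln 2 * cent Q X \<rho>)"
proof -
  obtain e p where e: "eigsys (Q \<times> X) (Q \<times> X) \<rho> e p" and p: "\<And>k. k \<in> Q \<times> X \<Longrightarrow> 0 \<le> p k"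
    using pos_obtain_eigsys[OF _ pos] fin by blast
  obtain f q where f: "eigsys X X (marg Q \<rho>) f q" and q: "\<And>j. j \<in> X \<Longrightarrow> 0 \<le> q j"
    using pos_obtain_eigsys[OF fin(2) pos_marg[OF fin(1) pos]] by blast
  define F where "F = (\<lambda>(k :: 'a \<times> 'b) (a :: 'a \<times> 'b). kd (fst a) (fst k) * f (snd k) (snd a))"
  have F: "eigsys (Q \<times> X) (Q \<times> X) (idt (marg Q \<rho>)) F (\<lambda>k. q (snd k))"
    unfolding F_def by (rule eigsys_idt[OF f fin(1)])
  have s: "(\<Sum>r\<in>Q. qf (Q \<times> X) \<rho> (F (r, j))) = q j" if "j \<in> X" for j
    using qf_marg[OF fin(1), of X \<rho> "f j"] qf_eigenvector[OF f that] by (simp add: F_def)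
  have "reldata (Q \<times> X) \<rho> (idt (marg Q \<rho>)) ((\<Sum>k\<in>Q \<times> X. ln (q (snd k)) * qf (Q \<times> X) \<rho> (F k)) - (\<Sum>i\<in>Q \<times> X. p i * ln (p i)))"
  proof (rule reldata_eigsys[OF e F p])
    fix k assume k: "k \<in> Q \<times> X" "q (snd k) = 0"
    then have "(\<Sum>r\<in>Q. qf (Q \<times> X) \<rho> (F (r, snd k))) = 0" using s by auto
    then have "\<forall>r\<in>Q. qf (Q \<times> X) \<rho> (F (r, snd k)) = 0"
      using fin pos by (subst (asm) sum_nonneg_eq_0_iff) (auto simp: pos_def)
    then show "qf (Q \<times> X) \<rho> (F k) = 0" using k by (metis SigmaE fst_conv snd_conv)
  qed (use q in auto)
  moreover have "(\<Sum>k\<in>Q \<times> X. ln (q (snd k)) * qf (Q \<times> X) \<rho> (F k)) = - ln 2 * ent X (marg Q \<rho>)"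
  proof -
    have "(\<Sum>k\<in>Q \<times> X. ln (q (snd k)) * qf (Q \<times> X) \<rho> (F k)) = (\<Sum>j\<in>X. ln (q j) * (\<Sum>r\<in>Q. qf (Q \<times> X) \<rho> (F (r, j))))"
      unfolding sum_Times sum_distrib_left by (subst sum.swap) simp
    also have "\<dots> = (\<Sum>j\<in>X. - ln 2 * eta (q j))"
      using q by (intro sum.cong refl) (simp only: s mult.commute[of "ln (q _)"] eta_ln)
    finally show ?thesis by (simp only: ent_eq[OF f] sum_distrib_left)
  qed
  moreover have "(\<Sum>i\<in>Q \<times> X. p i * ln (p i)) = - ln 2 * ent (Q \<times> X) \<rho>"
    unfolding ent_eq[OF e] sum_distrib_left using p by (intro sum.cong refl eta_ln) blast
  ultimately show ?thesis by (simp add: cent_def right_diff_distrib)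
qed

lemma cent_mono2:
  assumes "finite Q" "finite X" "pos (Q \<times> X) \<rho>" "finite Q1" "finite X1" "pos (Q1 \<times> X1) \<rho>1"
    "finite Q2" "finite X2" "pos (Q2 \<times> X2) \<rho>2"
    and "tr (Q \<times> X) \<rho> = tr (Q1 \<times> X1) \<rho>1 + tr (Q2 \<times> X2) \<rho>2"
    and "\<And>t Z. t > 0 \<Longrightarrow> \<exists>Z1 Z2. resf t (Q \<times> X) \<rho> (idt (marg Q \<rho>)) Z
      \<le> resf t (Q1 \<times> X1) \<rho>1 (idt (marg Q1 \<rho>1)) Z1 + resf t (Q2 \<times> X2) \<rho>2 (idt (marg Q2 \<rho>2)) Z2"
  shows "cent Q1 X1 \<rho>1 + cent Q2 X2 \<rho>2 \<le> cent Q X \<rho>"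
proof -
  have "ln 2 * cent Q1 X1 \<rho>1 + ln 2 * cent Q2 X2 \<rho>2 \<le> ln 2 * cent Q X \<rho>"
    by (rule reldata_mono[OF cent_reldata cent_reldata cent_reldata]) (use assms in auto)
  then show ?thesis by (simp flip: distrib_left)
qed

lemma cent_mono:
  assumes "finite Q" "finite X" "pos (Q \<times> X) \<rho>" "finite Q1" "finite X1" "pos (Q1 \<times> X1) \<rho>1"
    and "tr (Q \<times> X) \<rho> = tr (Q1 \<times> X1) \<rho>1"
    and "\<And>t Z. t > 0 \<Longrightarrow> \<exists>Z1. resf t (Q \<times> X) \<rho> (idt (marg Q \<rho>)) Z
      \<le> resf t (Q1 \<times> X1) \<rho>1 (idt (marg Q1 \<rho>1)) Z1"
  shows "cent Q1 X1 \<rho>1 \<le> cent Q X \<rho>"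
proof -
  have "ln 2 * cent Q1 X1 \<rho>1 + 0 \<le> ln 2 * cent Q X \<rho>"
    by (rule reldata_mono[OF cent_reldata cent_reldata reldata_empty])
      (use assms in \<open>auto simp: tr_def[of "{}"] resf_def[of _ "{}"]\<close>)
  then show ?thesis by simp
qed

text \<open>With Z tensor the identity on Y as test kernel, all three terms of \<open>resf\<close>
  reproduce their values for the marginal on QX, so the supremum for \<rho> is at least as
  large.\<close>

theorem cent_strong_subadditivity:
  assumes fin: "finite Q" "finite X" "finite Y" and pos: "pos (Q \<times> X \<times> Y) \<rho>"
  defines "\<tau> \<equiv> \<lambda>a b. \<Sum>y\<in>Y. \<rho> (fst a, snd a, y) (fst b, snd b, y)"
  shows "cent Q (X \<times> Y) \<rho> \<le> cent Q X \<tau>"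
proof -
  define h where "h = (\<lambda>a :: ('a \<times> 'b) \<times> 'c. (fst (fst a), snd (fst a), snd a))"
  have h: "bij_betw h ((Q \<times> X) \<times> Y) (Q \<times> X \<times> Y)"
    by (rule bij_betw_byWitness[of _ "\<lambda>a. ((fst a, fst (snd a)), snd (snd a))"]) (auto simp: h_def)
  have \<tau>: "\<tau> = margR Y (\<lambda>a b. \<rho> (h a) (h b))"
    by (simp add: fun_eq_iff \<tau>_def margR_def h_def)
  have mt: "marg Q \<tau> = margR Y (marg Q \<rho>)"
    unfolding fun_eq_iff marg_def margR_def \<tau>_def fst_conv snd_conv by (intro allI sum.swap)
  have pt: "pos (Q \<times> X) \<tau>" unfolding \<tau> by (rule pos_margR[OF fin(3) pos_reindex[OF h pos]])
  show ?thesis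
  proof (rule cent_mono[OF fin(1,2) pt fin(1) _ pos])
    show "finite (X \<times> Y)" using fin by simp
    show "tr (Q \<times> X) \<tau> = tr (Q \<times> X \<times> Y) \<rho>"
      unfolding \<tau> tr_margR by (simp add: tr_def sum_Times h_def)
    fix t :: real and Z
    define Z1 where "Z1 a b = Z (fst a, fst (snd a)) (fst b, fst (snd b)) * kd (snd (snd a)) (snd (snd b))"
      for a b :: "'a \<times> 'b \<times> 'c"
    have 1: "(\<Sum>a\<in>Q \<times> X \<times> Y. \<Sum>b\<in>Q \<times> X \<times> Y. cnj (Z1 a b) * \<rho> a b)
        = (\<Sum>a\<in>Q \<times> X. \<Sum>b\<in>Q \<times> X. cnj (Z a b) * \<tau> a b)"
    proof -
      have "(\<Sum>b\<in>Q \<times> X \<times> Y. cnj (Z1 (q, x, y) b) * \<rho> (q, x, y) b)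
        = (\<Sum>b\<in>Q \<times> X. cnj (Z (q, x) b) * \<rho> (q, x, y) (fst b, snd b, y))" if "y \<in> Y" for q x y
      proof -
        have "(\<Sum>z\<in>Y. cnj (Z1 (q, x, y) (q', x', z)) * \<rho> (q, x, y) (q', x', z))
           = cnj (Z (q, x) (q', x')) * (\<Sum>z\<in>Y. kd y z * \<rho> (q, x, y) (q', x', z))" for q' x'
          unfolding sum_distrib_left by (intro sum.cong refl) (simp add: Z1_def)
        then show ?thesis unfolding sum_Times using fin that by simp
      qed
      then have "(\<Sum>a\<in>Q \<times> X \<times> Y. \<Sum>b\<in>Q \<times> X \<times> Y. cnj (Z1 a b) * \<rho> a b)
        = (\<Sum>a\<in>Q \<times> X. \<Sum>y\<in>Y. \<Sum>b\<in>Q \<times> X. cnj (Z a b) * \<rho> (fst a, snd a, y) (fst b, snd b, y))"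
        by (simp add: sum_Times)
      also have "\<dots> = (\<Sum>a\<in>Q \<times> X. \<Sum>b\<in>Q \<times> X. cnj (Z a b) * \<tau> a b)"
        unfolding \<tau>_def sum_distrib_left by (intro sum.cong refl sum.swap)
      finally show ?thesis .
    qed
    have 2: "(\<Sum>b\<in>Q \<times> X \<times> Y. qf (Q \<times> X \<times> Y) (idt (marg Q \<rho>)) (\<lambda>a. Z1 a b))
        = (\<Sum>b\<in>Q \<times> X. qf (Q \<times> X) (idt (marg Q \<tau>)) (\<lambda>a. Z a b))"
    proof -
      have "(\<Sum>b\<in>Q \<times> X \<times> Y. qf (Q \<times> X \<times> Y) (idt (marg Q \<rho>)) (\<lambda>a. Z1 a b))
        = (\<Sum>b\<in>Q \<times> X. \<Sum>y\<in>Y. \<Sum>q\<in>Q. qf (X \<times> Y) (marg Q \<rho>) (\<lambda>a. Z (q, fst a) b * kd (snd a) y))"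
        by (simp add: qf_idt[OF fin(1)] sum_Times Z1_def)
      also have "\<dots> = (\<Sum>b\<in>Q \<times> X. \<Sum>q\<in>Q. \<Sum>y\<in>Y. qf (X \<times> Y) (marg Q \<rho>) (\<lambda>a. Z (q, fst a) b * kd (snd a) y))"
        by (intro sum.cong refl sum.swap)
      finally show ?thesis by (simp add: qf_idt[OF fin(1)] mt qf_margR[OF fin(3)])
    qed
    have 3: "(\<Sum>a\<in>Q \<times> X \<times> Y. qf (Q \<times> X \<times> Y) \<rho> (\<lambda>b. cnj (Z1 a b)))
        = (\<Sum>a\<in>Q \<times> X. qf (Q \<times> X) \<tau> (\<lambda>b. cnj (Z a b)))"
      unfolding \<tau> qf_margR[OF fin(3)] qf_reindex[OF h] by (simp add: sum_Times Z1_def h_def kd_sym)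
    show "\<exists>Z1. resf t (Q \<times> X) \<tau> (idt (marg Q \<tau>)) Z \<le> resf t (Q \<times> X \<times> Y) \<rho> (idt (marg Q \<rho>)) Z1"
      by (rule exI[of _ Z1]) (simp add: resf_def 1 2 3)
  qed
qed

lemma qf_add: "qf I (\<lambda>a b. M a b + N a b) v = qf I M v + qf I N v"
  by (simp add: qf_def distrib_left distrib_right sum.distrib)

lemma pos_add: "pos I M \<Longrightarrow> pos I N \<Longrightarrow> pos I (\<lambda>a b. M a b + N a b)"
  unfolding pos_def
proof (elim conjE, intro conjI)
  assume h: "herm I M" "herm I N"
  show "herm I (\<lambda>a b. M a b + N a b)"
    unfolding herm_def by (intro ballI) (simp add: herm_sym[OF h(1)] herm_sym[OF h(2)])
qed (simp add: qf_add)

lemma tr_add: "tr I (\<lambda>a b. M a b + N a b) = tr I M + tr I N"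
  by (simp add: tr_def sum.distrib)

text \<open>\<open>resf\<close> is additive in the pair of kernels, so one Z serves both summands.
  Together with homogeneity this is concavity of conditional entropy.\<close>

theorem cent_superadditive:
  assumes fin: "finite Q" "finite X" and pos: "pos (Q \<times> X) \<rho>1" "pos (Q \<times> X) \<rho>2"
  shows "cent Q X \<rho>1 + cent Q X \<rho>2 \<le> cent Q X (\<lambda>a b. \<rho>1 a b + \<rho>2 a b)"
proof (rule cent_mono2[OF fin _ fin pos(1) fin pos(2)])
  let ?\<rho> = "\<lambda>a b. \<rho>1 a b + \<rho>2 a b"
  show "pos (Q \<times> X) ?\<rho>" by (rule pos_add[OF pos])
  show "tr (Q \<times> X) ?\<rho> = tr (Q \<times> X) \<rho>1 + tr (Q \<times> X) \<rho>2" by (rule tr_add)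
  fix t :: real and Z
  have i: "idt (marg Q ?\<rho>) = (\<lambda>a b. idt (marg Q \<rho>1) a b + idt (marg Q \<rho>2) a b)"
    by (simp add: fun_eq_iff idt_def marg_def sum.distrib distrib_left)
  have "resf t (Q \<times> X) ?\<rho> (idt (marg Q ?\<rho>)) Z
      = resf t (Q \<times> X) \<rho>1 (idt (marg Q \<rho>1)) Z + resf t (Q \<times> X) \<rho>2 (idt (marg Q \<rho>2)) Z"
    unfolding i resf_def qf_add distrib_left sum.distrib plus_complex.sel by (simp add: algebra_simps)
  then show "\<exists>Z1 Z2. resf t (Q \<times> X) ?\<rho> (idt (marg Q ?\<rho>)) Z
      \<le> resf t (Q \<times> X) \<rho>1 (idt (marg Q \<rho>1)) Z1 + resf t (Q \<times> X) \<rho>2 (idt (marg Q \<rho>2)) Z2"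
    by (intro exI[of _ Z]) simp
qed

section \<open>Entropy inequalities for unnormalised kernels\<close>

lemma ent_singleton:
  assumes "herm {u} M"
  shows "ent {u} M = eta (Re (M u u))"
proof -
  have "M u u = of_real (Re (M u u))" using assms by (simp add: herm_def complex_eq_iff)
  then have "eigsys {u} {u} M kd (\<lambda>_. Re (M u u))" by (simp add: eigsys_def onb_def)
  then show ?thesis using ent_eq by force
qed

text \<open>Concavity of entropy, obtained by conditioning on a one-point system: the marginal there
  is the trace, whence the \<open>eta\<close> corrections.\<close>

lemma ent_superadditive:
  assumes fin: "finite I" and pos: "pos I \<rho>1" "pos I \<rho>2"
  shows "ent I \<rho>1 - eta (tr I \<rho>1) + (ent I \<rho>2 - eta (tr I \<rho>2))
    \<le> ent I (\<lambda>a b. \<rho>1 a b + \<rho>2 a b) - eta (tr I \<rho>1 + tr I \<rho>2)"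
proof -
  have h: "bij_betw fst (I \<times> {()}) I" by (auto simp: bij_betw_def inj_on_def image_iff)
  have c: "cent I {()} (\<lambda>a b. \<rho> (fst a) (fst b)) = ent I \<rho> - eta (tr I \<rho>)" if p: "pos I \<rho>" for \<rho>
  proof -
    have "pos {()} (marg I (\<lambda>a b. \<rho> (fst a) (fst b)))"
      by (rule pos_marg[OF fin pos_reindex[OF h p]])
    then show ?thesis
      using p unfolding cent_def by (subst ent_reindex[OF h fin]) (auto simp: pos_def ent_singleton marg_def tr_def)
  qed
  show ?thesis
    using cent_superadditive[OF fin _ pos_reindex[OF h pos(1)] pos_reindex[OF h pos(2)]]
    by (simp add: c pos pos_add[OF pos] c[of "\<lambda>a b. \<rho>1 a b + \<rho>2 a b"] tr_add)
qed

text \<open>Strong subadditivity with X discarded and a one-point system kept. The correction by eta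
  of the trace vanishes for normalised kernels.\<close>

lemma cent_le_ent:
  assumes fin: "finite Q" "finite X" and pos: "pos (Q \<times> X) \<rho>"
  shows "cent Q X \<rho> \<le> ent Q (margR X \<rho>) - eta (tr (Q \<times> X) \<rho>)"
proof -
  define h where "h = (\<lambda>a :: 'a \<times> unit \<times> 'b. (fst a, snd (snd a)))"
  define \<rho>' where "\<rho>' a b = \<rho> (h a) (h b)" for a b
  have h: "bij_betw h (Q \<times> {()} \<times> X) (Q \<times> X)"
    by (rule bij_betw_byWitness[of _ "\<lambda>a. (fst a, (), snd a)"]) (auto simp: h_def)
  have h2: "bij_betw snd ({()} \<times> X) X" by (auto simp: bij_betw_def inj_on_def image_iff)
  have h3: "bij_betw fst (Q \<times> {()}) Q" by (auto simp: bij_betw_def inj_on_def image_iff)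
  note p = pos_reindex[OF h pos, folded \<rho>'_def]
  note pm = pos_marg[OF fin(1) pos]
  note pr = pos_margR[OF fin(2) pos]
  let ?\<tau> = "\<lambda>a b. \<Sum>y\<in>X. \<rho>' (fst a, snd a, y) (fst b, snd b, y)"
  have t: "?\<tau> = (\<lambda>a b. margR X \<rho> (fst a) (fst b))" by (simp add: fun_eq_iff \<rho>'_def h_def margR_def)
  have m: "marg Q \<rho>' = (\<lambda>a b. marg Q \<rho> (snd a) (snd b))" by (simp add: fun_eq_iff \<rho>'_def h_def marg_def)
  have "cent Q ({()} \<times> X) \<rho>' = cent Q X \<rho>"
  proof -
    have "ent (Q \<times> {()} \<times> X) \<rho>' = ent (Q \<times> X) \<rho>"
      unfolding \<rho>'_def using pos fin by (intro ent_reindex[OF h]) (auto simp: pos_def)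
    moreover have "ent ({()} \<times> X) (marg Q \<rho>') = ent X (marg Q \<rho>)"
      unfolding m using pm fin by (intro ent_reindex[OF h2]) (auto simp: pos_def)
    ultimately show ?thesis by (simp add: cent_def)
  qed
  moreover have "cent Q {()} ?\<tau> = ent Q (margR X \<rho>) - eta (tr (Q \<times> X) \<rho>)"
  proof -
    have "ent (Q \<times> {()}) (\<lambda>a b. margR X \<rho> (fst a) (fst b)) = ent Q (margR X \<rho>)"
      using pr fin by (intro ent_reindex[OF h3]) (auto simp: pos_def)
    moreover have "pos {()} (marg Q (\<lambda>a b. margR X \<rho> (fst a) (fst b)))"
      by (rule pos_marg[OF fin(1) pos_reindex[OF h3 pr]])
    then have "ent {()} (marg Q (\<lambda>a b. margR X \<rho> (fst a) (fst b))) = eta (tr (Q \<times> X) \<rho>)"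
      unfolding tr_margR[symmetric] by (subst ent_singleton) (auto simp: pos_def marg_def tr_def)
    ultimately show ?thesis unfolding t cent_def by simp
  qed
  ultimately show ?thesis
    using cent_strong_subadditivity[OF fin(1) _ fin(2) p] by simp
qed

lemma ent_le_log_card:
  assumes fin: "finite I" and pos: "pos I \<rho>"
  shows "ent I \<rho> \<le> tr I \<rho> * log 2 (card I) + eta (tr I \<rho>)"
proof -
  obtain e p where e: "eigsys I I \<rho> e p" and p: "\<And>k. k \<in> I \<Longrightarrow> 0 \<le> p k"
    using pos_obtain_eigsys[OF fin pos] by blast
  define T where "T = tr I \<rho>"
  have T: "T = (\<Sum>k\<in>I. p k)" unfolding T_def by (rule tr_eigsys[OF e])
  show ?thesis
  proof (cases "T = 0")
    case True
    then have "\<forall>k\<in>I. p k = 0" using T fin p by (simp add: sum_nonneg_eq_0_iff)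
    then show ?thesis using True by (simp add: ent_eq[OF e] T_def)
  next
    case False
    then have T0: "T > 0" using T p by (metis less_eq_real_def sum_nonneg)
    then have I: "I \<noteq> {}" using T by auto
    define d where "d = real (card I)"
    have d: "d > 0" using I fin by (simp add: d_def card_gt_0_iff)
    have "eta (p k) \<le> p k * log 2 d - p k * log 2 T + (T / d - p k) / ln 2" if k: "k \<in> I" for k
    proof (cases "p k = 0")
      case True
      then show ?thesis using T0 d by simp
    next
      case False
      then have pk: "p k > 0" using p[OF k] by simp
      \<comment> \<open>Gibbs' inequality against the uniform distribution of total mass T; the
        error terms T / d - p k sum to zero.\<close>
      have "ln (T / (d * p k)) \<le> T / (d * p k) - 1" using T0 d pk by (intro ln_le_minus_one) simp
      then have "p k * ln (T / (d * p k)) \<le> p k * (T / (d * p k) - 1)" using pk by simp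
      also have "\<dots> = T / d - p k" using pk d by (simp add: field_simps)
      finally have "p k * (ln T - ln d - ln (p k)) \<le> T / d - p k"
        using T0 d pk by (simp add: ln_div ln_mult algebra_simps)
      then have "p k * (ln T - ln d - ln (p k)) / ln 2 \<le> (T / d - p k) / ln 2"
        by (simp add: divide_right_mono)
      moreover have "p k * (ln T - ln d - ln (p k)) / ln 2 = eta (p k) - p k * log 2 d + p k * log 2 T"
        using pk by (simp add: eta_def log_def field_simps)
      ultimately show ?thesis by linarith
    qed
    then have "ent I \<rho> \<le> (\<Sum>k\<in>I. p k * log 2 d - p k * log 2 T + (T / d - p k) / ln 2)"
      unfolding ent_eq[OF e] by (rule sum_mono)
    also have "\<dots> = T * log 2 d - T * log 2 T + (card I * (T / d) - T) / ln 2"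
      unfolding sum.distrib sum_subtractf sum_distrib_right[symmetric] sum_divide_distrib[symmetric] T[symmetric] by simp
    also have "\<dots> = T * log 2 d + eta T" using T0 d by (simp add: d_def eta_def)
    finally show ?thesis by (simp add: T_def d_def)
  qed
qed

text \<open>Enlarging the second argument from \<rho> to \<rho> + \<tau> lowers \<open>resf\<close>,
  because that argument enters with a minus sign; hence the relative entropy of \<rho> with respect
  to \<rho> + \<tau> is at most that with respect to \<rho> itself, which is zero.\<close>

lemma klein_inequality:
  assumes fin: "finite I" and pos: "pos I \<rho>" "pos I \<tau>" and f: "eigsys I I (\<lambda>a b. \<rho> a b + \<tau> a b) f q"
  shows "- ln 2 * ent I \<rho> \<le> (\<Sum>j\<in>I. ln (q j) * qf I \<rho> (f j))"
proof -
  obtain e p where e: "eigsys I I \<rho> e p" and p: "\<And>k. k \<in> I \<Longrightarrow> 0 \<le> p k"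
    using pos_obtain_eigsys[OF fin pos(1)] by blast
  have q: "0 \<le> q j" if "j \<in> I" for j using pos_eigen_nonneg[OF pos_add[OF pos] f that] .
  have pp: "(\<Sum>i\<in>I. p i * ln (p i)) = - ln 2 * ent I \<rho>"
    unfolding ent_eq[OF e] sum_distrib_left using p by (intro sum.cong refl eta_ln) blast
  have "reldata I \<rho> (\<lambda>a b. \<rho> a b + \<tau> a b) ((\<Sum>j\<in>I. ln (q j) * qf I \<rho> (f j)) - (\<Sum>i\<in>I. p i * ln (p i)))"
  proof (rule reldata_eigsys[OF e f p q])
    fix j assume "j \<in> I" "q j = 0"
    then have "qf I \<rho> (f j) + qf I \<tau> (f j) = 0" using qf_eigenvector[OF f] by (simp add: qf_add)
    then show "qf I \<rho> (f j) = 0" using pos unfolding pos_def by (metis add_nonneg_eq_0_iff)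
  qed
  moreover have "reldata I \<rho> \<rho> ((\<Sum>j\<in>I. ln (p j) * qf I \<rho> (e j)) - (\<Sum>i\<in>I. p i * ln (p i)))"
    by (rule reldata_eigsys[OF e e p p]) (auto simp: qf_eigenvector[OF e])
  ultimately have "(\<Sum>j\<in>I. ln (p j) * qf I \<rho> (e j)) - (\<Sum>i\<in>I. p i * ln (p i)) + 0
    \<le> (\<Sum>j\<in>I. ln (q j) * qf I \<rho> (f j)) - (\<Sum>i\<in>I. p i * ln (p i))"
  proof (rule reldata_mono[OF _ _ reldata_empty])
    show "tr I \<rho> = tr I \<rho> + tr {} undefined" by (simp add: tr_def)
    fix t :: real and Z
    have "(\<Sum>b\<in>I. qf I \<rho> (\<lambda>a. Z a b)) \<le> (\<Sum>b\<in>I. qf I (\<lambda>a b. \<rho> a b + \<tau> a b) (\<lambda>a. Z a b))"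
      using pos by (intro sum_mono) (simp add: qf_add pos_def)
    then show "\<exists>Z1 Z2. resf t I \<rho> (\<lambda>a b. \<rho> a b + \<tau> a b) Z \<le> resf t I \<rho> \<rho> Z1 + resf t {} undefined undefined Z2"
      by (intro exI[of _ Z] exI[of _ undefined]) (simp add: resf_def)
  qed
  moreover have "(\<Sum>j\<in>I. ln (p j) * qf I \<rho> (e j)) = (\<Sum>i\<in>I. p i * ln (p i))"
    by (intro sum.cong refl) (simp add: qf_eigenvector[OF e])
  ultimately show ?thesis by (simp add: pp)
qed

text \<open>The entropy of the sum, written in its own eigenbasis, is a sum of two expectations of
  the same logarithm, one for each summand, and Klein's inequality bounds each of them.\<close>

theorem ent_subadditive_sum:
  assumes fin: "finite I" and pos: "pos I \<rho>1" "pos I \<rho>2"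
  shows "ent I (\<lambda>a b. \<rho>1 a b + \<rho>2 a b) \<le> ent I \<rho>1 + ent I \<rho>2"
proof -
  let ?\<omega> = "\<lambda>a b. \<rho>1 a b + \<rho>2 a b"
  obtain f q where f: "eigsys I I ?\<omega> f q" and q: "\<And>k. k \<in> I \<Longrightarrow> 0 \<le> q k"
    using pos_obtain_eigsys[OF fin pos_add[OF pos]] by blast
  have f': "eigsys I I (\<lambda>a b. \<rho>2 a b + \<rho>1 a b) f q" using f by (simp add: add.commute)
  have "(\<Sum>j\<in>I. ln (q j) * qf I \<rho>1 (f j)) + (\<Sum>j\<in>I. ln (q j) * qf I \<rho>2 (f j)) = (\<Sum>j\<in>I. ln (q j) * q j)"
    unfolding sum.distrib[symmetric]
    by (intro sum.cong refl) (simp add: qf_eigenvector[OF f, symmetric] qf_add distrib_left)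
  also have "\<dots> = - ln 2 * ent I ?\<omega>"
    unfolding ent_eq[OF f] sum_distrib_left using q by (intro sum.cong refl) (subst mult.commute, rule eta_ln)
  finally have "ln 2 * (ent I \<rho>1 + ent I \<rho>2) \<ge> ln 2 * ent I ?\<omega>"
    using klein_inequality[OF fin pos f] klein_inequality[OF fin pos(2,1) f'] by (simp add: distrib_left)
  then show ?thesis by simp
qed

subsection \<open>Continuity of conditional entropy\<close>

lemma cent_cong:
  assumes "\<And>a b. a \<in> Q \<times> X \<Longrightarrow> b \<in> Q \<times> X \<Longrightarrow> \<rho> a b = \<tau> a b"
  shows "cent Q X \<rho> = cent Q X \<tau>"
proof -
  have "ent (Q \<times> X) \<rho> = ent (Q \<times> X) \<tau>" using assms by (rule ent_cong)
  moreover have "ent X (marg Q \<rho>) = ent X (marg Q \<tau>)"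
    unfolding marg_def by (intro ent_cong sum.cong refl assms) auto
  ultimately show ?thesis by (simp add: cent_def)
qed

lemma marg_add: "marg Q (\<lambda>i j. M i j + N i j) = (\<lambda>i j. marg Q M i j + marg Q N i j)"
  by (simp add: fun_eq_iff marg_def sum.distrib)

lemma marg_red: "marg Q (red Y \<psi>) = red (Q \<times> Y) (\<lambda>x a. \<psi> (fst a, x) (snd a))"
  by (simp add: fun_eq_iff marg_def red_def sum_Times)

text \<open>Schmidt symmetry exchanges QX with Y and QY with X; the right-hand side only regroups
  the indices of the same vector.\<close>

lemma cent_dual:
  assumes fin: "finite Q" "finite X" "finite Y"
  shows "cent Q X (red Y \<psi>) = - cent Q Y (red X (\<lambda>a x. \<psi> (fst a, x) (snd a)))"
proof -
  let ?\<phi> = "\<lambda>a x. \<psi> (fst a, x) (snd a)"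
  have 1: "ent (Q \<times> X) (red Y \<psi>) = ent Y (marg Q (red X ?\<phi>))"
    using fin by (subst ent_schmidt) (auto simp: marg_red)
  have 2: "ent (Q \<times> Y) (red X ?\<phi>) = ent X (marg Q (red Y \<psi>))"
    using fin by (subst ent_schmidt) (auto simp: marg_red)
  show ?thesis unfolding cent_def 1 2 by simp
qed

lemma tr_red: "tr A (red B \<psi>) = (\<Sum>a\<in>A. \<Sum>b\<in>B. (cmod (\<psi> a b))\<^sup>2)"
  by (simp add: tr_def red_def mult_cnj_self)

lemma cent_le_log_card:
  assumes fin: "finite Q" "finite X" and pos: "pos (Q \<times> X) \<rho>"
  shows "cent Q X \<rho> \<le> tr (Q \<times> X) \<rho> * log 2 (card Q)"
  using cent_le_ent[OF assms] ent_le_log_card[OF fin(1) pos_margR[OF fin(2) pos]]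
  by (simp add: tr_margR)

text \<open>Dual form of the upper bound; the trace is the squared norm of the vector under either
  grouping.\<close>

lemma cent_ge_log_card:
  assumes fin: "finite Q" "finite X" "finite Y"
  shows "- (tr (Q \<times> X) (red Y \<psi>) * log 2 (card Q)) \<le> cent Q X (red Y \<psi>)"
proof -
  have "tr (Q \<times> Y) (red X (\<lambda>a x. \<psi> (fst a, x) (snd a))) = tr (Q \<times> X) (red Y \<psi>)"
    unfolding tr_red sum_Times by (simp add: sum.swap[of _ X Y])
  then show ?thesis
    using cent_dual[OF fin, of \<psi>] cent_le_log_card[OF fin(1,3) pos_red, of X "\<lambda>a x. \<psi> (fst a, x) (snd a)"]
    by simp
qed

text \<open>Closed form of (1 + x) h(x / (1 + x)), the correction term in the continuity of
  conditional entropy; the proof of \<open>Delta_eq\<close> identifies the two.\<close>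

definition etagap :: "real \<Rightarrow> real" where
  "etagap x = eta x - eta (1 + x)"

lemma etagap_0 [simp]: "etagap 0 = 0"
  by (simp add: etagap_def)

text \<open>The derivative is the binary logarithm of (1 + x) / x, which is positive. It diverges at
  0, so that endpoint is compared directly.\<close>

lemma etagap_mono:
  assumes "0 \<le> x" "x \<le> y"
  shows "etagap x \<le> etagap y"
proof (cases "x = 0")
  case False
  define G where "G x = (1 + x) * ln (1 + x) - x * ln x" for x :: real
  have e: "etagap z = G z / ln 2" if "z > 0" for z
    using that by (simp add: etagap_def eta_def G_def log_def) (simp add: field_simps)
  have "G x \<le> G y"
  proof (rule DERIV_nonneg_imp_nondecreasing[OF assms(2)])
    fix z assume z: "x \<le> z" "z \<le> y"
    then have z0: "z > 0" using assms False by simp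
    have "(G has_real_derivative (ln (1 + z) - ln z)) (at z)"
      unfolding G_def using z0 by (auto intro!: derivative_eq_intros)
    then show "\<exists>d. (G has_real_derivative d) (at z) \<and> 0 \<le> d" using z0 by (intro exI conjI) auto
  qed
  then show ?thesis using assms False by (simp add: e divide_right_mono)
next
  case True
  show ?thesis
  proof (cases "y = 0")
    case False
    then have y: "y > 0" using assms by simp
    have "log 2 y \<le> log 2 (1 + y)" using y by simp
    then have "y * log 2 y \<le> y * log 2 (1 + y)" using y by simp
    also have "\<dots> \<le> (1 + y) * log 2 (1 + y)" using y by (intro mult_right_mono) auto
    finally have "y * log 2 y \<le> (1 + y) * log 2 (1 + y)" .
    moreover have "eta y = - (y * log 2 y)" "eta (1 + y) = - ((1 + y) * log 2 (1 + y))"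
      using y by (simp_all only: eta_def add_pos_pos zero_less_one if_True mult_minus_left)
    ultimately show ?thesis using True by (simp only: etagap_0) (simp only: etagap_def)
  qed (simp add: True)
qed

text \<open>The argument of Alicki, Fannes and Winter: both pure states are completed to one kernel
  by remainders of equal trace T at most \<delta>, and one passes from one completion to the other.
  The conditional entropies of both remainders lie within T log |Q| of zero, which explains the
  factor 2 and the absence of all other dimensions.\<close>

lemma cent_continuity:
  fixes a b :: "'q \<times> 'x \<Rightarrow> 'y \<Rightarrow> complex"
  assumes fin: "finite Q" "finite X" "finite Y" and \<delta>: "0 \<le> \<delta>"
    and a: "(\<Sum>i\<in>Q \<times> X. \<Sum>y\<in>Y. (cmod (a i y))\<^sup>2) = 1" and b: "(\<Sum>i\<in>Q \<times> X. \<Sum>y\<in>Y. (cmod (b i y))\<^sup>2) = 1"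
    and d: "(\<Sum>i\<in>Q \<times> X. \<Sum>y\<in>Y. (cmod (a i y - b i y))\<^sup>2) \<le> \<delta>\<^sup>2"
  shows "cent Q X (red Y a) - cent Q X (red Y b) \<le> 2 * \<delta> * log 2 (card Q) + etagap \<delta>"
proof (cases "\<delta> = 0")
  case True
  have "(\<Sum>y\<in>Y. (cmod (a i y - b i y))\<^sup>2) = 0" if "i \<in> Q \<times> X" for i
  proof -
    have "(\<Sum>i\<in>Q \<times> X. \<Sum>y\<in>Y. (cmod (a i y - b i y))\<^sup>2) = 0"
      using d True by (intro antisym[OF _ sum_nonneg] sum_nonneg) auto
    then show ?thesis using that fin by (subst (asm) sum_nonneg_eq_0_iff) (auto intro!: sum_nonneg)
  qed
  then have "a i y = b i y" if "i \<in> Q \<times> X" "y \<in> Y" for i y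
    using that fin by (subst (asm) sum_nonneg_eq_0_iff) auto
  then have "cent Q X (red Y a) = cent Q X (red Y b)"
    by (intro cent_cong) (simp add: red_def)
  then show ?thesis using True by simp
next
  case False
  then have d0: "\<delta> > 0" using \<delta> by simp
  \<comment> \<open>This value minimises
    \<open>s\<^sup>2 / 2 * \<delta>\<^sup>2 + 2 / s\<^sup>2\<close>, which bounds the two remainder
    traces together; both terms become \<delta>.\<close>
  define s where "s = sqrt (2 / \<delta>)"
  have s: "s > 0" "s\<^sup>2 = 2 / \<delta>" using d0 by (simp_all add: s_def)
  text \<open>With these vectors the projectors satisfy aa* + a'a'* = bb* + b'b'*.\<close>
  define a' where "a' i y = (of_real s * (a i y - b i y) - (a i y + b i y) / of_real s) / 2" for i y
  define b' where "b' i y = (of_real s * (a i y - b i y) + (a i y + b i y) / of_real s) / 2" for i y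
  have key: "red Y a i j + red Y a' i j = red Y b i j + red Y b' i j" for i j
  proof -
    have "a i y * cnj (a j y) + a' i y * cnj (a' j y) = b i y * cnj (b j y) + b' i y * cnj (b' j y)" for y
      using s(1) by (simp add: a'_def b'_def field_simps)
    then show ?thesis unfolding red_def sum.distrib[symmetric] by simp
  qed
  have ta: "tr (Q \<times> X) (red Y a) = 1" "tr (Q \<times> X) (red Y b) = 1" using a b by (simp_all add: tr_red)
  define T where "T = tr (Q \<times> X) (red Y b')"
  have "tr (Q \<times> X) (red Y a) + tr (Q \<times> X) (red Y a') = tr (Q \<times> X) (red Y b) + tr (Q \<times> X) (red Y b')"
    unfolding tr_add[symmetric] by (simp add: key)
  then have Ta: "tr (Q \<times> X) (red Y a') = T" using ta by (simp add: T_def)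
  have T0: "T \<ge> 0" unfolding T_def tr_red by (intro sum_nonneg) auto
  have Td: "T \<le> \<delta>"
  proof -
    have par: "(cmod (z - w))\<^sup>2 + (cmod (z + w))\<^sup>2 = 2 * (cmod z)\<^sup>2 + 2 * (cmod w)\<^sup>2" for z w
      unfolding cmod_power2 by (simp add: power2_eq_square algebra_simps)
    have four: "4 * (cmod (a' i y))\<^sup>2 + 4 * (cmod (b' i y))\<^sup>2
      = 2 * (s\<^sup>2 * (cmod (a i y - b i y))\<^sup>2) + 2 * ((cmod (a i y + b i y))\<^sup>2 / s\<^sup>2)" for i y
      using par[of "of_real s * (a i y - b i y)" "(a i y + b i y) / of_real s"] s(1)
      by (simp add: a'_def b'_def norm_mult norm_divide power_mult_distrib power_divide)
    have e: "(cmod (a' i y))\<^sup>2 + (cmod (b' i y))\<^sup>2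
      = s\<^sup>2 / 2 * (cmod (a i y - b i y))\<^sup>2 + 1 / (2 * s\<^sup>2) * (cmod (a i y + b i y))\<^sup>2" for i y
      using four[of i y] by (simp add: field_simps)
    define u where "u = (\<Sum>i\<in>Q \<times> X. \<Sum>y\<in>Y. (cmod (a i y - b i y))\<^sup>2)"
    define v where "v = (\<Sum>i\<in>Q \<times> X. \<Sum>y\<in>Y. (cmod (a i y + b i y))\<^sup>2)"
    have u: "u \<ge> 0" unfolding u_def by (intro sum_nonneg) auto
    \<comment> \<open>Parallelogram law: the squared norms of a - b and a + b add up to 4.\<close>
    have "u + v = 2 * (\<Sum>i\<in>Q \<times> X. \<Sum>y\<in>Y. (cmod (a i y))\<^sup>2) + 2 * (\<Sum>i\<in>Q \<times> X. \<Sum>y\<in>Y. (cmod (b i y))\<^sup>2)"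
      unfolding u_def v_def sum.distrib[symmetric] par sum_distrib_left ..
    then have v: "v \<le> 4" using a b u by simp
    have "T + T = s\<^sup>2 / 2 * u + 1 / (2 * s\<^sup>2) * v"
    proof -
      have "T + T = (\<Sum>i\<in>Q \<times> X. \<Sum>y\<in>Y. (cmod (a' i y))\<^sup>2 + (cmod (b' i y))\<^sup>2)"
        using Ta unfolding T_def tr_red by (simp add: sum.distrib)
      also have "\<dots> = s\<^sup>2 / 2 * u + 1 / (2 * s\<^sup>2) * v"
        unfolding e u_def v_def sum.distrib sum_distrib_left ..
      finally show ?thesis .
    qed
    also have "\<dots> = u / \<delta> + \<delta> / 4 * v" using d0 by (simp add: s(2))
    also have "\<dots> \<le> \<delta>\<^sup>2 / \<delta> + \<delta> / 4 * 4"
      using d v d0 unfolding u_def[symmetric] by (intro add_mono divide_right_mono mult_left_mono) auto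
    also have "\<dots> = \<delta> + \<delta>" using d0 by (simp add: power2_eq_square)
    finally show ?thesis by simp
  qed
  let ?\<omega> = "\<lambda>i j. red Y a i j + red Y a' i j"
  have fQX: "finite (Q \<times> X)" using fin by simp
  have "cent Q X (red Y a) + cent Q X (red Y a') \<le> cent Q X ?\<omega>"
    by (rule cent_superadditive[OF fin(1,2) pos_red pos_red])
  also have "\<dots> = ent (Q \<times> X) (\<lambda>i j. red Y b i j + red Y b' i j) - ent X (\<lambda>i j. marg Q (red Y b) i j + marg Q (red Y b') i j)"
    unfolding key cent_def marg_add ..
  \<comment> \<open>The joint entropy is bounded by subadditivity of sums. The marginal entropy
    enters negatively, so its concavity is what is used, and this produces the \<open>eta\<close>
    terms.\<close>
  also have "\<dots> \<le> cent Q X (red Y b) + cent Q X (red Y b') + eta T - eta (1 + T)"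
  proof -
    have "ent (Q \<times> X) (\<lambda>i j. red Y b i j + red Y b' i j) \<le> ent (Q \<times> X) (red Y b) + ent (Q \<times> X) (red Y b')"
      by (rule ent_subadditive_sum[OF fQX pos_red pos_red])
    moreover have "ent X (marg Q (red Y b)) - eta 1 + (ent X (marg Q (red Y b')) - eta T)
      \<le> ent X (\<lambda>i j. marg Q (red Y b) i j + marg Q (red Y b') i j) - eta (1 + T)"
      using ent_superadditive[OF fin(2) pos_marg[OF fin(1) pos_red] pos_marg[OF fin(1) pos_red], of Y b Y b']
      by (simp only: tr_marg ta T_def[symmetric])
    ultimately show ?thesis by (simp add: cent_def)
  qed
  finally have 1: "cent Q X (red Y a) - cent Q X (red Y b) \<le> cent Q X (red Y b') - cent Q X (red Y a') + etagap T"
    by (simp add: etagap_def)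
  have L: "log 2 (card Q) \<ge> 0" by (cases "card Q = 0") (auto simp: log_def)
  have "cent Q X (red Y b') \<le> T * log 2 (card Q)"
    using cent_le_log_card[OF fin(1,2) pos_red, of Y b'] by (simp add: T_def)
  moreover have "- (T * log 2 (card Q)) \<le> cent Q X (red Y a')"
    using cent_ge_log_card[OF fin, of a'] by (simp add: Ta)
  moreover have "T * log 2 (card Q) \<le> \<delta> * log 2 (card Q)" using Td L by (rule mult_right_mono)
  ultimately show ?thesis using 1 etagap_mono[OF T0 Td] by simp
qed

subsection \<open>Isometries and product states\<close>

text \<open>The input index comes first: \<open>A x z\<close> is the entry in row z and column
  x.\<close>

definition isom :: "'x set \<Rightarrow> 'z set \<Rightarrow> ('x \<Rightarrow> 'z \<Rightarrow> complex) \<Rightarrow> bool" where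
  "isom X Z A \<longleftrightarrow> finite X \<and> finite Z \<and> (\<forall>x\<in>X. \<forall>y\<in>X. (\<Sum>z\<in>Z. cnj (A x z) * A y z) = kd x y)"

lemma isom_gram:
  assumes "isom X Z A"
  shows "(\<Sum>z\<in>Z. (\<Sum>x\<in>X. A x z * f x) * cnj (\<Sum>x\<in>X. A x z * g x)) = (\<Sum>x\<in>X. f x * cnj (g x))"
proof -
  have "(\<Sum>z\<in>Z. (\<Sum>x\<in>X. A x z * f x) * cnj (\<Sum>x\<in>X. A x z * g x))
     = (\<Sum>z\<in>Z. \<Sum>x\<in>X. \<Sum>y\<in>X. f x * cnj (g y) * (cnj (A y z) * A x z))"
    unfolding cnj_sum sum_product by (intro sum.cong refl) simp
  also have "\<dots> = (\<Sum>x\<in>X. \<Sum>y\<in>X. f x * cnj (g y) * (\<Sum>z\<in>Z. cnj (A y z) * A x z))"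
    unfolding sum_distrib_left by (subst sum.swap[of _ X Z], intro sum.cong refl sum.swap)
  also have "\<dots> = (\<Sum>x\<in>X. \<Sum>y\<in>X. f x * cnj (g y) * kd y x)"
    using assms by (intro sum.cong refl) (simp add: isom_def)
  also have "\<dots> = (\<Sum>x\<in>X. f x * cnj (g x))"
    using assms by (intro sum.cong refl) (simp add: isom_def)
  finally show ?thesis .
qed

text \<open>An isometry on the conditioning system preserves the Gram matrices that determine both
  entropies.\<close>

lemma cent_isom:
  assumes A: "isom X Z A" and fin: "finite Q" "finite Y"
    and a: "\<And>q z y. q \<in> Q \<Longrightarrow> z \<in> Z \<Longrightarrow> y \<in> Y \<Longrightarrow> a (q, z) y = (\<Sum>x\<in>X. A x z * \<chi> (q, x) y)"
  shows "cent Q Z (red Y a) = cent Q X (red Y \<chi>)"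
proof -
  have f: "finite X" "finite Z" using A by (simp_all add: isom_def)
  have "ent (Q \<times> Z) (red Y a) = ent (Q \<times> X) (red Y \<chi>)"
    using f fin by (intro ent_gram_eq) (simp_all add: sum_Times a isom_gram[OF A] del: cnj_sum)
  moreover have "ent Z (red (Q \<times> Y) (\<lambda>z p. a (fst p, z) (snd p))) = ent X (red (Q \<times> Y) (\<lambda>x p. \<chi> (fst p, x) (snd p)))"
    using f fin by (intro ent_gram_eq) (auto simp: sum_Times a isom_gram[OF A] simp del: cnj_sum)
  ultimately show ?thesis by (simp add: cent_def marg_red)
qed

text \<open>An isometry on a part of the environment cancels in the partial trace; \<open>O'\<close>
  is the part left alone.\<close>

lemma cent_isom_environment:
  assumes B: "isom W Z B"
    and a: "\<And>i z o'. i \<in> Q \<times> X \<Longrightarrow> z \<in> Z \<Longrightarrow> o' \<in> O' \<Longrightarrow> a i (z, o') = (\<Sum>w\<in>W. B w z * \<chi> i (w, o'))"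
  shows "cent Q X (red (Z \<times> O') a) = cent Q X (red (W \<times> O') \<chi>)"
proof (rule cent_cong)
  fix i j assume ij: "i \<in> Q \<times> X" "j \<in> Q \<times> X"
  have "red (Z \<times> O') a i j = (\<Sum>p\<in>O'. \<Sum>z\<in>Z. (\<Sum>w\<in>W. B w z * \<chi> i (w, p)) * cnj (\<Sum>w\<in>W. B w z * \<chi> j (w, p)))"
    unfolding red_def sum_Times by (subst sum.swap, intro sum.cong refl) (simp only: a ij)
  also have "\<dots> = red (W \<times> O') \<chi> i j"
    unfolding isom_gram[OF B] red_def sum_Times by (rule sum.swap)
  finally show "red (Z \<times> O') a i j = red (W \<times> O') \<chi> i j" .
qed

text \<open>One inequality discards E by strong subadditivity. The other is its mirror image under
  duality, where the environment is conditioned on and F is discarded.\<close>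

lemma cent_product:
  assumes fin: "finite Q" "finite X" "finite Y" "finite E" "finite F"
    and c: "(\<Sum>e\<in>E. \<Sum>f\<in>F. (cmod (c e f))\<^sup>2) = 1"
  shows "cent Q (X \<times> E) (red (Y \<times> F) (\<lambda>i y. u (fst i, fst (snd i)) (fst y) * c (snd (snd i)) (snd y))) = cent Q X (red Y u)"
proof (rule antisym)
  let ?b = "\<lambda>i y. u (fst i, fst (snd i)) (fst y) * c (snd (snd i)) (snd y)"
  have cc: "(\<Sum>e\<in>E. \<Sum>f\<in>F. c e f * cnj (c e f)) = 1"
    using c by (simp add: mult_cnj_self flip: of_real_power of_real_sum)
  have cc': "(\<Sum>f\<in>F. \<Sum>e\<in>E. c e f * cnj (c e f)) = 1"
    using cc by (subst sum.swap)
  have "cent Q (X \<times> E) (red (Y \<times> F) ?b)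
    \<le> cent Q X (\<lambda>a b. \<Sum>e\<in>E. red (Y \<times> F) ?b (fst a, snd a, e) (fst b, snd b, e))"
    using fin by (intro cent_strong_subadditivity pos_red)
  also have "(\<lambda>a b. \<Sum>e\<in>E. red (Y \<times> F) ?b (fst a, snd a, e) (fst b, snd b, e)) = red Y u"
  proof (intro ext)
    fix a b
    have "(\<Sum>e\<in>E. red (Y \<times> F) ?b (fst a, snd a, e) (fst b, snd b, e))
      = (\<Sum>e\<in>E. \<Sum>y\<in>Y. \<Sum>f\<in>F. u a y * cnj (u b y) * (c e f * cnj (c e f)))"
      unfolding red_def sum_Times by (intro sum.cong refl) simp
    also have "\<dots> = (\<Sum>y\<in>Y. u a y * cnj (u b y) * (\<Sum>e\<in>E. \<Sum>f\<in>F. c e f * cnj (c e f)))"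
      unfolding sum_distrib_left by (rule sum.swap)
    finally show "(\<Sum>e\<in>E. red (Y \<times> F) ?b (fst a, snd a, e) (fst b, snd b, e)) = red Y u a b"
      by (simp add: cc red_def)
  qed
  finally show "cent Q (X \<times> E) (red (Y \<times> F) ?b) \<le> cent Q X (red Y u)" .
  let ?b' = "\<lambda>a x. ?b (fst a, x) (snd a)"
  let ?u' = "\<lambda>a x. u (fst a, x) (snd a)"
  have "cent Q (Y \<times> F) (red (X \<times> E) ?b')
    \<le> cent Q Y (\<lambda>a b. \<Sum>f\<in>F. red (X \<times> E) ?b' (fst a, snd a, f) (fst b, snd b, f))"
    using fin by (intro cent_strong_subadditivity pos_red)
  also have "(\<lambda>a b. \<Sum>f\<in>F. red (X \<times> E) ?b' (fst a, snd a, f) (fst b, snd b, f)) = red X ?u'"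
  proof (intro ext)
    fix a b
    have "(\<Sum>f\<in>F. red (X \<times> E) ?b' (fst a, snd a, f) (fst b, snd b, f))
      = (\<Sum>f\<in>F. \<Sum>x\<in>X. \<Sum>e\<in>E. ?u' a x * cnj (?u' b x) * (c e f * cnj (c e f)))"
      unfolding red_def sum_Times by (intro sum.cong refl) simp
    also have "\<dots> = (\<Sum>x\<in>X. ?u' a x * cnj (?u' b x) * (\<Sum>f\<in>F. \<Sum>e\<in>E. c e f * cnj (c e f)))"
      unfolding sum_distrib_left by (rule sum.swap)
    finally show "(\<Sum>f\<in>F. red (X \<times> E) ?b' (fst a, snd a, f) (fst b, snd b, f)) = red X ?u' a b"
      by (simp add: cc' red_def)
  qed
  finally show "cent Q X (red Y u) \<le> cent Q (X \<times> E) (red (Y \<times> F) ?b)"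
    using fin by (subst (1 2) cent_dual) auto
qed

text \<open>The components of a along u form, after normalisation, a state of the environment whose product
  with u overlaps a in the square root of their total weight.\<close>
lemma cent_near_product:
  fixes a :: "'q \<times> 'x \<times> 'e \<Rightarrow> 'y \<times> 'f \<Rightarrow> complex" and u :: "'q \<times> 'x \<Rightarrow> 'y \<Rightarrow> complex"
  assumes fin: "finite Q" "finite X" "finite Y" "finite E" "finite F"
    and a: "(\<Sum>i\<in>Q \<times> X \<times> E. \<Sum>y\<in>Y \<times> F. (cmod (a i y))\<^sup>2) = 1"
    and u: "(\<Sum>i\<in>Q \<times> X. \<Sum>y\<in>Y. (cmod (u i y))\<^sup>2) = 1"
    and fid: "(\<Sum>e\<in>E. \<Sum>f\<in>F. (cmod (\<Sum>i\<in>Q \<times> X. \<Sum>y\<in>Y. cnj (u i y) * a (fst i, snd i, e) (y, f)))\<^sup>2) \<ge> 1 - \<epsilon>"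
    and eps: "0 \<le> \<epsilon>" "\<epsilon> < 1"
  shows "\<bar>cent Q (X \<times> E) (red (Y \<times> F) a) - cent Q X (red Y u)\<bar>
     \<le> 2 * sqrt (2 * \<epsilon>) * log 2 (card Q) + etagap (sqrt (2 * \<epsilon>))"
proof -
  define c where "c e f = (\<Sum>i\<in>Q \<times> X. \<Sum>y\<in>Y. cnj (u i y) * a (fst i, snd i, e) (y, f))" for e f
  define P where "P = (\<Sum>e\<in>E. \<Sum>f\<in>F. (cmod (c e f))\<^sup>2)"
  have P: "P \<ge> 1 - \<epsilon>" using fid by (simp add: P_def c_def)
  then have P0: "P > 0" using eps by simp
  define c' where "c' e f = c e f / of_real (sqrt P)" for e f
  have c'2: "(cmod (c' e f))\<^sup>2 = (cmod (c e f))\<^sup>2 / P" for e f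
    using P0 by (simp add: c'_def norm_divide power_divide)
  have c'1: "(\<Sum>e\<in>E. \<Sum>f\<in>F. (cmod (c' e f))\<^sup>2) = 1"
    unfolding c'2 sum_divide_distrib[symmetric] P_def[symmetric] using P0 by simp
  define b where "b i y = u (fst i, fst (snd i)) (fst y) * c' (snd (snd i)) (snd y)" for i :: "'q \<times> 'x \<times> 'e" and y :: "'y \<times> 'f"
  have re: "(\<Sum>i\<in>Q \<times> X \<times> E. \<Sum>y\<in>Y \<times> F. G i y) = (\<Sum>e\<in>E. \<Sum>f\<in>F. \<Sum>i\<in>Q \<times> X. \<Sum>y\<in>Y. G (fst i, snd i, e) (y, f))"
    for G :: "_ \<Rightarrow> _ \<Rightarrow> 'r :: comm_monoid_add"
  proof -
    have "(\<Sum>i\<in>Q \<times> X \<times> E. \<Sum>y\<in>Y \<times> F. G i y) = (\<Sum>i\<in>Q \<times> X. \<Sum>e\<in>E. \<Sum>y\<in>Y. \<Sum>f\<in>F. G (fst i, snd i, e) (y, f))"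
      by (simp add: sum_Times)
    also have "\<dots> = (\<Sum>e\<in>E. \<Sum>i\<in>Q \<times> X. \<Sum>f\<in>F. \<Sum>y\<in>Y. G (fst i, snd i, e) (y, f))"
      by (subst sum.swap, intro sum.cong refl sum.swap)
    also have "\<dots> = (\<Sum>e\<in>E. \<Sum>f\<in>F. \<Sum>i\<in>Q \<times> X. \<Sum>y\<in>Y. G (fst i, snd i, e) (y, f))"
      by (intro sum.cong refl sum.swap)
    finally show ?thesis .
  qed
  have b1: "(\<Sum>i\<in>Q \<times> X \<times> E. \<Sum>y\<in>Y \<times> F. (cmod (b i y))\<^sup>2) = 1"
  proof -
    have "(\<Sum>i\<in>Q \<times> X \<times> E. \<Sum>y\<in>Y \<times> F. (cmod (b i y))\<^sup>2)
      = (\<Sum>e\<in>E. \<Sum>f\<in>F. (\<Sum>i\<in>Q \<times> X. \<Sum>y\<in>Y. (cmod (u i y))\<^sup>2) * (cmod (c' e f))\<^sup>2)"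
      unfolding re b_def sum_distrib_right by (simp add: norm_mult power_mult_distrib)
    then show ?thesis unfolding u using c'1 by simp
  qed
  have ba: "(\<Sum>i\<in>Q \<times> X \<times> E. \<Sum>y\<in>Y \<times> F. cnj (b i y) * a i y) = of_real (sqrt P)"
  proof -
    have "(\<Sum>i\<in>Q \<times> X \<times> E. \<Sum>y\<in>Y \<times> F. cnj (b i y) * a i y) = (\<Sum>e\<in>E. \<Sum>f\<in>F. cnj (c' e f) * c e f)"
      unfolding re c_def sum_distrib_left by (intro sum.cong refl) (simp add: b_def)
    also have "\<dots> = (\<Sum>e\<in>E. \<Sum>f\<in>F. of_real ((cmod (c e f))\<^sup>2 / sqrt P))"
      by (intro sum.cong refl) (simp add: c'_def cnj_mult_self)
    also have "\<dots> = of_real (P / sqrt P)"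
      unfolding P_def sum_divide_distrib by simp
    finally show ?thesis using P0 by (simp add: real_div_sqrt)
  qed
  have exp2: "(cmod (z - w))\<^sup>2 = (cmod z)\<^sup>2 + (cmod w)\<^sup>2 - 2 * Re (cnj w * z)" for z w
    unfolding cmod_power2 by (simp add: power2_eq_square algebra_simps)
  have ab: "(\<Sum>i\<in>Q \<times> X \<times> E. \<Sum>y\<in>Y \<times> F. (cmod (a i y - b i y))\<^sup>2) = 2 - 2 * sqrt P"
    unfolding exp2 sum_subtractf sum.distrib a b1 sum_distrib_left[symmetric] Re_sum[symmetric] ba by simp
  \<comment> \<open>A squared distance is nonnegative, so P is at most 1 and thus at most its root;
    this turns 2 - 2 sqrt P into at most 2 - 2P, hence at most 2\<epsilon>.\<close>
  have "0 \<le> 2 - 2 * sqrt P" unfolding ab[symmetric] by (intro sum_nonneg) auto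
  then have "sqrt P \<le> 1" by simp
  then have "sqrt P * sqrt P \<le> 1 * sqrt P" using P0 by (intro mult_right_mono) auto
  then have "P \<le> sqrt P" using P0 by simp
  then have "(\<Sum>i\<in>Q \<times> X \<times> E. \<Sum>y\<in>Y \<times> F. (cmod (a i y - b i y))\<^sup>2) \<le> (sqrt (2 * \<epsilon>))\<^sup>2"
    unfolding ab using P eps by simp
  moreover from this have "(\<Sum>i\<in>Q \<times> X \<times> E. \<Sum>y\<in>Y \<times> F. (cmod (b i y - a i y))\<^sup>2) \<le> (sqrt (2 * \<epsilon>))\<^sup>2"
    by (simp add: norm_minus_commute)
  moreover have "finite (X \<times> E)" "finite (Y \<times> F)" "0 \<le> sqrt (2 * \<epsilon>)" using fin eps by auto
  ultimately have "\<bar>cent Q (X \<times> E) (red (Y \<times> F) a) - cent Q (X \<times> E) (red (Y \<times> F) b)\<bar>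
     \<le> 2 * sqrt (2 * \<epsilon>) * log 2 (card Q) + etagap (sqrt (2 * \<epsilon>))"
    using cent_continuity[of Q "X \<times> E" "Y \<times> F" "sqrt (2 * \<epsilon>)" a b]
      cent_continuity[of Q "X \<times> E" "Y \<times> F" "sqrt (2 * \<epsilon>)" b a] fin(1) a b1 by (simp add: abs_le_iff)
  moreover have "cent Q (X \<times> E) (red (Y \<times> F) b) = cent Q X (red Y u)"
    unfolding b_def by (rule cent_product[OF fin c'1])
  ultimately show ?thesis by simp
qed

subsection \<open>The entropy bound for a single round of communication\<close>

lemma ent_subadditivity:
  assumes fin: "finite A" "finite B" and pos: "pos (A \<times> B) \<rho>" and tr: "tr (A \<times> B) \<rho> = 1"
  shows "ent (A \<times> B) \<rho> \<le> ent A (margR B \<rho>) + ent B (marg A \<rho>)"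
  using cent_le_ent[OF fin pos] by (simp add: cent_def tr)

text \<open>The vector on Q K R Z is pure, so S(QK) = S(RZ) is at most S(R) + S(Z) = S(R) + S(QKR).
  Together with S(KR) at most S(K) + S(R), this removes R at the price of twice its entropy.\<close>

lemma cent_remove_resource:
  fixes \<xi> :: "'q \<Rightarrow> 'k \<Rightarrow> 'r \<Rightarrow> 'z \<Rightarrow> complex"
  assumes fin: "finite Q" "finite K" "finite R" "finite Z"
    and norm: "(\<Sum>q\<in>Q. \<Sum>k\<in>K. \<Sum>r\<in>R. \<Sum>z\<in>Z. (cmod (\<xi> q k r z))\<^sup>2) = 1"
  shows "cent Q K (red (R \<times> Z) (\<lambda>i p. \<xi> (fst i) (snd i) (fst p) (snd p)))
    \<le> cent Q (K \<times> R) (red Z (\<lambda>i z. \<xi> (fst i) (fst (snd i)) (snd (snd i)) z))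
      + 2 * ent R (red (Q \<times> K \<times> Z) (\<lambda>r p. \<xi> (fst p) (fst (snd p)) r (snd (snd p))))"
proof -
  define s1 where "s1 = (\<lambda>i p. \<xi> (fst i) (snd i) (fst p) (snd p))"
  define s2 where "s2 = (\<lambda>i z. \<xi> (fst i) (fst (snd i)) (snd (snd i)) z)"
  define sR where "sR = (\<lambda>r p. \<xi> (fst p) (fst (snd p)) r (snd (snd p)))"
  define N where "N = red (Q \<times> K) (\<lambda>p i. s1 i p)"
  define M where "M = marg Q (red Z s2)"
  have trs2: "tr (Q \<times> K \<times> R) (red Z s2) = 1" unfolding tr_red s2_def sum_Times using norm by simp
  have "tr (R \<times> Z) N = (\<Sum>i\<in>Q \<times> K. \<Sum>p\<in>R \<times> Z. (cmod (s1 i p))\<^sup>2)"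
    unfolding N_def tr_red by (rule sum.swap)
  also have "\<dots> = 1" unfolding s1_def sum_Times using norm by simp
  finally have trN: "tr (R \<times> Z) N = 1" .
  have "ent (Q \<times> K) (red (R \<times> Z) s1) = ent (R \<times> Z) N"
    unfolding N_def using fin by (intro ent_schmidt) auto
  also have "\<dots> \<le> ent R (margR Z N) + ent Z (marg R N)"
    using fin trN by (intro ent_subadditivity) (auto simp: N_def pos_red)
  also have "margR Z N = red (Q \<times> K \<times> Z) sR"
  proof (intro ext)
    fix r r'
    have "margR Z N r r' = (\<Sum>z\<in>Z. \<Sum>i\<in>Q \<times> K. \<xi> (fst i) (snd i) r z * cnj (\<xi> (fst i) (snd i) r' z))"
      by (simp add: margR_def N_def red_def s1_def)
    also have "\<dots> = (\<Sum>i\<in>Q \<times> K. \<Sum>z\<in>Z. \<xi> (fst i) (snd i) r z * cnj (\<xi> (fst i) (snd i) r' z))"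
      by (rule sum.swap)
    finally show "margR Z N r r' = red (Q \<times> K \<times> Z) sR r r'"
      by (simp add: red_def sR_def sum_Times)
  qed
  also have "ent Z (marg R N) = ent (Q \<times> K \<times> R) (red Z s2)"
  proof -
    have "ent Z (marg R N) = ent Z (red (Q \<times> K \<times> R) (\<lambda>z i. s2 i z))"
    proof (rule ent_cong)
      fix z z'
      have "marg R N z z' = (\<Sum>r\<in>R. \<Sum>i\<in>Q \<times> K. \<xi> (fst i) (snd i) r z * cnj (\<xi> (fst i) (snd i) r z'))"
        by (simp add: marg_def N_def red_def s1_def)
      also have "\<dots> = (\<Sum>i\<in>Q \<times> K. \<Sum>r\<in>R. \<xi> (fst i) (snd i) r z * cnj (\<xi> (fst i) (snd i) r z'))"
        by (rule sum.swap)
      finally show "marg R N z z' = red (Q \<times> K \<times> R) (\<lambda>z i. s2 i z) z z'"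
        by (simp add: red_def s2_def sum_Times)
    qed
    also have "\<dots> = ent (Q \<times> K \<times> R) (red Z s2)"
      using fin by (intro ent_schmidt[symmetric]) auto
    finally show ?thesis .
  qed
  finally have 1: "ent (Q \<times> K) (red (R \<times> Z) s1) \<le> ent R (red (Q \<times> K \<times> Z) sR) + ent (Q \<times> K \<times> R) (red Z s2)" .
  have "ent (K \<times> R) M \<le> ent K (margR R M) + ent R (marg K M)"
    unfolding M_def using fin trs2
    by (intro ent_subadditivity pos_marg pos_red) (auto simp: tr_marg)
  also have "margR R M = marg Q (red (R \<times> Z) s1)"
    unfolding fun_eq_iff margR_def M_def marg_def red_def sum_Times s1_def s2_def
    by (auto intro: sum.swap)
  also have "marg K M = red (Q \<times> K \<times> Z) sR"
    unfolding fun_eq_iff M_def marg_def red_def sum_Times sR_def s2_def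
    by (auto intro: sum.swap)
  finally have 2: "ent (K \<times> R) M \<le> ent K (marg Q (red (R \<times> Z) s1)) + ent R (red (Q \<times> K \<times> Z) sR)" .
  show ?thesis
    using 1 2 unfolding s1_def[symmetric] s2_def[symmetric] sR_def[symmetric] cent_def M_def by simp
qed

text \<open>Z holds the systems untouched by T, M is the message in its output, and Y is the part of
  the output that is not sent.\<close>

definition apply_right :: "'r set \<Rightarrow> ('r \<Rightarrow> 'm \<times> 'y \<Rightarrow> complex) \<Rightarrow> ('q \<Rightarrow> 'k \<Rightarrow> 'r \<Rightarrow> 'z \<Rightarrow> complex)
    \<Rightarrow> 'q \<times> 'k \<times> 'm \<Rightarrow> 'z \<times> 'y \<Rightarrow> complex" where
  "apply_right R T \<xi> i p = (\<Sum>r\<in>R. T r (snd (snd i), snd p) * \<xi> (fst i) (fst (snd i)) r (fst p))"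

text \<open>Strong subadditivity discards the message M. The output of T is then traced out entirely
  and T cancels, so the bound does not depend on T.\<close>

lemma cent_apply_right_le:
  assumes fin: "finite Q" "finite K" "finite M" "finite Y" "finite Z" and T: "isom R (M \<times> Y) T"
  shows "cent Q (K \<times> M) (red (Z \<times> Y) (apply_right R T \<xi>))
    \<le> cent Q K (red (R \<times> Z) (\<lambda>i p. \<xi> (fst i) (snd i) (fst p) (snd p)))"
proof -
  let ?\<chi> = "apply_right R T \<xi>"
  have "cent Q (K \<times> M) (red (Z \<times> Y) ?\<chi>)
    \<le> cent Q K (\<lambda>a b. \<Sum>m\<in>M. red (Z \<times> Y) ?\<chi> (fst a, snd a, m) (fst b, snd b, m))"
    using fin by (intro cent_strong_subadditivity pos_red)
  also have "(\<lambda>a b. \<Sum>m\<in>M. red (Z \<times> Y) ?\<chi> (fst a, snd a, m) (fst b, snd b, m))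
      = red (R \<times> Z) (\<lambda>i p. \<xi> (fst i) (snd i) (fst p) (snd p))"
  proof (intro ext)
    fix a b :: "'a \<times> 'b"
    have "(\<Sum>m\<in>M. red (Z \<times> Y) ?\<chi> (fst a, snd a, m) (fst b, snd b, m))
      = (\<Sum>m\<in>M. \<Sum>z\<in>Z. \<Sum>y\<in>Y. (\<Sum>r\<in>R. T r (m, y) * \<xi> (fst a) (snd a) r z) * cnj (\<Sum>r\<in>R. T r (m, y) * \<xi> (fst b) (snd b) r z))"
      by (simp add: red_def sum_Times apply_right_def)
    also have "\<dots> = (\<Sum>z\<in>Z. \<Sum>p\<in>M \<times> Y. (\<Sum>r\<in>R. T r p * \<xi> (fst a) (snd a) r z) * cnj (\<Sum>r\<in>R. T r p * \<xi> (fst b) (snd b) r z))"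
      unfolding sum_Times by (rule sum.swap)
    also have "\<dots> = (\<Sum>r\<in>R. \<Sum>z\<in>Z. \<xi> (fst a) (snd a) r z * cnj (\<xi> (fst b) (snd b) r z))"
      unfolding isom_gram[OF T] by (rule sum.swap)
    finally show "(\<Sum>m\<in>M. red (Z \<times> Y) ?\<chi> (fst a, snd a, m) (fst b, snd b, m))
      = red (R \<times> Z) (\<lambda>i p. \<xi> (fst i) (snd i) (fst p) (snd p)) a b"
      by (simp add: red_def sum_Times)
  qed
  finally show ?thesis .
qed

text \<open>T extended by the identity on K is an isometry on the conditioning system and changes
  nothing; discarding its unsent output Y can only raise the conditional entropy.\<close>

lemma cent_le_apply_right:
  fixes \<xi> :: "'q \<Rightarrow> 'k \<Rightarrow> 'r \<Rightarrow> 'z \<Rightarrow> complex" and T :: "'r \<Rightarrow> 'm \<times> 'y \<Rightarrow> complex"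
  assumes fin: "finite Q" "finite K" "finite M" "finite Y" "finite Z" and T: "isom R (M \<times> Y) T"
  shows "cent Q (K \<times> R) (red Z (\<lambda>i z. \<xi> (fst i) (fst (snd i)) (snd (snd i)) z))
    \<le> cent Q (K \<times> M) (red (Z \<times> Y) (apply_right R T \<xi>))"
proof -
  have fR: "finite R" using T by (simp add: isom_def)
  define A :: "'k \<times> 'r \<Rightarrow> ('k \<times> 'm) \<times> 'y \<Rightarrow> complex" where "A = (\<lambda>x z. kd (fst x) (fst (fst z)) * T (snd x) (snd (fst z), snd z))"
  define a :: "'q \<times> ('k \<times> 'm) \<times> 'y \<Rightarrow> 'z \<Rightarrow> complex" where "a = (\<lambda>i z. \<Sum>r\<in>R. T r (snd (fst (snd i)), snd (snd i)) * \<xi> (fst i) (fst (fst (snd i))) r z)"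
  have "isom (K \<times> R) ((K \<times> M) \<times> Y) A"
    unfolding isom_def
  proof (intro conjI ballI)
    fix x y assume xy: "x \<in> K \<times> R" "y \<in> K \<times> R"
    have "(\<Sum>z\<in>(K \<times> M) \<times> Y. cnj (A x z) * A y z)
      = (\<Sum>k\<in>K. kd (fst x) k * (kd (fst y) k * (\<Sum>p\<in>M \<times> Y. cnj (T (snd x) p) * T (snd y) p)))"
      unfolding sum_Times sum_distrib_left A_def by (intro sum.cong refl) simp
    also have "\<dots> = kd (fst x) (fst y) * kd (snd x) (snd y)"
      using xy T fin by (auto simp: isom_def kd_sym)
    finally show "(\<Sum>z\<in>(K \<times> M) \<times> Y. cnj (A x z) * A y z) = kd x y" by (simp flip: kd_pair)
  qed (use fin fR in auto)
  then have "cent Q ((K \<times> M) \<times> Y) (red Z a) = cent Q (K \<times> R) (red Z (\<lambda>i z. \<xi> (fst i) (fst (snd i)) (snd (snd i)) z))"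
  proof (rule cent_isom[OF _ fin(1,5)])
    fix q z y assume z: "z \<in> (K \<times> M) \<times> Y"
    have "(\<Sum>x\<in>K \<times> R. A x z * \<xi> (fst (q, x)) (fst (snd (q, x))) (snd (snd (q, x))) y)
      = (\<Sum>k\<in>K. kd (fst (fst z)) k * (\<Sum>r\<in>R. T r (snd (fst z), snd z) * \<xi> q k r y))"
      unfolding sum_Times sum_distrib_left A_def by (intro sum.cong refl) (simp add: kd_sym)
    also have "\<dots> = a (q, z) y" using z fin by (auto simp: a_def)
    finally show "a (q, z) y = (\<Sum>x\<in>K \<times> R. A x z * \<xi> (fst (q, x)) (fst (snd (q, x))) (snd (snd (q, x))) y)" by simp
  qed
  then have "cent Q (K \<times> R) (red Z (\<lambda>i z. \<xi> (fst i) (fst (snd i)) (snd (snd i)) z)) = cent Q ((K \<times> M) \<times> Y) (red Z a)" by simp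
  also have "\<dots> \<le> cent Q (K \<times> M) (\<lambda>b c. \<Sum>y\<in>Y. red Z a (fst b, snd b, y) (fst c, snd c, y))"
    using fin by (intro cent_strong_subadditivity pos_red) auto
  also have "(\<lambda>b c. \<Sum>y\<in>Y. red Z a (fst b, snd b, y) (fst c, snd c, y)) = red (Z \<times> Y) (apply_right R T \<xi>)"
    unfolding fun_eq_iff red_def sum_Times a_def apply_right_def by (auto intro: sum.swap)
  finally show ?thesis .
qed

text \<open>T and \<open>T'\<close> stand for Bob's operation with one or the other of his two
  inputs absorbed.\<close>

theorem cent_single_round_bound:
  fixes \<xi> :: "'q \<Rightarrow> 'k \<Rightarrow> 'r \<Rightarrow> 'z \<Rightarrow> complex"
  assumes fin: "finite Q" "finite K" "finite M" "finite Y" "finite Z"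
    and T: "isom R (M \<times> Y) T" "isom R (M \<times> Y) T'"
    and norm: "(\<Sum>q\<in>Q. \<Sum>k\<in>K. \<Sum>r\<in>R. \<Sum>z\<in>Z. (cmod (\<xi> q k r z))\<^sup>2) = 1"
  shows "cent Q (K \<times> M) (red (Z \<times> Y) (apply_right R T' \<xi>))
    \<le> cent Q (K \<times> M) (red (Z \<times> Y) (apply_right R T \<xi>))
      + 2 * ent R (red (Q \<times> K \<times> Z) (\<lambda>r p. \<xi> (fst p) (fst (snd p)) r (snd (snd p))))"
proof -
  have fR: "finite R" using T by (simp add: isom_def)
  show ?thesis
    using cent_apply_right_le[OF fin T(2), of \<xi>] cent_remove_resource[OF fin(1,2) fR fin(5) norm]
      cent_le_apply_right[OF fin T(1), of \<xi>] by linarith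
qed

lemma isom_norm:
  assumes "isom X Z A"
  shows "(\<Sum>z\<in>Z. (cmod (\<Sum>x\<in>X. A x z * f x))\<^sup>2) = (\<Sum>x\<in>X. (cmod (f x))\<^sup>2)"
proof -
  have "complex_of_real (\<Sum>z\<in>Z. (cmod (\<Sum>x\<in>X. A x z * f x))\<^sup>2) = of_real (\<Sum>x\<in>X. (cmod (f x))\<^sup>2)"
    using isom_gram[OF assms, of f f] by (simp add: mult_cnj_self del: cnj_sum)
  then show ?thesis by (simp only: of_real_eq_iff)
qed

lemma red_reindex:
  assumes "bij_betw h S R"
  shows "red R \<psi> = red S (\<lambda>i r. \<psi> i (h r))"
  unfolding fun_eq_iff red_def by (intro allI sum.reindex_bij_betw[symmetric, OF assms])

text \<open>Stinespring form of a protocol: \<open>E1\<close> to \<open>E4\<close> are the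
  environments of the four local operations, and \<psi> lists the amplitudes of the resource. The
  environment of a first operation precedes its outputs, that of a last operation follows
  them.\<close>

locale protocol =
  fixes A :: "'a set" and B :: "'b set" and L :: "'l set" and R :: "'r set"
    and Ka :: "'ka set" and Ma :: "'ma set" and Kb :: "'kb set" and Mb :: "'mb set"
    and E1 :: "'e1 set" and E2 :: "'e2 set" and E3 :: "'e3 set" and E4 :: "'e4 set"
    and V :: "'a \<times> 'l \<Rightarrow> 'e1 \<times> 'ka \<times> 'mb \<Rightarrow> complex"
    and V' :: "'r \<times> 'b \<Rightarrow> 'e2 \<times> 'ma \<times> 'kb \<Rightarrow> complex"
    and W :: "'ka \<times> 'ma \<Rightarrow> 'a \<times> 'e3 \<Rightarrow> complex"
    and W' :: "'mb \<times> 'kb \<Rightarrow> 'b \<times> 'e4 \<Rightarrow> complex"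
    and \<psi> :: "'l \<Rightarrow> 'r \<Rightarrow> complex"
  assumes fin: "finite A" "finite B" "finite L" "finite R" "finite Ka" "finite Ma" "finite Kb" "finite Mb"
      "finite E1" "finite E2" "finite E3" "finite E4"
    and V: "isom (A \<times> L) (E1 \<times> Ka \<times> Mb) V" and V': "isom (R \<times> B) (E2 \<times> Ma \<times> Kb) V'"
    and W: "isom (Ka \<times> Ma) (A \<times> E3) W" and W': "isom (Mb \<times> Kb) (B \<times> E4) W'"
    and \<psi>: "(\<Sum>l\<in>L. \<Sum>r\<in>R. (cmod (\<psi> l r))\<^sup>2) = 1"
begin

text \<open>Amplitude after the exchange for the basis input x: i collects what Alice holds, j what
  Bob holds, and f the environments of the two first operations.\<close>

definition H :: "'a \<times> 'b \<Rightarrow> 'ka \<times> 'ma \<Rightarrow> 'mb \<times> 'kb \<Rightarrow> 'e1 \<times> 'e2 \<Rightarrow> complex" where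
  "H x i j f = (\<Sum>l\<in>L. \<Sum>r\<in>R. V (fst x, l) (fst f, fst i, fst j) * V' (r, snd x) (snd f, snd i, snd j) * \<psi> l r)"

definition G :: "'a \<times> 'b \<Rightarrow> ('a \<times> 'e3) \<times> ('b \<times> 'e4) \<times> 'e1 \<times> 'e2 \<Rightarrow> complex" where
  "G x z = (\<Sum>i\<in>Ka \<times> Ma. W i (fst z) * (\<Sum>j\<in>Mb \<times> Kb. W' j (fst (snd z)) * H x i j (snd (snd z))))"

text \<open>V and then \<open>V'\<close> are contracted as isometries, and the norm of \<psi>
  remains.\<close>

lemma H_gram:
  assumes x: "x \<in> A \<times> B" and y: "y \<in> A \<times> B"
  shows "(\<Sum>i\<in>Ka \<times> Ma. \<Sum>j\<in>Mb \<times> Kb. \<Sum>f\<in>E1 \<times> E2. H y i j f * cnj (H x i j f)) = kd x y"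
proof -
  define g where "g u l t = (\<Sum>r\<in>R. V' (r, u) t * \<psi> l r)" for u l t
  \<comment> \<open>The inserted \<open>kd\<close> extends the sum over l to all of A \<times> L,
    the domain of V, so that \<open>isom_gram\<close> applies; \<open>gV\<close> does the same for
    \<open>V'\<close>.\<close>
  have HV: "H u i j f = (\<Sum>v\<in>A \<times> L. V v (fst f, fst i, fst j) * (kd (fst u) (fst v) * g (snd u) (snd v) (snd f, snd i, snd j)))"
    if "u \<in> A \<times> B" for u i j f
  proof -
    have "(\<Sum>v\<in>A \<times> L. V v (fst f, fst i, fst j) * (kd (fst u) (fst v) * g (snd u) (snd v) (snd f, snd i, snd j)))
      = (\<Sum>a\<in>A. kd (fst u) a * (\<Sum>l\<in>L. V (a, l) (fst f, fst i, fst j) * g (snd u) l (snd f, snd i, snd j)))"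
      unfolding sum_Times sum_distrib_left by (intro sum.cong refl) simp
    also have "\<dots> = (\<Sum>l\<in>L. V (fst u, l) (fst f, fst i, fst j) * g (snd u) l (snd f, snd i, snd j))"
      using that fin by auto
    also have "\<dots> = H u i j f" unfolding H_def g_def sum_distrib_left by (simp add: mult.assoc)
    finally show ?thesis ..
  qed
  have gV: "g u l t = (\<Sum>v\<in>R \<times> B. V' v t * (\<psi> l (fst v) * kd u (snd v)))" if "u \<in> B" for u l t
  proof -
    have "(\<Sum>v\<in>R \<times> B. V' v t * (\<psi> l (fst v) * kd u (snd v))) = (\<Sum>r\<in>R. \<Sum>b\<in>B. V' (r, b) t * \<psi> l r * kd u b)"
      unfolding sum_Times by (intro sum.cong refl) simp
    also have "\<dots> = g u l t" using that fin by (simp add: g_def)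
    finally show ?thesis ..
  qed
  have gg: "(\<Sum>t\<in>E2 \<times> Ma \<times> Kb. g u l t * cnj (g u' l t)) = kd u u' * (\<Sum>r\<in>R. \<psi> l r * cnj (\<psi> l r))"
    if u: "u \<in> B" "u' \<in> B" for u u' l
  proof -
    have "(\<Sum>t\<in>E2 \<times> Ma \<times> Kb. g u l t * cnj (g u' l t))
      = (\<Sum>v\<in>R \<times> B. (\<psi> l (fst v) * kd u (snd v)) * cnj (\<psi> l (fst v) * kd u' (snd v)))"
      unfolding gV[OF u(1)] gV[OF u(2)] by (rule isom_gram[OF V'])
    also have "\<dots> = (\<Sum>v\<in>R \<times> B. (\<psi> l (fst v) * cnj (\<psi> l (fst v))) * (kd u (snd v) * kd u' (snd v)))"
      by (intro sum.cong refl) simp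
    also have "\<dots> = kd u u' * (\<Sum>r\<in>R. \<psi> l r * cnj (\<psi> l r))"
      unfolding sum_Times fst_conv snd_conv sum_product[symmetric] using u fin by (simp add: kd_sym)
    finally show ?thesis .
  qed
  have "(\<Sum>i\<in>Ka \<times> Ma. \<Sum>j\<in>Mb \<times> Kb. \<Sum>f\<in>E1 \<times> E2. H y i j f * cnj (H x i j f))
    = (\<Sum>t\<in>E2 \<times> Ma \<times> Kb. \<Sum>s\<in>E1 \<times> Ka \<times> Mb.
        H y (fst (snd s), fst (snd t)) (snd (snd s), snd (snd t)) (fst s, fst t)
        * cnj (H x (fst (snd s), fst (snd t)) (snd (snd s), snd (snd t)) (fst s, fst t)))"
  proof -
    define F where "F i j f = H y i j f * cnj (H x i j f)" for i j f
    have "(\<Sum>i\<in>Ka \<times> Ma. \<Sum>j\<in>Mb \<times> Kb. \<Sum>f\<in>E1 \<times> E2. F i j f)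
      = (\<Sum>p\<in>(Ka \<times> Ma) \<times> (Mb \<times> Kb) \<times> (E1 \<times> E2). F (fst p) (fst (snd p)) (snd (snd p)))"
      by (simp add: sum_Times)
    also have "\<dots> = (\<Sum>p\<in>(E2 \<times> Ma \<times> Kb) \<times> (E1 \<times> Ka \<times> Mb).
        F (fst (snd (snd p)), fst (snd (fst p))) (snd (snd (snd p)), snd (snd (fst p))) (fst (snd p), fst (fst p)))"
      by (rule sum.reindex_bij_witness[of _
          "\<lambda>p. ((fst (snd (snd p)), fst (snd (fst p))), (snd (snd (snd p)), snd (snd (fst p))), (fst (snd p), fst (fst p)))"
          "\<lambda>p. ((snd (snd (snd p)), snd (fst p), snd (fst (snd p))), (fst (snd (snd p)), fst (fst p), fst (fst (snd p))))"]) auto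
    finally show ?thesis by (simp add: sum_Times F_def)
  qed
  also have "\<dots> = (\<Sum>t\<in>E2 \<times> Ma \<times> Kb. \<Sum>v\<in>A \<times> L.
      (kd (fst y) (fst v) * g (snd y) (snd v) t) * cnj (kd (fst x) (fst v) * g (snd x) (snd v) t))"
    unfolding HV[OF x] HV[OF y] fst_conv snd_conv prod.collapse
    by (intro sum.cong refl isom_gram[OF V])
  also have "\<dots> = (\<Sum>v\<in>A \<times> L. (kd (fst y) (fst v) * kd (fst x) (fst v)) *
      (\<Sum>t\<in>E2 \<times> Ma \<times> Kb. g (snd y) (snd v) t * cnj (g (snd x) (snd v) t)))"
    unfolding sum_distrib_left by (subst sum.swap, intro sum.cong refl) simp
  also have "\<dots> = (\<Sum>v\<in>A \<times> L. (kd (fst y) (fst v) * kd (fst x) (fst v)) *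
      (kd (snd y) (snd x) * (\<Sum>r\<in>R. \<psi> (snd v) r * cnj (\<psi> (snd v) r))))"
    using x y by (intro sum.cong refl) (auto simp: gg)
  also have "\<dots> = (kd (fst y) (fst x)) * (kd (snd y) (snd x) * (\<Sum>l\<in>L. \<Sum>r\<in>R. \<psi> l r * cnj (\<psi> l r)))"
    unfolding sum_Times fst_conv snd_conv sum_product[symmetric] unfolding sum_distrib_left[symmetric]
    using x y fin by (auto simp: kd_sym)
  also have "(\<Sum>l\<in>L. \<Sum>r\<in>R. \<psi> l r * cnj (\<psi> l r)) = 1"
    using \<psi> by (simp add: mult_cnj_self flip: of_real_power of_real_sum)
  finally show ?thesis by (simp add: kd_sym flip: kd_pair)
qed

lemma G_isom: "isom (A \<times> B) ((A \<times> E3) \<times> (B \<times> E4) \<times> E1 \<times> E2) G"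
  unfolding isom_def
proof (intro conjI ballI)
  fix x y assume x: "x \<in> A \<times> B" and y: "y \<in> A \<times> B"
  let ?g = "\<lambda>x i d f. \<Sum>j\<in>Mb \<times> Kb. W' j d * H x i j f"
  have "(\<Sum>z\<in>(A \<times> E3) \<times> (B \<times> E4) \<times> E1 \<times> E2. cnj (G x z) * G y z)
    = (\<Sum>c\<in>A \<times> E3. \<Sum>p\<in>(B \<times> E4) \<times> E1 \<times> E2. G y (c, p) * cnj (G x (c, p)))"
    by (subst sum_Times) (simp only: mult.commute)
  also have "\<dots> = (\<Sum>p\<in>(B \<times> E4) \<times> E1 \<times> E2. \<Sum>c\<in>A \<times> E3. G y (c, p) * cnj (G x (c, p)))"
    by (rule sum.swap)
  also have "\<dots> = (\<Sum>p\<in>(B \<times> E4) \<times> E1 \<times> E2. \<Sum>i\<in>Ka \<times> Ma. ?g y i (fst p) (snd p) * cnj (?g x i (fst p) (snd p)))"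
    unfolding G_def fst_conv snd_conv by (intro sum.cong refl isom_gram[OF W])
  also have "\<dots> = (\<Sum>i\<in>Ka \<times> Ma. \<Sum>f\<in>E1 \<times> E2. \<Sum>d\<in>B \<times> E4. ?g y i d f * cnj (?g x i d f))"
    by (subst sum.swap, intro sum.cong refl, subst sum_Times, subst sum.swap) simp
  also have "\<dots> = (\<Sum>i\<in>Ka \<times> Ma. \<Sum>f\<in>E1 \<times> E2. \<Sum>j\<in>Mb \<times> Kb. H y i j f * cnj (H x i j f))"
    by (intro sum.cong refl isom_gram[OF W'])
  also have "\<dots> = (\<Sum>i\<in>Ka \<times> Ma. \<Sum>j\<in>Mb \<times> Kb. \<Sum>f\<in>E1 \<times> E2. H y i j f * cnj (H x i j f))"
    by (intro sum.cong refl sum.swap)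
  also have "\<dots> = kd x y" by (rule H_gram[OF x y])
  finally show "(\<Sum>z\<in>(A \<times> E3) \<times> (B \<times> E4) \<times> E1 \<times> E2. cnj (G x z) * G y z) = kd x y" .
qed (use fin in auto)

text \<open>The joint state just before the communication round is split into the part prepared by Alice
  and Bob's isometry acting on his half of the resource.\<close>
definition alice :: "('q \<Rightarrow> 'a \<Rightarrow> 'p \<Rightarrow> complex) \<Rightarrow> 'q \<Rightarrow> 'ka \<Rightarrow> 'r \<Rightarrow> 'p \<times> 'mb \<times> 'e1 \<Rightarrow> complex" where
  "alice \<pi> q k r z = (\<Sum>x\<in>A \<times> L. V x (snd (snd z), k, fst (snd z)) * (\<pi> q (fst x) (fst z) * \<psi> (snd x) r))"

definition bob :: "('b \<Rightarrow> 's \<Rightarrow> complex) \<Rightarrow> 'r \<Rightarrow> 'ma \<times> 'kb \<times> 'e2 \<times> 's \<Rightarrow> complex" where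
  "bob \<phi> r t = (\<Sum>b\<in>B. V' (r, b) (fst (snd (snd t)), fst t, fst (snd t)) * \<phi> b (snd (snd (snd t))))"

text \<open>The output vector for purified inputs, with purifying indices p and s. The environment
  \<open>E3\<close> stays with A, so that W acts as an isometry on the conditioning system; the
  other environments go with Bob's output and the purifiers.\<close>

definition amp :: "('q \<Rightarrow> 'a \<Rightarrow> 'p \<Rightarrow> complex) \<Rightarrow> ('b \<Rightarrow> 's \<Rightarrow> complex) \<Rightarrow>
    'q \<times> 'a \<times> 'e3 \<Rightarrow> ('b \<times> 'p \<times> 's) \<times> 'e4 \<times> 'e1 \<times> 'e2 \<Rightarrow> complex" where
  "amp \<pi> \<phi> i y = (\<Sum>x\<in>A \<times> B. G x (snd i, (fst (fst y), fst (snd y)), snd (snd y))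
     * (\<pi> (fst i) (fst x) (fst (snd (fst y))) * \<phi> (snd x) (snd (snd (fst y)))))"

text \<open>Feeding a fixed normalised input into Bob's isometry leaves an isometry of his resource
  half alone.\<close>

lemma bob_isom:
  assumes S: "finite S" and \<phi>: "(\<Sum>b\<in>B. \<Sum>s\<in>S. (cmod (\<phi> b s))\<^sup>2) = 1"
  shows "isom R (Ma \<times> Kb \<times> E2 \<times> S) (bob \<phi>)"
  unfolding isom_def
proof (intro conjI ballI)
  fix x y assume xy: "x \<in> R" "y \<in> R"
  define g where "g u s t = (\<Sum>b\<in>B. V' (u, b) t * \<phi> b s)" for u s t
  have gV: "g u s t = (\<Sum>v\<in>R \<times> B. V' v t * (kd u (fst v) * \<phi> (snd v) s))" if "u \<in> R" for u s t
  proof -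
    have "(\<Sum>v\<in>R \<times> B. V' v t * (kd u (fst v) * \<phi> (snd v) s)) = (\<Sum>r\<in>R. kd u r * (\<Sum>b\<in>B. V' (r, b) t * \<phi> b s))"
      unfolding sum_Times sum_distrib_left by (intro sum.cong refl) simp
    then show ?thesis using that fin by (simp add: g_def)
  qed
  have "(\<Sum>z\<in>Ma \<times> Kb \<times> E2 \<times> S. cnj (bob \<phi> x z) * bob \<phi> y z)
    = (\<Sum>p\<in>S \<times> E2 \<times> Ma \<times> Kb. g y (fst p) (snd p) * cnj (g x (fst p) (snd p)))"
    by (rule sum.reindex_bij_witness[of _ "\<lambda>p. (fst (snd (snd p)), snd (snd (snd p)), fst (snd p), fst p)"
          "\<lambda>p. (snd (snd (snd p)), fst (snd (snd p)), fst p, fst (snd p))"])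
      (auto simp: bob_def g_def)
  also have "\<dots> = (\<Sum>s\<in>S. \<Sum>t\<in>E2 \<times> Ma \<times> Kb. g y s t * cnj (g x s t))"
    by (subst sum_Times) simp
  also have "\<dots> = (\<Sum>s\<in>S. \<Sum>v\<in>R \<times> B. (kd y (fst v) * \<phi> (snd v) s) * cnj (kd x (fst v) * \<phi> (snd v) s))"
    unfolding gV[OF xy(1)] gV[OF xy(2)] by (intro sum.cong refl isom_gram[OF V'])
  also have "\<dots> = (\<Sum>s\<in>S. \<Sum>v\<in>R \<times> B. (kd y (fst v) * kd x (fst v)) * (\<phi> (snd v) s * cnj (\<phi> (snd v) s)))"
    by (intro sum.cong refl) simp
  also have "\<dots> = (\<Sum>s\<in>S. kd x y * (\<Sum>b\<in>B. \<phi> b s * cnj (\<phi> b s)))"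
    unfolding sum_Times fst_conv snd_conv sum_product[symmetric] using xy fin by (simp add: kd_sym)
  also have "\<dots> = kd x y * (\<Sum>b\<in>B. \<Sum>s\<in>S. \<phi> b s * cnj (\<phi> b s))"
    unfolding sum_distrib_left by (rule sum.swap)
  also have "(\<Sum>b\<in>B. \<Sum>s\<in>S. \<phi> b s * cnj (\<phi> b s)) = 1"
    using \<phi> by (simp add: mult_cnj_self flip: of_real_power of_real_sum)
  finally show "(\<Sum>z\<in>Ma \<times> Kb \<times> E2 \<times> S. cnj (bob \<phi> x z) * bob \<phi> y z) = kd x y" by simp
qed (use fin S in auto)

text \<open>Alice's operation and her normalised input do not touch R, so its marginal remains that
  of \<psi>; hence the entropy in the bound is that of the resource itself.\<close>

lemma alice_gram:
  assumes P: "finite P" and Q: "finite Q"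
    and \<pi>: "(\<Sum>q\<in>Q. \<Sum>a\<in>A. \<Sum>p\<in>P. (cmod (\<pi> q a p))\<^sup>2) = 1"
  shows "(\<Sum>i\<in>Q \<times> Ka \<times> P \<times> Mb \<times> E1. alice \<pi> (fst i) (fst (snd i)) r (snd (snd i))
      * cnj (alice \<pi> (fst i) (fst (snd i)) r' (snd (snd i)))) = (\<Sum>l\<in>L. \<psi> l r * cnj (\<psi> l r'))"
proof -
  define g where "g q p r t = (\<Sum>x\<in>A \<times> L. V x t * (\<pi> q (fst x) p * \<psi> (snd x) r))" for q p r t
  have "(\<Sum>i\<in>Q \<times> Ka \<times> P \<times> Mb \<times> E1. alice \<pi> (fst i) (fst (snd i)) r (snd (snd i))
      * cnj (alice \<pi> (fst i) (fst (snd i)) r' (snd (snd i))))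
    = (\<Sum>i\<in>Q \<times> P \<times> E1 \<times> Ka \<times> Mb. g (fst i) (fst (snd i)) r (snd (snd i)) * cnj (g (fst i) (fst (snd i)) r' (snd (snd i))))"
    by (rule sum.reindex_bij_witness[of _
          "\<lambda>p. (fst p, fst (snd (snd (snd p))), fst (snd p), snd (snd (snd (snd p))), fst (snd (snd p)))"
          "\<lambda>p. (fst p, fst (snd (snd p)), snd (snd (snd (snd p))), fst (snd p), fst (snd (snd (snd p))))"])
      (auto simp: alice_def g_def)
  also have "\<dots> = (\<Sum>q\<in>Q. \<Sum>p\<in>P. \<Sum>t\<in>E1 \<times> Ka \<times> Mb. g q p r t * cnj (g q p r' t))"
    unfolding sum_Times[of _ Q] sum_Times[of _ P] by simp
  also have "\<dots> = (\<Sum>q\<in>Q. \<Sum>p\<in>P. \<Sum>x\<in>A \<times> L. (\<pi> q (fst x) p * \<psi> (snd x) r) * cnj (\<pi> q (fst x) p * \<psi> (snd x) r'))"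
    unfolding g_def by (intro sum.cong refl isom_gram[OF V])
  also have "\<dots> = (\<Sum>q\<in>Q. \<Sum>p\<in>P. \<Sum>x\<in>A \<times> L. (\<pi> q (fst x) p * cnj (\<pi> q (fst x) p)) * (\<psi> (snd x) r * cnj (\<psi> (snd x) r')))"
    by (intro sum.cong refl) simp
  also have "\<dots> = (\<Sum>q\<in>Q. \<Sum>a\<in>A. \<Sum>p\<in>P. \<pi> q a p * cnj (\<pi> q a p)) * (\<Sum>l\<in>L. \<psi> l r * cnj (\<psi> l r'))"
    unfolding sum_Times fst_conv snd_conv sum_product[symmetric]
    unfolding sum_distrib_right[symmetric] unfolding sum.swap[of _ P A] ..
  also have "(\<Sum>q\<in>Q. \<Sum>a\<in>A. \<Sum>p\<in>P. \<pi> q a p * cnj (\<pi> q a p)) = 1"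
    using \<pi> by (simp add: mult_cnj_self flip: of_real_power of_real_sum)
  finally show ?thesis by simp
qed

lemma amp_norm:
  assumes P: "finite P" and Q: "finite Q" and S: "finite S"
    and \<pi>: "(\<Sum>q\<in>Q. \<Sum>a\<in>A. \<Sum>p\<in>P. (cmod (\<pi> q a p))\<^sup>2) = 1"
    and \<phi>: "(\<Sum>b\<in>B. \<Sum>s\<in>S. (cmod (\<phi> b s))\<^sup>2) = 1"
  shows "(\<Sum>i\<in>Q \<times> A \<times> E3. \<Sum>y\<in>(B \<times> P \<times> S) \<times> E4 \<times> E1 \<times> E2. (cmod (amp \<pi> \<phi> i y))\<^sup>2) = 1"
proof -
  define g where "g q p s t = (\<Sum>x\<in>A \<times> B. G x t * (\<pi> q (fst x) p * \<phi> (snd x) s))" for q p s t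
  have "(\<Sum>i\<in>Q \<times> A \<times> E3. \<Sum>y\<in>(B \<times> P \<times> S) \<times> E4 \<times> E1 \<times> E2. (cmod (amp \<pi> \<phi> i y))\<^sup>2)
    = (\<Sum>i\<in>(Q \<times> A \<times> E3) \<times> ((B \<times> P \<times> S) \<times> E4 \<times> E1 \<times> E2). (cmod (amp \<pi> \<phi> (fst i) (snd i)))\<^sup>2)"
    by (simp add: sum.cartesian_product case_prod_unfold)
  also have "\<dots> = (\<Sum>i\<in>(Q \<times> P \<times> S) \<times> (A \<times> E3) \<times> (B \<times> E4) \<times> E1 \<times> E2.
      (cmod (g (fst (fst i)) (fst (snd (fst i))) (snd (snd (fst i))) (snd i)))\<^sup>2)"
    by (rule sum.reindex_bij_witness[of _
          "\<lambda>i. ((fst (fst i), fst (snd i)), ((fst (fst (snd (snd i))), snd (fst i)), (snd (fst (snd (snd i))), snd (snd (snd i)))))"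
          "\<lambda>i. ((fst (fst i), snd (fst (snd i))), (snd (fst i), ((fst (fst (snd i)), fst (snd (snd i))), snd (snd (snd i)))))"])
      (auto simp: amp_def g_def)
  also have "\<dots> = (\<Sum>q\<in>Q. \<Sum>p\<in>P. \<Sum>s\<in>S. \<Sum>t\<in>(A \<times> E3) \<times> (B \<times> E4) \<times> E1 \<times> E2. (cmod (g q p s t))\<^sup>2)"
    unfolding sum_Times[of _ "Q \<times> P \<times> S"] sum_Times[of _ Q] sum_Times[of _ P] by simp
  also have "\<dots> = (\<Sum>q\<in>Q. \<Sum>p\<in>P. \<Sum>s\<in>S. \<Sum>x\<in>A \<times> B. (cmod (\<pi> q (fst x) p))\<^sup>2 * (cmod (\<phi> (snd x) s))\<^sup>2)"
    unfolding g_def isom_norm[OF G_isom] by (simp add: norm_mult power_mult_distrib)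
  also have "\<dots> = (\<Sum>q\<in>Q. \<Sum>a\<in>A. \<Sum>p\<in>P. (cmod (\<pi> q a p))\<^sup>2) * (\<Sum>b\<in>B. \<Sum>s\<in>S. (cmod (\<phi> b s))\<^sup>2)"
    unfolding sum_Times fst_conv snd_conv sum_product[symmetric] unfolding sum_distrib_left[symmetric]
    unfolding sum_distrib_right[symmetric] unfolding sum.swap[of _ S B] sum.swap[of _ P A] ..
  finally show ?thesis by (simp add: \<pi> \<phi>)
qed

text \<open>Separates the last operations from the state after the exchange, which is Bob's isometry
  applied to the part prepared by Alice.\<close>

lemma amp_nested:
  "amp \<pi> \<phi> (q, c) ((\<beta>, p, s), e4, f) = (\<Sum>i\<in>Ka \<times> Ma. W i c * (\<Sum>j\<in>Mb \<times> Kb. W' j (\<beta>, e4) *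
     apply_right R (bob \<phi>) (alice \<pi>) (q, i) ((p, fst j, fst f), snd j, snd f, s)))"
proof -
  have "(\<Sum>x\<in>A \<times> B. H x i j f * (\<pi> q (fst x) p * \<phi> (snd x) s))
      = apply_right R (bob \<phi>) (alice \<pi>) (q, i) ((p, fst j, fst f), snd j, snd f, s)" for i j
  proof -
    have "apply_right R (bob \<phi>) (alice \<pi>) (q, i) ((p, fst j, fst f), snd j, snd f, s)
      = (\<Sum>r\<in>R. \<Sum>b\<in>B. \<Sum>a\<in>A. \<Sum>l\<in>L. V (a, l) (fst f, fst i, fst j) * V' (r, b) (snd f, snd i, snd j) * \<psi> l r * (\<pi> q a p * \<phi> b s))"
      unfolding apply_right_def bob_def alice_def fst_conv snd_conv sum_product sum_Times
      by (simp add: sum_distrib_left mult_ac)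
    also have "\<dots> = (\<Sum>a\<in>A. \<Sum>b\<in>B. \<Sum>l\<in>L. \<Sum>r\<in>R. V (a, l) (fst f, fst i, fst j) * V' (r, b) (snd f, snd i, snd j) * \<psi> l r * (\<pi> q a p * \<phi> b s))"
    proof -
      define F where "F a b l r = V (a, l) (fst f, fst i, fst j) * V' (r, b) (snd f, snd i, snd j) * \<psi> l r * (\<pi> q a p * \<phi> b s)" for a b l r
      have "(\<Sum>r\<in>R. \<Sum>b\<in>B. \<Sum>a\<in>A. \<Sum>l\<in>L. F a b l r) = (\<Sum>i\<in>R \<times> B \<times> A \<times> L. F (fst (snd (snd i))) (fst (snd i)) (snd (snd (snd i))) (fst i))"
        by (simp add: sum_Times)
      also have "\<dots> = (\<Sum>i\<in>A \<times> B \<times> L \<times> R. F (fst i) (fst (snd i)) (fst (snd (snd i))) (snd (snd (snd i))))"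
        by (rule sum.reindex_bij_witness[of _ "\<lambda>i. (snd (snd (snd i)), fst (snd i), fst i, fst (snd (snd i)))"
            "\<lambda>i. (fst (snd (snd i)), fst (snd i), snd (snd (snd i)), fst i)"]) auto
      finally show ?thesis by (simp add: sum_Times F_def)
    qed
    also have "\<dots> = (\<Sum>x\<in>A \<times> B. H x i j f * (\<pi> q (fst x) p * \<phi> (snd x) s))"
      unfolding H_def sum_Times sum_distrib_right fst_conv snd_conv ..
    finally show ?thesis ..
  qed
  note * = this
  have "amp \<pi> \<phi> (q, c) ((\<beta>, p, s), e4, f)
    = (\<Sum>x\<in>A \<times> B. \<Sum>i\<in>Ka \<times> Ma. \<Sum>j\<in>Mb \<times> Kb. W i c * (W' j (\<beta>, e4) * (H x i j f * (\<pi> q (fst x) p * \<phi> (snd x) s))))"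
    unfolding amp_def G_def fst_conv snd_conv sum_distrib_left sum_distrib_right by (intro sum.cong refl) (simp only: mult_ac)
  also have "\<dots> = (\<Sum>i\<in>Ka \<times> Ma. \<Sum>j\<in>Mb \<times> Kb. \<Sum>x\<in>A \<times> B. W i c * (W' j (\<beta>, e4) * (H x i j f * (\<pi> q (fst x) p * \<phi> (snd x) s))))"
    by (subst sum.swap, intro sum.cong refl sum.swap)
  finally show ?thesis by (simp only: sum_distrib_left[symmetric] *)
qed

text \<open>The last operations do not change the entropy of Q given Alice's systems: W is an
  isometry on the conditioning system and \<open>W'\<close> one on the environment. All other steps
  permute environment indices.\<close>

lemma cent_amp:
  assumes P: "finite P" and Q: "finite Q" and S: "finite S"
  shows "cent Q (A \<times> E3) (red ((B \<times> P \<times> S) \<times> E4 \<times> E1 \<times> E2) (amp \<pi> \<phi>))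
    = cent Q (Ka \<times> Ma) (red ((P \<times> Mb \<times> E1) \<times> Kb \<times> E2 \<times> S) (apply_right R (bob \<phi>) (alice \<pi>)))"
proof -
  let ?O = "P \<times> S \<times> E1 \<times> E2"
  define X where "X = (\<lambda>i w. apply_right R (bob \<phi>) (alice \<pi>) i
     ((fst (snd w), fst (fst w), fst (snd (snd (snd w)))), snd (fst w), snd (snd (snd (snd w))), fst (snd (snd w))))"
  define Y where "Y = (\<lambda>i w. \<Sum>j\<in>Mb \<times> Kb. W' j (fst w) * X i (j, snd w))"
  define Z where "Z = (\<lambda>i w. \<Sum>x\<in>Ka \<times> Ma. W x (snd i) * Y (fst i, x) w)"
  have "red ((P \<times> Mb \<times> E1) \<times> Kb \<times> E2 \<times> S) (apply_right R (bob \<phi>) (alice \<pi>)) = red ((Mb \<times> Kb) \<times> ?O) X"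
    unfolding X_def
    by (rule red_reindex, rule bij_betw_byWitness[of _
       "\<lambda>w. ((fst (snd (fst w)), fst (snd w)), (fst (fst w), snd (snd (snd w)), snd (snd (fst w)), fst (snd (snd w))))"]) auto
  moreover have "cent Q (Ka \<times> Ma) (red ((B \<times> E4) \<times> ?O) Y) = cent Q (Ka \<times> Ma) (red ((Mb \<times> Kb) \<times> ?O) X)"
    by (rule cent_isom_environment[OF W']) (simp add: Y_def)
  moreover have "cent Q (A \<times> E3) (red ((B \<times> E4) \<times> ?O) Z) = cent Q (Ka \<times> Ma) (red ((B \<times> E4) \<times> ?O) Y)"
    using fin P Q S by (intro cent_isom[OF W]) (auto simp: Z_def)
  moreover have "red ((B \<times> P \<times> S) \<times> E4 \<times> E1 \<times> E2) (amp \<pi> \<phi>)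
      = red ((B \<times> E4) \<times> ?O) (\<lambda>i w. amp \<pi> \<phi> i ((fst (fst w), fst (snd w), fst (snd (snd w))), snd (fst w), snd (snd (snd w))))"
    by (rule red_reindex, rule bij_betw_byWitness[of _
       "\<lambda>w. ((fst (fst w), fst (snd w)), (fst (snd (fst w)), snd (snd (fst w)), snd (snd w)))"]) auto
  moreover have "(\<lambda>i w. amp \<pi> \<phi> i ((fst (fst w), fst (snd w), fst (snd (snd w))), snd (fst w), snd (snd (snd w)))) = Z"
  proof (intro ext)
    fix i w
    have "amp \<pi> \<phi> (fst i, snd i) ((fst (fst w), fst (snd w), fst (snd (snd w))), snd (fst w), snd (snd (snd w))) = Z i w"
      unfolding amp_nested Z_def Y_def X_def by simp
    then show "amp \<pi> \<phi> i ((fst (fst w), fst (snd w), fst (snd (snd w))), snd (fst w), snd (snd (snd w))) = Z i w" by simp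
  qed
  ultimately show ?thesis by simp
qed

definition ideal :: "('a \<times> 'b \<Rightarrow> 'a \<times> 'b \<Rightarrow> complex) \<Rightarrow> ('q \<Rightarrow> 'a \<Rightarrow> 'p \<Rightarrow> complex) \<Rightarrow> ('b \<Rightarrow> 's \<Rightarrow> complex) \<Rightarrow>
    'q \<times> 'a \<Rightarrow> 'b \<times> 'p \<times> 's \<Rightarrow> complex" where
  "ideal U \<pi> \<phi> i y = (\<Sum>x\<in>A \<times> B. U x (snd i, fst y) * (\<pi> (fst i) (fst x) (fst (snd y)) * \<phi> (snd x) (snd (snd y))))"

lemma ideal_norm:
  assumes U: "isom (A \<times> B) (A \<times> B) U" and P: "finite P" and Q: "finite Q" and S: "finite S"
    and \<pi>: "(\<Sum>q\<in>Q. \<Sum>a\<in>A. \<Sum>p\<in>P. (cmod (\<pi> q a p))\<^sup>2) = 1"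
    and \<phi>: "(\<Sum>b\<in>B. \<Sum>s\<in>S. (cmod (\<phi> b s))\<^sup>2) = 1"
  shows "(\<Sum>i\<in>Q \<times> A. \<Sum>y\<in>B \<times> P \<times> S. (cmod (ideal U \<pi> \<phi> i y))\<^sup>2) = 1"
proof -
  define g where "g q p s t = (\<Sum>x\<in>A \<times> B. U x t * (\<pi> q (fst x) p * \<phi> (snd x) s))" for q p s t
  have "(\<Sum>i\<in>Q \<times> A. \<Sum>y\<in>B \<times> P \<times> S. (cmod (ideal U \<pi> \<phi> i y))\<^sup>2)
    = (\<Sum>i\<in>(Q \<times> A) \<times> (B \<times> P \<times> S). (cmod (ideal U \<pi> \<phi> (fst i) (snd i)))\<^sup>2)"
    by (simp add: sum.cartesian_product case_prod_unfold)
  also have "\<dots> = (\<Sum>i\<in>(Q \<times> P \<times> S) \<times> (A \<times> B). (cmod (g (fst (fst i)) (fst (snd (fst i))) (snd (snd (fst i))) (snd i)))\<^sup>2)"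
    by (rule sum.reindex_bij_witness[of _
          "\<lambda>i. ((fst (fst i), fst (snd i)), (snd (snd i), snd (fst i)))"
          "\<lambda>i. ((fst (fst i), snd (snd i)), (snd (fst i), fst (snd i)))"])
      (auto simp: ideal_def g_def)
  also have "\<dots> = (\<Sum>q\<in>Q. \<Sum>p\<in>P. \<Sum>s\<in>S. \<Sum>t\<in>A \<times> B. (cmod (g q p s t))\<^sup>2)"
    unfolding sum_Times[of _ "Q \<times> P \<times> S"] sum_Times[of _ Q] sum_Times[of _ P] by simp
  also have "\<dots> = (\<Sum>q\<in>Q. \<Sum>p\<in>P. \<Sum>s\<in>S. \<Sum>x\<in>A \<times> B. (cmod (\<pi> q (fst x) p))\<^sup>2 * (cmod (\<phi> (snd x) s))\<^sup>2)"
    unfolding g_def isom_norm[OF U] by (simp add: norm_mult power_mult_distrib)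
  also have "\<dots> = (\<Sum>q\<in>Q. \<Sum>a\<in>A. \<Sum>p\<in>P. (cmod (\<pi> q a p))\<^sup>2) * (\<Sum>b\<in>B. \<Sum>s\<in>S. (cmod (\<phi> b s))\<^sup>2)"
    unfolding sum_Times fst_conv snd_conv sum_product[symmetric] unfolding sum_distrib_left[symmetric]
    unfolding sum_distrib_right[symmetric] unfolding sum.swap[of _ S B] sum.swap[of _ P A] ..
  finally show ?thesis by (simp add: \<pi> \<phi>)
qed

text \<open>The overlap with the ideal output is squared and summed over a basis of the
  environments: this is the fidelity of the reduced output with the ideal pure state.\<close>

definition faithful where
  "faithful Q P S U \<pi> \<phi> \<epsilon> \<longleftrightarrow> (\<Sum>e\<in>E3. \<Sum>f\<in>E4 \<times> E1 \<times> E2.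
     (cmod (\<Sum>i\<in>Q \<times> A. \<Sum>y\<in>B \<times> P \<times> S. cnj (ideal U \<pi> \<phi> i y) * amp \<pi> \<phi> (fst i, snd i, e) (y, f)))\<^sup>2) \<ge> 1 - \<epsilon>"

theorem resource_entropy_bound:
  assumes U: "isom (A \<times> B) (A \<times> B) U" and P: "finite P" and Q: "finite Q" and S: "finite S"
    and \<pi>: "(\<Sum>q\<in>Q. \<Sum>a\<in>A. \<Sum>p\<in>P. (cmod (\<pi> q a p))\<^sup>2) = 1"
    and \<phi>: "(\<Sum>b\<in>B. \<Sum>s\<in>S. (cmod (\<phi> b s))\<^sup>2) = 1"
    and \<phi>': "(\<Sum>b\<in>B. \<Sum>s\<in>S. (cmod (\<phi>' b s))\<^sup>2) = 1"
    and faithful: "faithful Q P S U \<pi> \<phi> \<epsilon>" "faithful Q P S U \<pi> \<phi>' \<epsilon>"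
    and eps: "0 \<le> \<epsilon>" "\<epsilon> < 1"
  shows "cent Q A (red (B \<times> P \<times> S) (ideal U \<pi> \<phi>')) - cent Q A (red (B \<times> P \<times> S) (ideal U \<pi> \<phi>))
    \<le> 2 * ent R (red L (\<lambda>r l. \<psi> l r)) + 2 * (2 * sqrt (2 * \<epsilon>) * log 2 (card Q) + etagap (sqrt (2 * \<epsilon>)))"
proof -
  let ?b = "2 * sqrt (2 * \<epsilon>) * log 2 (card Q) + etagap (sqrt (2 * \<epsilon>))"
  let ?C = "\<lambda>\<phi>. cent Q (Ka \<times> Ma) (red ((P \<times> Mb \<times> E1) \<times> Kb \<times> E2 \<times> S) (apply_right R (bob \<phi>) (alice \<pi>)))"
  have near: "\<bar>?C \<phi> - cent Q A (red (B \<times> P \<times> S) (ideal U \<pi> \<phi>))\<bar> \<le> ?b"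
    if "(\<Sum>b\<in>B. \<Sum>s\<in>S. (cmod (\<phi> b s))\<^sup>2) = 1" "faithful Q P S U \<pi> \<phi> \<epsilon>" for \<phi>
    unfolding cent_amp[OF P Q S, symmetric]
    using fin P Q S that eps amp_norm[OF P Q S \<pi> that(1)] ideal_norm[OF U P Q S \<pi> that(1)]
    by (intro cent_near_product) (auto simp: faithful_def)
  have gram: "red (Q \<times> Ka \<times> P \<times> Mb \<times> E1) (\<lambda>r p. alice \<pi> (fst p) (fst (snd p)) r (snd (snd p))) = red L (\<lambda>r l. \<psi> l r)"
    unfolding fun_eq_iff red_def using alice_gram[OF P Q \<pi>] by blast
  have "(\<Sum>q\<in>Q. \<Sum>k\<in>Ka. \<Sum>r\<in>R. \<Sum>z\<in>P \<times> Mb \<times> E1. (cmod (alice \<pi> q k r z))\<^sup>2)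
    = tr R (red (Q \<times> Ka \<times> P \<times> Mb \<times> E1) (\<lambda>r p. alice \<pi> (fst p) (fst (snd p)) r (snd (snd p))))"
    unfolding tr_red sum_Times[of _ Q] sum_Times[of _ Ka] fst_conv snd_conv sum.swap[of _ R Ka] sum.swap[of _ R Q] ..
  also have "\<dots> = 1" unfolding gram tr_red using \<psi> by (simp add: sum.swap[of _ L R])
  finally have norm: "(\<Sum>q\<in>Q. \<Sum>k\<in>Ka. \<Sum>r\<in>R. \<Sum>z\<in>P \<times> Mb \<times> E1. (cmod (alice \<pi> q k r z))\<^sup>2) = 1" .
  have "?C \<phi>' \<le> ?C \<phi> + 2 * ent R (red L (\<lambda>r l. \<psi> l r))"
    unfolding gram[symmetric]
    using fin P Q S by (intro cent_single_round_bound bob_isom norm \<phi> \<phi>') auto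
  moreover have "i' - i \<le> 2 * e + 2 * b" if "x' \<le> x + 2 * e" "x - i \<le> b" "- (x' - i') \<le> b" for x x' i i' e b :: real
    using that by linarith
  ultimately show ?thesis using abs_le_D1[OF near[OF \<phi> faithful(1)]] abs_le_D2[OF near[OF \<phi>' faithful(2)]] by blast
qed

end

subsection \<open>Matrices as kernels\<close>

lemma sum_lessThan_times: "(\<Sum>k<m * n. f k) = (\<Sum>i<m. \<Sum>j<n. f (i * n + j))" for m n :: nat
proof (induction m)
  case (Suc m)
  have "(\<Sum>k<Suc m * n. f k) = (\<Sum>k<m * n. f k) + (\<Sum>k\<in>{m * n..<m * n + n}. f k)"
  proof -
    have "{..<Suc m * n} = {..<m * n} \<union> {m * n..<m * n + n}" by auto
    moreover have "{..<m * n} \<inter> {m * n..<m * n + n} = {}" by auto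
    ultimately show ?thesis by (simp only: sum.union_disjoint finite_lessThan finite_atLeastLessThan)
  qed
  also have "(\<Sum>k\<in>{m * n..<m * n + n}. f k) = (\<Sum>j<n. f (m * n + j))"
    by (rule sum.reindex_bij_witness[of _ "\<lambda>j. m * n + j" "\<lambda>k. k - m * n"]) auto
  finally show ?case using Suc by simp
qed simp

lemma index_less: "i < m \<Longrightarrow> j < n \<Longrightarrow> i * n + j < m * (n :: nat)"
proof -
  assume "i < m" "j < n"
  then have "i * n + j < Suc i * n" by simp
  also have "\<dots> \<le> m * n" using \<open>i < m\<close> by (intro mult_right_mono) auto
  finally show ?thesis .
qed

lemma div_mod_less: "k < m * n \<Longrightarrow> k div n < m" "k < m * n \<Longrightarrow> k mod n < n" for k m n :: nat
  by (simp add: less_mult_imp_div_less) (metis mod_less_divisor mult_0_right neq0_conv not_less0)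

lemma index_bij: "bij_betw (\<lambda>a. fst a * n + snd a) ({..<m} \<times> {..<n}) {..<m * (n :: nat)}"
proof (rule bij_betw_byWitness[of _ "\<lambda>k. (k div n, k mod n)"])
  show "(\<lambda>k. (k div n, k mod n)) ` {..<m * n} \<subseteq> {..<m} \<times> {..<n}"
    using div_mod_less by auto
qed (auto simp: index_less)

lemma kd_index: "j < n \<Longrightarrow> j' < n \<Longrightarrow> kd (i * n + j) (i' * n + j' :: nat) = kd i i' * kd j j'"
proof -
  assume j: "j < n" "j' < n"
  have "i = i' \<and> j = j'" if "i * n + j = i' * n + j'"
  proof -
    have "(i * n + j) div n = (i' * n + j') div n" "(i * n + j) mod n = (i' * n + j') mod n" using that by simp_all
    then show ?thesis using j by simp
  qed
  then show ?thesis by (auto simp: kd_def)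
qed

definition kern :: "complex mat \<Rightarrow> nat \<Rightarrow> nat \<Rightarrow> complex" where
  "kern M i j = M $$ (i, j)"

lemma adj_carrier [simp]: "M \<in> carrier_mat m n \<Longrightarrow> adj M \<in> carrier_mat n m"
  by (simp add: adj_def)

lemma adj_index: "M \<in> carrier_mat m n \<Longrightarrow> i < n \<Longrightarrow> j < m \<Longrightarrow> adj M $$ (i, j) = cnj (M $$ (j, i))"
  by (simp add: adj_def)

lemma mult_index:
  assumes "M \<in> carrier_mat m n" "N \<in> carrier_mat n k" "i < m" "j < k"
  shows "(M * N) $$ (i, j) = (\<Sum>l<n. M $$ (i, l) * N $$ (l, j))"
  using assms by (simp add: scalar_prod_def lessThan_atLeast0)

lemma conj_index:
  assumes K: "K \<in> carrier_mat m n" and M: "M \<in> carrier_mat n n" and ij: "i < m" "j < m"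
  shows "(K * M * adj K) $$ (i, j) = (\<Sum>k<n. \<Sum>l<n. K $$ (i, k) * M $$ (k, l) * cnj (K $$ (j, l)))"
proof -
  have "(K * M * adj K) $$ (i, j) = (\<Sum>l<n. (K * M) $$ (i, l) * adj K $$ (l, j))"
    using K M ij by (intro mult_index[of _ m n _ m]) auto
  also have "\<dots> = (\<Sum>l<n. \<Sum>k<n. K $$ (i, k) * M $$ (k, l) * cnj (K $$ (j, l)))"
  proof (intro sum.cong refl)
    fix l assume "l \<in> {..<n}"
    then show "(K * M) $$ (i, l) * adj K $$ (l, j) = (\<Sum>k<n. K $$ (i, k) * M $$ (k, l) * cnj (K $$ (j, l)))"
      using mult_index[OF K M ij(1), of l] adj_index[OF K, of l j] ij by (simp add: sum_distrib_right)
  qed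
  also have "\<dots> = (\<Sum>k<n. \<Sum>l<n. K $$ (i, k) * M $$ (k, l) * cnj (K $$ (j, l)))"
    by (rule sum.swap)
  finally show ?thesis .
qed

lemma kron_carrier [simp]:
  "M \<in> carrier_mat m n \<Longrightarrow> N \<in> carrier_mat k l \<Longrightarrow> kron M N \<in> carrier_mat (m * k) (n * l)"
  by (simp add: kron_def)

lemma kron_index:
  assumes "M \<in> carrier_mat m n" "N \<in> carrier_mat k l" "i < m" "j < n" "r < k" "s < l"
  shows "kron M N $$ (i * k + r, j * l + s) = M $$ (i, j) * N $$ (r, s)"
  using assms index_less[of i m r k] index_less[of j n s l] by (simp add: kron_def)

lemma sum_list_eq_sum_nth: "sum_list (map f xs) = (\<Sum>e<length xs. f (xs ! e))" for f :: "_ \<Rightarrow> complex"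
  by (simp add: sum_list_sum_nth lessThan_atLeast0)

lemma foldr_add_index:
  assumes "\<forall>K\<in>set Ks. f K \<in> carrier_mat m n"
  shows "foldr (\<lambda>K acc. f K + acc) Ks (0\<^sub>m m n) \<in> carrier_mat m n"
    and "i < m \<Longrightarrow> j < n \<Longrightarrow> foldr (\<lambda>K acc. f K + acc) Ks (0\<^sub>m m n) $$ (i, j) = sum_list (map (\<lambda>K. f K $$ (i, j)) Ks)"
  using assms by (induction Ks) auto

text \<open>Trace preservation says that the stacked Kraus operators have orthonormal columns, that
  is, form the Stinespring isometry.\<close>

lemma kraus_gram:
  assumes K: "kraus_channel m n Ks" and ij: "i < m" "j < m"
  shows "(\<Sum>e<length Ks. \<Sum>y<n. cnj ((Ks ! e) $$ (y, i)) * (Ks ! e) $$ (y, j)) = kd i j"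
proof -
  have c: "\<forall>K\<in>set Ks. K \<in> carrier_mat n m" using K by (simp add: kraus_channel_def)
  then have c': "\<forall>K\<in>set Ks. adj K * K \<in> carrier_mat m m" by (meson adj_carrier mult_carrier_mat)
  have "kd i j = foldr (\<lambda>K acc. adj K * K + acc) Ks (0\<^sub>m m m) $$ (i, j)"
    using K ij by (auto simp: kraus_channel_def kd_def)
  also have "\<dots> = (\<Sum>e<length Ks. (adj (Ks ! e) * (Ks ! e)) $$ (i, j))"
    using foldr_add_index(2)[OF c' ij] by (simp add: sum_list_eq_sum_nth)
  also have "\<dots> = (\<Sum>e<length Ks. \<Sum>y<n. cnj ((Ks ! e) $$ (y, i)) * (Ks ! e) $$ (y, j))"
  proof (intro sum.cong refl)
    fix e assume "e \<in> {..<length Ks}"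
    then have K: "Ks ! e \<in> carrier_mat n m" using c by simp
    show "(adj (Ks ! e) * (Ks ! e)) $$ (i, j) = (\<Sum>y<n. cnj ((Ks ! e) $$ (y, i)) * (Ks ! e) $$ (y, j))"
      using mult_index[OF adj_carrier[OF K] K ij] ij adj_index[OF K] by simp
  qed
  finally show ?thesis ..
qed

text \<open>An operator on a composite system is written as a sum of dyads x y*, and every map
  in the protocol acts on the two legs separately.\<close>
definition dyads :: "nat \<Rightarrow> complex mat \<Rightarrow> 't set \<Rightarrow> (nat \<Rightarrow> 't \<Rightarrow> complex) \<Rightarrow> (nat \<Rightarrow> 't \<Rightarrow> complex) \<Rightarrow> bool" where
  "dyads n M T x y \<longleftrightarrow> M \<in> carrier_mat n n \<and>
     (\<forall>i<n. \<forall>j<n. M $$ (i, j) = (\<Sum>t\<in>T. x i t * cnj (y j t)))"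

lemma dyads_carrier: "dyads n M T x y \<Longrightarrow> M \<in> carrier_mat n n"
  and dyads_index: "dyads n M T x y \<Longrightarrow> i < n \<Longrightarrow> j < n \<Longrightarrow> M $$ (i, j) = (\<Sum>t\<in>T. x i t * cnj (y j t))"
  by (simp_all add: dyads_def)

text \<open>Pairs the columns of M with the unit vectors, which covers operators that are neither
  positive nor Hermitian.\<close>

lemma dyads_trivial:
  assumes "M \<in> carrier_mat n n"
  shows "dyads n M {..<n} (\<lambda>i t. M $$ (i, t)) kd"
  using assms by (simp add: dyads_def)

lemma dyads_cong:
  assumes "dyads n M T x y" "\<And>i t. i < n \<Longrightarrow> t \<in> T \<Longrightarrow> x i t = x' i t" "\<And>i t. i < n \<Longrightarrow> t \<in> T \<Longrightarrow> y i t = y' i t"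
  shows "dyads n M T x' y'"
  using assms unfolding dyads_def by auto

lemma conj_dyads_index:
  assumes d: "dyads n M T x y" and K: "K \<in> carrier_mat m n" and ij: "i < m" "j < m"
  shows "(K * M * adj K) $$ (i, j) = (\<Sum>t\<in>T. (\<Sum>k<n. K $$ (i, k) * x k t) * cnj (\<Sum>k<n. K $$ (j, k) * y k t))"
proof -
  have "(K * M * adj K) $$ (i, j) = (\<Sum>k<n. \<Sum>l<n. K $$ (i, k) * M $$ (k, l) * cnj (K $$ (j, l)))"
    by (rule conj_index[OF K dyads_carrier[OF d] ij])
  also have "\<dots> = (\<Sum>k<n. \<Sum>l<n. \<Sum>t\<in>T. (K $$ (i, k) * x k t) * (cnj (K $$ (j, l)) * cnj (y l t)))"
    by (intro sum.cong refl) (simp add: dyads_index[OF d] sum_distrib_left sum_distrib_right mult_ac)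
  also have "\<dots> = (\<Sum>t\<in>T. \<Sum>k<n. \<Sum>l<n. (K $$ (i, k) * x k t) * (cnj (K $$ (j, l)) * cnj (y l t)))"
    by (subst sum.swap[of _ T], intro sum.cong refl sum.swap)
  finally show ?thesis by (simp add: sum_product)
qed

lemma dyads_conj:
  assumes d: "dyads n M T x y" and K: "K \<in> carrier_mat m n"
  shows "dyads m (K * M * adj K) T (\<lambda>i t. \<Sum>k<n. K $$ (i, k) * x k t) (\<lambda>i t. \<Sum>k<n. K $$ (i, k) * y k t)"
  unfolding dyads_def
proof (intro conjI allI impI)
  show "K * M * adj K \<in> carrier_mat m m"
    using K dyads_carrier[OF d] by (meson adj_carrier mult_carrier_mat)
qed (rule conj_dyads_index[OF d K])

lemma sum_list_concat_map:
  "sum_list (map f (concat (map g xs))) = sum_list (map (\<lambda>x. sum_list (map f (g x))) xs)"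
  for f :: "_ \<Rightarrow> complex"
  by (induction xs) auto

lemma sum_list_kron_list:
  "sum_list (map f (kron_list Ks Ks')) = (\<Sum>e<length Ks. \<Sum>e'<length Ks'. f (kron (Ks ! e) (Ks' ! e')))"
  for f :: "_ \<Rightarrow> complex"
  unfolding kron_list_def sum_list_concat_map map_map comp_def unfolding sum_list_eq_sum_nth ..

text \<open>Every Kraus operator acts on both legs alike, so its label becomes a further dyad
  index.\<close>

lemma dyads_kraus_kron:
  assumes d: "dyads (n * n') M T x y"
    and K: "\<forall>K\<in>set Ks. K \<in> carrier_mat m n" "\<forall>K\<in>set Ks'. K \<in> carrier_mat m' n'"
  shows "dyads (m * m') (kraus_apply (m * m') (kron_list Ks Ks') M) (T \<times> {..<length Ks} \<times> {..<length Ks'})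
    (\<lambda>i t. \<Sum>k<n * n'. kron (Ks ! fst (snd t)) (Ks' ! snd (snd t)) $$ (i, k) * x k (fst t))
    (\<lambda>i t. \<Sum>k<n * n'. kron (Ks ! fst (snd t)) (Ks' ! snd (snd t)) $$ (i, k) * y k (fst t))"
proof -
  have c0: "K \<in> carrier_mat (m * m') (n * n')" if "K \<in> set (kron_list Ks Ks')" for K
    using that K by (auto simp: kron_list_def)
  then have c: "\<forall>K\<in>set (kron_list Ks Ks'). K * M * adj K \<in> carrier_mat (m * m') (m * m')"
    using dyads_carrier[OF d] by (meson adj_carrier mult_carrier_mat)
  show ?thesis unfolding dyads_def
  proof (intro conjI allI impI)
    show "kraus_apply (m * m') (kron_list Ks Ks') M \<in> carrier_mat (m * m') (m * m')"
      unfolding kraus_apply_def by (rule foldr_add_index(1)[OF c])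
    fix i j assume ij: "i < m * m'" "j < m * m'"
    have "kraus_apply (m * m') (kron_list Ks Ks') M $$ (i, j)
      = (\<Sum>e<length Ks. \<Sum>e'<length Ks'. (kron (Ks ! e) (Ks' ! e') * M * adj (kron (Ks ! e) (Ks' ! e'))) $$ (i, j))"
      unfolding kraus_apply_def foldr_add_index(2)[OF c ij] by (rule sum_list_kron_list)
    also have "\<dots> = (\<Sum>e<length Ks. \<Sum>e'<length Ks'. \<Sum>t\<in>T. (\<Sum>k<n * n'. kron (Ks ! e) (Ks' ! e') $$ (i, k) * x k t)
        * cnj (\<Sum>k<n * n'. kron (Ks ! e) (Ks' ! e') $$ (j, k) * y k t))"
    proof (intro sum.cong refl conj_dyads_index[OF d _ ij])
      fix e e' assume "e \<in> {..<length Ks}" "e' \<in> {..<length Ks'}"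
      then show "kron (Ks ! e) (Ks' ! e') \<in> carrier_mat (m * m') (n * n')" using K by simp
    qed
    also have "\<dots> = (\<Sum>t\<in>T. \<Sum>e<length Ks. \<Sum>e'<length Ks'. (\<Sum>k<n * n'. kron (Ks ! e) (Ks' ! e') $$ (i, k) * x k t)
        * cnj (\<Sum>k<n * n'. kron (Ks ! e) (Ks' ! e') $$ (j, k) * y k t))"
      by (subst sum.swap[of _ T], intro sum.cong refl sum.swap)
    finally show "kraus_apply (m * m') (kron_list Ks Ks') M $$ (i, j) = (\<Sum>t\<in>T \<times> {..<length Ks} \<times> {..<length Ks'}.
       (\<Sum>k<n * n'. kron (Ks ! fst (snd t)) (Ks' ! snd (snd t)) $$ (i, k) * x k (fst t)) *
       cnj (\<Sum>k<n * n'. kron (Ks ! fst (snd t)) (Ks' ! snd (snd t)) $$ (j, k) * y k (fst t)))"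
      by (simp only: sum_Times fst_conv snd_conv)
  qed
qed

lemma dyads_kron_outer:
  assumes d: "dyads n M T x y" and \<psi>: "dim_vec \<psi> = k"
  shows "dyads (n * k) (kron M (outer \<psi>)) T (\<lambda>i t. x (i div k) t * \<psi> $ (i mod k)) (\<lambda>i t. y (i div k) t * \<psi> $ (i mod k))"
  unfolding dyads_def
proof (intro conjI allI impI)
  have o: "outer \<psi> \<in> carrier_mat k k" by (simp add: outer_def \<psi>)
  note M = dyads_carrier[OF d]
  show "kron M (outer \<psi>) \<in> carrier_mat (n * k) (n * k)" using M o by simp
  fix i j assume ij: "i < n * k" "j < n * k"
  note di = div_mod_less[OF ij(1)] div_mod_less[OF ij(2)]
  have "kron M (outer \<psi>) $$ (i div k * k + i mod k, j div k * k + j mod k) = M $$ (i div k, j div k) * outer \<psi> $$ (i mod k, j mod k)"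
    using di by (intro kron_index[OF M o]) auto
  then show "kron M (outer \<psi>) $$ (i, j)
    = (\<Sum>t\<in>T. x (i div k) t * \<psi> $ (i mod k) * cnj (y (j div k) t * \<psi> $ (j mod k)))"
    using di by (simp add: dyads_index[OF d] outer_def \<psi> sum_distrib_right) (simp add: mult_ac)
qed

lemma swap_carrier [simp]: "swap m n \<in> carrier_mat (m * n) (m * n)"
  by (simp add: swap_def)

lemma swap_index:
  assumes "a < m" "b < n" "b' < n" "a' < m"
  shows "swap m n $$ (b' * m + a', a * n + b) = kd a' a * kd b' b"
proof -
  have "b' * m + a' < m * n" using index_less[of b' n a' m] assms by (simp add: mult.commute)
  then have "swap m n $$ (b' * m + a', a * n + b) = kd (b' * m + a') (b * m + a)"
    using assms index_less[of a m b n] by (simp add: swap_def kd_def)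
  then show ?thesis using assms by (simp add: kd_index)
qed

subsection \<open>The protocol in Kraus form\<close>

lemma kron_apply:
  assumes "M \<in> carrier_mat m n" "N \<in> carrier_mat m' n'" "i < m" "j < m'"
  shows "(\<Sum>k<n * n'. kron M N $$ (i * m' + j, k) * f k) = (\<Sum>k<n. \<Sum>l<n'. M $$ (i, k) * N $$ (j, l) * f (k * n' + l))"
  unfolding sum_lessThan_times using assms by (intro sum.cong refl) (simp add: kron_index)

lemma index_div_mod: "j < n \<Longrightarrow> (i * n + j) div n = i" "j < n \<Longrightarrow> (i * n + j) mod n = j" for i j n :: nat
  by simp_all

lemma swap_apply:
  assumes "a < m" "b < n"
  shows "(\<Sum>k<m * n. swap m n $$ (b * m + a, k) * f k) = f (a * n + b)"
proof -
  have "(\<Sum>k<m * n. swap m n $$ (b * m + a, k) * f k) = (\<Sum>i<m. kd a i * (\<Sum>j<n. kd b j * f (i * n + j)))"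
    unfolding sum_lessThan_times sum_distrib_left using assms
    by (intro sum.cong refl) (simp add: swap_index)
  then show ?thesis using assms by simp
qed

lemma kron_one_swap_apply:
  assumes "c < d" "a < m" "b < n"
  shows "(\<Sum>k<d * (m * n). kron (1\<^sub>m d) (swap m n) $$ (c * (m * n) + (b * m + a), k) * f k) = f (c * (m * n) + (a * n + b))"
proof -
  have "b * m + a < m * n" using index_less[of b n a m] assms by (simp add: mult.commute)
  then have "(\<Sum>k<d * (m * n). kron (1\<^sub>m d) (swap m n) $$ (c * (m * n) + (b * m + a), k) * f k)
    = (\<Sum>i<d. \<Sum>k<m * n. (1\<^sub>m d) $$ (c, i) * swap m n $$ (b * m + a, k) * f (i * (m * n) + k))"
    using assms by (intro kron_apply[of _ d]) auto
  also have "\<dots> = (\<Sum>i<d. kd c i * (\<Sum>k<m * n. swap m n $$ (b * m + a, k) * f (i * (m * n) + k)))"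
    unfolding sum_distrib_left using assms by (intro sum.cong refl) (simp add: kd_def)
  finally show ?thesis using assms by (simp add: swap_apply)
qed

lemma kron_one_apply:
  assumes M: "M \<in> carrier_mat m n" and i: "i < m" "c < d"
  shows "(\<Sum>k<n * d. kron M (1\<^sub>m d) $$ (i * d + c, k) * f k) = (\<Sum>k<n. M $$ (i, k) * f (k * d + c))"
proof -
  have "(\<Sum>k<n * d. kron M (1\<^sub>m d) $$ (i * d + c, k) * f k) = (\<Sum>k<n. \<Sum>l<d. M $$ (i, k) * (1\<^sub>m d) $$ (c, l) * f (k * d + l))"
    using assms by (intro kron_apply) auto
  also have "\<dots> = (\<Sum>k<n. M $$ (i, k) * (\<Sum>l<d. kd c l * f (k * d + l)))"
    unfolding sum_distrib_left using i by (intro sum.cong refl) (simp add: kd_def)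
  finally show ?thesis using i by simp
qed

text \<open>Stinespring isometry with the Kraus label as environment index, for operations with a
  composite output; \<open>kraus_merge\<close> is the variant for a single output system, with the
  label last.\<close>

definition kraus_split :: "complex mat list \<Rightarrow> nat \<Rightarrow> nat \<Rightarrow> nat \<times> nat \<Rightarrow> nat \<times> nat \<times> nat \<Rightarrow> complex" where
  "kraus_split Ks n m x z = (Ks ! fst z) $$ (fst (snd z) * m + snd (snd z), fst x * n + snd x)"

definition kraus_merge :: "complex mat list \<Rightarrow> nat \<Rightarrow> nat \<times> nat \<Rightarrow> nat \<times> nat \<Rightarrow> complex" where
  "kraus_merge Ks n x z = (Ks ! snd z) $$ (fst z, fst x * n + snd x)"

lemma kraus_split_isom:
  assumes "kraus_channel (k * n) (j * m) Ks"
  shows "isom ({..<k} \<times> {..<n}) ({..<length Ks} \<times> {..<j} \<times> {..<m}) (kraus_split Ks n m)"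
  unfolding isom_def
proof (intro conjI ballI)
  fix x y assume xy: "x \<in> {..<k} \<times> {..<n}" "y \<in> {..<k} \<times> {..<n}"
  have "(\<Sum>z\<in>{..<length Ks} \<times> {..<j} \<times> {..<m}. cnj (kraus_split Ks n m x z) * kraus_split Ks n m y z)
    = (\<Sum>e<length Ks. \<Sum>z<j * m. cnj ((Ks ! e) $$ (z, fst x * n + snd x)) * (Ks ! e) $$ (z, fst y * n + snd y))"
    unfolding sum_Times sum_lessThan_times kraus_split_def by simp
  also have "\<dots> = kd (fst x * n + snd x) (fst y * n + snd y)"
    using xy by (intro kraus_gram[OF assms]) (auto intro: index_less)
  also have "\<dots> = kd x y" using xy by (auto simp: kd_index kd_pair)
  finally show "(\<Sum>z\<in>{..<length Ks} \<times> {..<j} \<times> {..<m}. cnj (kraus_split Ks n m x z) * kraus_split Ks n m y z) = kd x y" .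
qed auto

lemma kraus_merge_isom:
  assumes "kraus_channel (k * n) j Ks"
  shows "isom ({..<k} \<times> {..<n}) ({..<j} \<times> {..<length Ks}) (kraus_merge Ks n)"
  unfolding isom_def
proof (intro conjI ballI)
  fix x y assume xy: "x \<in> {..<k} \<times> {..<n}" "y \<in> {..<k} \<times> {..<n}"
  have "(\<Sum>z\<in>{..<j} \<times> {..<length Ks}. cnj (kraus_merge Ks n x z) * kraus_merge Ks n y z)
    = (\<Sum>e<length Ks. \<Sum>z<j. cnj ((Ks ! e) $$ (z, fst x * n + snd x)) * (Ks ! e) $$ (z, fst y * n + snd y))"
    unfolding sum_Times kraus_merge_def fst_conv snd_conv by (rule sum.swap)
  also have "\<dots> = kd (fst x * n + snd x) (fst y * n + snd y)"
    using xy by (intro kraus_gram[OF assms]) (auto intro: index_less)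
  also have "\<dots> = kd x y" using xy by (auto simp: kd_index kd_pair)
  finally show "(\<Sum>z\<in>{..<j} \<times> {..<length Ks}. cnj (kraus_merge Ks n x z) * kraus_merge Ks n y z) = kd x y" .
qed auto

text \<open>The identity is required for all matrices and not only for states, because
  \<open>ext_id\<close> applies the map to off-diagonal blocks.\<close>

definition krep :: "nat \<Rightarrow> nat \<Rightarrow> (complex mat \<Rightarrow> complex mat) \<Rightarrow> 'e set \<Rightarrow> (nat \<Rightarrow> nat \<Rightarrow> 'e \<Rightarrow> complex) \<Rightarrow> bool" where
  "krep n m N E g \<longleftrightarrow> (\<forall>\<rho>\<in>carrier_mat n n. N \<rho> \<in> carrier_mat m m \<and>
     (\<forall>i<m. \<forall>j<m. N \<rho> $$ (i, j) = (\<Sum>e\<in>E. \<Sum>k<n. \<Sum>l<n. g i k e * \<rho> $$ (k, l) * cnj (g j l e))))"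

lemma krep_unitary:
  assumes "U \<in> carrier_mat n n"
  shows "krep n n (\<lambda>\<rho>. U * \<rho> * adj U) {()} (\<lambda>i k _. U $$ (i, k))"
  unfolding krep_def
proof (intro ballI conjI allI impI)
  fix \<rho> :: "complex mat" assume r: "\<rho> \<in> carrier_mat n n"
  show "U * \<rho> * adj U \<in> carrier_mat n n" using assms r by (meson adj_carrier mult_carrier_mat)
  fix i j assume "i < n" "j < n"
  then show "(U * \<rho> * adj U) $$ (i, j) = (\<Sum>e\<in>{()}. \<Sum>k<n. \<Sum>l<n. U $$ (i, k) * \<rho> $$ (k, l) * cnj (U $$ (j, l)))"
    using conj_index[OF assms r] by simp
qed

locale nlqc =
  fixes dA dB dL dR dKa dMa dKb dMb :: nat
    and Vs Vs' Ws Ws' :: "complex mat list" and \<psi> :: "complex vec"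
  assumes chV: "kraus_channel (dA*dL) (dKa*dMb) Vs"
    and chV': "kraus_channel (dR*dB) (dMa*dKb) Vs'"
    and chW: "kraus_channel (dKa*dMa) dA Ws"
    and chW': "kraus_channel (dMb*dKb) dB Ws'"
    and psi: "unit_cvec (dL*dR) \<psi>"
begin

lemma resource_norm: "(\<Sum>l<dL. \<Sum>r<dR. (cmod (\<psi> $ (l * dR + r)))\<^sup>2) = 1"
  using psi unfolding unit_cvec_def sum_lessThan_times by simp

sublocale protocol "{..<dA}" "{..<dB}" "{..<dL}" "{..<dR}" "{..<dKa}" "{..<dMa}" "{..<dKb}" "{..<dMb}"
  "{..<length Vs}" "{..<length Vs'}" "{..<length Ws}" "{..<length Ws'}"
  "kraus_split Vs dL dMb" "kraus_split Vs' dB dKb" "kraus_merge Ws dMa" "kraus_merge Ws' dKb" "\<lambda>l r. \<psi> $ (l * dR + r)"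
  by unfold_locales (use kraus_split_isom[OF chV] kraus_split_isom[OF chV'] kraus_merge_isom[OF chW]
      kraus_merge_isom[OF chW'] resource_norm in auto)

text \<open>The Kraus operators of the whole protocol, labelled by e = ((e1, e2), (e3, e4)) and read
  off from the isometry G.\<close>

definition g :: "nat \<Rightarrow> nat \<Rightarrow> (nat \<times> nat) \<times> nat \<times> nat \<Rightarrow> complex" where
  "g i k e = G (k div dB, k mod dB) ((i div dB, fst (snd e)), (i mod dB, snd (snd e)), fst e)"

lemma carriers:
  "\<forall>K\<in>set Vs. K \<in> carrier_mat (dKa*dMb) (dA*dL)" "\<forall>K\<in>set Vs'. K \<in> carrier_mat (dMa*dKb) (dR*dB)"
  "\<forall>K\<in>set Ws. K \<in> carrier_mat dA (dKa*dMa)" "\<forall>K\<in>set Ws'. K \<in> carrier_mat dB (dMb*dKb)"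
  using chV chV' chW chW' by (simp_all add: kraus_channel_def)

text \<open>A single leg is followed through the protocol. Its amplitude is evaluated with every
  index written in the mixed radix of its tensor factors, where both permutations become rewritings
  of indices.\<close>

lemma nlqc_dyads:
  assumes d: "dyads (dA*dB) \<rho> T x y"
  shows "dyads (dA*dB) (nlqc_map dA dB dL dR dKa dMa dKb dMb Vs Vs' Ws Ws' (outer \<psi>) \<rho>)
    ((T \<times> {..<length Vs} \<times> {..<length Vs'}) \<times> {..<length Ws} \<times> {..<length Ws'})
    (\<lambda>i t. \<Sum>k<dA*dB. g i k (snd (fst t), snd t) * x k (fst (fst t)))
    (\<lambda>i t. \<Sum>k<dA*dB. g i k (snd (fst t), snd t) * y k (fst (fst t)))"
proof -
  let ?P1 = "kron (1\<^sub>m dA) (swap dB (dL*dR))"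
  let ?P2 = "kron (kron (1\<^sub>m dKa) (swap dMb dMa)) (1\<^sub>m dKb)"
  have dpsi: "dim_vec \<psi> = dL*dR" using psi by (simp add: unit_cvec_def)
  \<comment> \<open>\<open>leg1\<close> to \<open>leg5\<close> are the amplitudes after adjoining
    the resource, the first permutation, the first operations, the exchange and the last
    operations.\<close>
  define leg1 where "leg1 x k t = x (k div (dL*dR)) t * \<psi> $ (k mod (dL*dR))" for x :: "nat \<Rightarrow> _ \<Rightarrow> complex" and k and t :: 'a
  define leg2 where "leg2 x i t = (\<Sum>k<(dA*dB)*(dL*dR). ?P1 $$ (i, k) * leg1 x k t)" for x i t
  define leg3 where "leg3 x i t = (\<Sum>k<(dA*dL)*(dR*dB). kron (Vs ! fst (snd t)) (Vs' ! snd (snd t)) $$ (i, k) * leg2 x k (fst t))" for x i t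
  define leg4 where "leg4 x i t = (\<Sum>k<(dKa*dMb)*(dMa*dKb). ?P2 $$ (i, k) * leg3 x k t)" for x i t
  define leg5 where "leg5 x i t = (\<Sum>k<(dKa*dMa)*(dMb*dKb). kron (Ws ! fst (snd t)) (Ws' ! snd (snd t)) $$ (i, k) * leg4 x k (fst t))" for x i t
  have "dyads ((dA*dB)*(dL*dR)) (kron \<rho> (outer \<psi>)) T (leg1 x) (leg1 y)"
    unfolding leg1_def by (rule dyads_kron_outer[OF d dpsi])
  moreover have "?P1 \<in> carrier_mat ((dA*dL)*(dR*dB)) ((dA*dB)*(dL*dR))"
    using kron_carrier[OF one_carrier_mat swap_carrier, of dA dB "dL*dR"] by (simp add: mult_ac)
  ultimately have "dyads ((dA*dL)*(dR*dB)) (?P1 * kron \<rho> (outer \<psi>) * adj ?P1) T (leg2 x) (leg2 y)"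
    unfolding leg2_def by (rule dyads_conj)
  then have "dyads ((dKa*dMb)*(dMa*dKb)) (kraus_apply ((dKa*dMb)*(dMa*dKb)) (kron_list Vs Vs') (?P1 * kron \<rho> (outer \<psi>) * adj ?P1))
      (T \<times> {..<length Vs} \<times> {..<length Vs'}) (leg3 x) (leg3 y)"
    unfolding leg3_def by (rule dyads_kraus_kron[OF _ carriers(1,2)])
  moreover have "?P2 \<in> carrier_mat ((dKa*dMa)*(dMb*dKb)) ((dKa*dMb)*(dMa*dKb))"
    using kron_carrier[OF kron_carrier[OF one_carrier_mat swap_carrier] one_carrier_mat, of dKa dMb dMa dKb] by (simp add: mult_ac)
  ultimately have "dyads ((dKa*dMa)*(dMb*dKb)) (?P2 * kraus_apply ((dKa*dMb)*(dMa*dKb)) (kron_list Vs Vs') (?P1 * kron \<rho> (outer \<psi>) * adj ?P1) * adj ?P2)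
      (T \<times> {..<length Vs} \<times> {..<length Vs'}) (leg4 x) (leg4 y)"
    unfolding leg4_def by (rule dyads_conj)
  then have "dyads (dA*dB) (kraus_apply (dA*dB) (kron_list Ws Ws') (?P2 * kraus_apply ((dKa*dMb)*(dMa*dKb)) (kron_list Vs Vs') (?P1 * kron \<rho> (outer \<psi>) * adj ?P1) * adj ?P2))
      ((T \<times> {..<length Vs} \<times> {..<length Vs'}) \<times> {..<length Ws} \<times> {..<length Ws'}) (leg5 x) (leg5 y)"
    unfolding leg5_def by (rule dyads_kraus_kron[OF _ carriers(3,4)])
  moreover have "dKa*dMb*dMa*dKb = (dKa*dMb)*(dMa*dKb)" by simp
  ultimately have final: "dyads (dA*dB) (nlqc_map dA dB dL dR dKa dMa dKb dMb Vs Vs' Ws Ws' (outer \<psi>) \<rho>)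
      ((T \<times> {..<length Vs} \<times> {..<length Vs'}) \<times> {..<length Ws} \<times> {..<length Ws'}) (leg5 x) (leg5 y)"
    unfolding nlqc_map_def Let_def by (simp only:)
  have leg: "leg5 x i t = (\<Sum>k<dA*dB. g i k (snd (fst t), snd t) * x k (fst (fst t)))"
    if i: "i < dA*dB" and t: "t \<in> (T \<times> {..<length Vs} \<times> {..<length Vs'}) \<times> {..<length Ws} \<times> {..<length Ws'}" for x i t
  proof -
    obtain u e1 e2 e3 e4 where te: "t = ((u, (e1, e2)), (e3, e4))" by (metis prod.exhaust)
    have e: "Vs ! e1 \<in> carrier_mat (dKa*dMb) (dA*dL)" "Vs' ! e2 \<in> carrier_mat (dMa*dKb) (dR*dB)"
      "Ws ! e3 \<in> carrier_mat dA (dKa*dMa)" "Ws' ! e4 \<in> carrier_mat dB (dMb*dKb)"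
      using t carriers by (auto simp: te)
    have l2: "leg2 x ((a * dL + l) * (dR*dB) + (r * dB + b)) u = x (a * dB + b) u * \<psi> $ (l * dR + r)"
      if "a < dA" "l < dL" "r < dR" "b < dB" for a l r b
    proof -
      have lr: "l * dR + r < dL*dR" using that by (intro index_less)
      have "leg2 x (a * (dB * (dL*dR)) + ((l * dR + r) * dB + b)) u = leg1 x (a * (dB * (dL*dR)) + (b * (dL*dR) + (l * dR + r))) u"
        unfolding leg2_def mult.assoc[of dA] using that lr by (intro kron_one_swap_apply) auto
      also have "a * (dB * (dL*dR)) + (b * (dL*dR) + (l * dR + r)) = (a * dB + b) * (dL*dR) + (l * dR + r)"
        by (simp add: algebra_simps)
      also have "leg1 x \<dots> u = x (a * dB + b) u * \<psi> $ (l * dR + r)"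
        unfolding leg1_def index_div_mod[OF lr] ..
      also have "a * (dB * (dL*dR)) + ((l * dR + r) * dB + b) = (a * dL + l) * (dR*dB) + (r * dB + b)"
        by (simp add: algebra_simps)
      finally show ?thesis .
    qed
    have l3: "leg3 x ((ka * dMb + mb) * (dMa*dKb) + (ma * dKb + kb)) (u, (e1, e2))
      = (\<Sum>a<dA. \<Sum>b<dB. H (a, b) (ka, ma) (mb, kb) (e1, e2) * x (a * dB + b) u)"
      if "ka < dKa" "mb < dMb" "ma < dMa" "kb < dKb" for ka mb ma kb
    proof -
      have "leg3 x ((ka * dMb + mb) * (dMa*dKb) + (ma * dKb + kb)) (u, (e1, e2))
        = (\<Sum>k<dA*dL. \<Sum>k'<dR*dB. Vs ! e1 $$ (ka * dMb + mb, k) * Vs' ! e2 $$ (ma * dKb + kb, k') * leg2 x (k * (dR*dB) + k') u)"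
        unfolding leg3_def fst_conv snd_conv using e that by (intro kron_apply) (auto intro: index_less)
      also have "\<dots> = (\<Sum>a<dA. \<Sum>l<dL. \<Sum>r<dR. \<Sum>b<dB. Vs ! e1 $$ (ka * dMb + mb, a * dL + l) * Vs' ! e2 $$ (ma * dKb + kb, r * dB + b)
          * (x (a * dB + b) u * \<psi> $ (l * dR + r)))"
        unfolding sum_lessThan_times by (intro sum.cong refl) (simp add: l2)
      also have "\<dots> = (\<Sum>a<dA. \<Sum>b<dB. \<Sum>l<dL. \<Sum>r<dR. Vs ! e1 $$ (ka * dMb + mb, a * dL + l) * Vs' ! e2 $$ (ma * dKb + kb, r * dB + b)
          * (x (a * dB + b) u * \<psi> $ (l * dR + r)))"
        by (subst sum.swap[of _ "{..<dB}" "{..<dR}"], subst sum.swap[of _ "{..<dB}" "{..<dL}"]) simp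
      also have "\<dots> = (\<Sum>a<dA. \<Sum>b<dB. H (a, b) (ka, ma) (mb, kb) (e1, e2) * x (a * dB + b) u)"
        unfolding H_def kraus_split_def fst_conv snd_conv sum_distrib_right by (intro sum.cong refl) (simp only: mult_ac)
      finally show ?thesis .
    qed
    have l4: "leg4 x ((ka * dMa + ma) * (dMb*dKb) + (mb * dKb + kb)) (u, (e1, e2))
      = (\<Sum>a<dA. \<Sum>b<dB. H (a, b) (ka, ma) (mb, kb) (e1, e2) * x (a * dB + b) u)"
      if "ka < dKa" "mb < dMb" "ma < dMa" "kb < dKb" for ka mb ma kb
    proof -
      have i1: "ka * (dMb*dMa) + (ma * dMb + mb) < dKa*(dMb*dMa)"
        using that index_less[of ma dMa mb dMb] by (intro index_less) (auto simp: mult.commute)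
      have "leg4 x ((ka * (dMb*dMa) + (ma * dMb + mb)) * dKb + kb) (u, (e1, e2))
        = (\<Sum>k<(dKa*(dMb*dMa))*dKb. ?P2 $$ ((ka * (dMb*dMa) + (ma * dMb + mb)) * dKb + kb, k) * leg3 x k (u, (e1, e2)))"
        unfolding leg4_def by (simp only: mult.assoc)
      also have "\<dots> = (\<Sum>k<dKa*(dMb*dMa). kron (1\<^sub>m dKa) (swap dMb dMa) $$ (ka * (dMb*dMa) + (ma * dMb + mb), k) * leg3 x (k * dKb + kb) (u, (e1, e2)))"
        using that i1 by (intro kron_one_apply[of _ "dKa*(dMb*dMa)"]) auto
      also have "\<dots> = leg3 x ((ka * (dMb*dMa) + (mb * dMa + ma)) * dKb + kb) (u, (e1, e2))"
        using that by (intro kron_one_swap_apply) auto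
      also have "(ka * (dMb*dMa) + (mb * dMa + ma)) * dKb + kb = (ka * dMb + mb) * (dMa*dKb) + (ma * dKb + kb)"
        by (simp add: algebra_simps)
      also have "(ka * (dMb*dMa) + (ma * dMb + mb)) * dKb + kb = (ka * dMa + ma) * (dMb*dKb) + (mb * dKb + kb)"
        by (simp add: algebra_simps)
      finally show ?thesis using l3[OF that] by simp
    qed
    define \<alpha> \<beta> where "\<alpha> = i div dB" and "\<beta> = i mod dB"
    have ab: "\<alpha> < dA" "\<beta> < dB" "i = \<alpha> * dB + \<beta>" using div_mod_less[OF i] by (simp_all add: \<alpha>_def \<beta>_def)
    have "leg5 x i t = (\<Sum>k<dKa*dMa. \<Sum>l<dMb*dKb. Ws ! e3 $$ (\<alpha>, k) * Ws' ! e4 $$ (\<beta>, l) * leg4 x (k * (dMb*dKb) + l) (u, (e1, e2)))"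
      unfolding leg5_def te fst_conv snd_conv ab(3) using e ab by (intro kron_apply) auto
    also have "\<dots> = (\<Sum>ka<dKa. \<Sum>ma<dMa. \<Sum>mb<dMb. \<Sum>kb<dKb. Ws ! e3 $$ (\<alpha>, ka * dMa + ma) * Ws' ! e4 $$ (\<beta>, mb * dKb + kb)
        * (\<Sum>a<dA. \<Sum>b<dB. H (a, b) (ka, ma) (mb, kb) (e1, e2) * x (a * dB + b) u))"
      unfolding sum_lessThan_times by (intro sum.cong refl) (simp add: l4)
    also have "\<dots> = (\<Sum>i\<in>{..<dKa} \<times> {..<dMa}. \<Sum>j\<in>{..<dMb} \<times> {..<dKb}. \<Sum>p\<in>{..<dA} \<times> {..<dB}.
        kraus_merge Ws dMa i (\<alpha>, e3) * (kraus_merge Ws' dKb j (\<beta>, e4) * (H p i j (e1, e2) * x (fst p * dB + snd p) u)))"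
      unfolding sum_Times kraus_merge_def fst_conv snd_conv sum_distrib_left by (intro sum.cong refl) (simp only: mult_ac)
    also have "\<dots> = (\<Sum>p\<in>{..<dA} \<times> {..<dB}. \<Sum>i\<in>{..<dKa} \<times> {..<dMa}. \<Sum>j\<in>{..<dMb} \<times> {..<dKb}.
        kraus_merge Ws dMa i (\<alpha>, e3) * (kraus_merge Ws' dKb j (\<beta>, e4) * (H p i j (e1, e2) * x (fst p * dB + snd p) u)))"
      by (subst sum.swap[of _ "{..<dA} \<times> {..<dB}"], intro sum.cong refl sum.swap)
    also have "\<dots> = (\<Sum>p\<in>{..<dA} \<times> {..<dB}. G p ((\<alpha>, e3), (\<beta>, e4), (e1, e2)) * x (fst p * dB + snd p) u)"
      unfolding G_def fst_conv snd_conv sum_distrib_left sum_distrib_right by (intro sum.cong refl) (simp only: mult_ac)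
    also have "\<dots> = (\<Sum>k<dA*dB. g i k (snd (fst t), snd t) * x k (fst (fst t)))"
      unfolding sum_lessThan_times sum_Times g_def te \<alpha>_def \<beta>_def by (intro sum.cong refl) simp
    finally show ?thesis .
  qed
  show ?thesis by (rule dyads_cong[OF final leg leg])
qed

lemma nlqc_krep:
  "krep (dA*dB) (dA*dB) (nlqc_map dA dB dL dR dKa dMa dKb dMb Vs Vs' Ws Ws' (outer \<psi>))
    (({..<length Vs} \<times> {..<length Vs'}) \<times> {..<length Ws} \<times> {..<length Ws'}) g"
  unfolding krep_def
proof (intro ballI conjI allI impI)
  let ?n = "dA*dB"
  let ?E = "({..<length Vs} \<times> {..<length Vs'}) \<times> {..<length Ws} \<times> {..<length Ws'}"
  fix \<rho> :: "complex mat" assume r: "\<rho> \<in> carrier_mat ?n ?n"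
  note d = nlqc_dyads[OF dyads_trivial[OF r]]
  show "nlqc_map dA dB dL dR dKa dMa dKb dMb Vs Vs' Ws Ws' (outer \<psi>) \<rho> \<in> carrier_mat ?n ?n"
    by (rule dyads_carrier[OF d])
  fix i j assume ij: "i < ?n" "j < ?n"
  have "nlqc_map dA dB dL dR dKa dMa dKb dMb Vs Vs' Ws Ws' (outer \<psi>) \<rho> $$ (i, j)
    = (\<Sum>t<?n. \<Sum>e\<in>?E. (\<Sum>k<?n. g i k e * \<rho> $$ (k, t)) * cnj (\<Sum>k<?n. g j k e * kd k t))"
    unfolding dyads_index[OF d ij] by (simp add: sum_Times)
  also have "\<dots> = (\<Sum>t<?n. \<Sum>e\<in>?E. \<Sum>k<?n. g i k e * \<rho> $$ (k, t) * cnj (g j t e))"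
    by (intro sum.cong refl) (simp add: sum_distrib_right del: cnj_sum)
  also have "\<dots> = (\<Sum>e\<in>?E. \<Sum>k<?n. \<Sum>t<?n. g i k e * \<rho> $$ (k, t) * cnj (g j t e))"
    by (subst sum.swap, intro sum.cong refl sum.swap)
  finally show "nlqc_map dA dB dL dR dKa dMa dKb dMb Vs Vs' Ws Ws' (outer \<psi>) \<rho> $$ (i, j)
    = (\<Sum>e\<in>?E. \<Sum>k<?n. \<Sum>l<?n. g i k e * \<rho> $$ (k, l) * cnj (g j l e))" .
qed

lemma g_isom:
  "isom {..<dA*dB} ({..<dA*dB} \<times> ({..<length Vs} \<times> {..<length Vs'}) \<times> {..<length Ws} \<times> {..<length Ws'}) (\<lambda>k z. g (fst z) k (snd z))"
  unfolding isom_def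
proof (intro conjI ballI)
  let ?E = "({..<length Vs} \<times> {..<length Vs'}) \<times> {..<length Ws} \<times> {..<length Ws'}"
  fix k l assume kl: "k \<in> {..<dA*dB}" "l \<in> {..<dA*dB}"
  let ?k = "(k div dB, k mod dB)" and ?l = "(l div dB, l mod dB)"
  have "(\<Sum>z\<in>{..<dA*dB} \<times> ?E. cnj (g (fst z) k (snd z)) * g (fst z) l (snd z))
    = (\<Sum>z\<in>({..<dA} \<times> {..<dB}) \<times> ?E. cnj (g (fst (fst z) * dB + snd (fst z)) k (snd z)) * g (fst (fst z) * dB + snd (fst z)) l (snd z))"
    by (simp add: sum_Times sum_lessThan_times)
  also have "\<dots> = (\<Sum>z\<in>({..<dA} \<times> {..<length Ws}) \<times> ({..<dB} \<times> {..<length Ws'}) \<times> {..<length Vs} \<times> {..<length Vs'}.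
      cnj (G ?k z) * G ?l z)"
    by (rule sum.reindex_bij_witness[of _
        "\<lambda>z. ((fst (fst z), fst (fst (snd z))), (snd (snd z), (snd (fst z), snd (fst (snd z)))))"
        "\<lambda>z. ((fst (fst z), fst (snd (snd z))), ((snd (fst z), snd (snd (snd z))), fst (snd z)))"])
      (auto simp: g_def)
  also have "\<dots> = kd ?k ?l" using G_isom kl div_mod_less by (simp add: isom_def)
  also have "\<dots> = kd k l" using kl by (simp add: kd_def) (metis div_mod_decomp)
  finally show "(\<Sum>z\<in>{..<dA*dB} \<times> ?E. cnj (g (fst z) k (snd z)) * g (fst z) l (snd z)) = kd k l" .
qed auto

end

subsection \<open>Spectral functions of matrices\<close>

lemma order_prod_linear:
  "order a (\<Prod>c\<leftarrow>cs. [:- c, 1:]) = count_list cs (a :: complex)" "(\<Prod>c\<leftarrow>cs. [:- c, 1:]) \<noteq> (0 :: complex poly)"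
  "poly (\<Prod>c\<leftarrow>cs. [:- c, 1:]) a = 0 \<longleftrightarrow> a \<in> set cs"
proof (induction cs)
  case (Cons c cs)
  {
    case 1
    have "order a [:- c, 1:] = (if c = a then 1 else 0)"
      using order_power_n_n[of a 1] by (auto simp: order_0I)
    then show ?case using Cons by (simp add: order_mult del: mult_pCons_left)
  next
    case 2
    then show ?case using Cons by (simp del: mult_pCons_left)
  next
    case 3
    then show ?case using Cons by auto
  }
qed simp_all

lemma sum_count_list:
  assumes "finite A" "set cs \<subseteq> A"
  shows "(\<Sum>a\<in>A. real (count_list cs a) * f a) = sum_list (map f cs)"
  using assms(2)
proof (induction cs)
  case (Cons c cs)
  have "(\<Sum>a\<in>A. real (count_list (c # cs) a) * f a) = (\<Sum>a\<in>A. (if c = a then f a else 0) + real (count_list cs a) * f a)"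
    by (intro sum.cong refl) (simp add: algebra_simps)
  then show ?case using Cons assms(1) by (simp add: sum.distrib)
qed simp

text \<open>The eigenbasis, taken as the columns of E, gives a unitary similarity with a diagonal
  matrix.\<close>

lemma char_poly_eigsys:
  assumes A: "A \<in> carrier_mat n n" and e: "eigsys {..<n} {..<n} (kern A) e p"
  shows "char_poly A = (\<Prod>c\<leftarrow>map (\<lambda>k. of_real (p k)) [0..<n]. [:- c, 1:])"
proof -
  note o = eigsys_onb[OF e]
  define E where "E = mat n n (\<lambda>(i, k). e k i)"
  define D where "D = mat n n (\<lambda>(i, j). if i = j then complex_of_real (p i) else 0)"
  have c: "E \<in> carrier_mat n n" "D \<in> carrier_mat n n" "adj E \<in> carrier_mat n n" by (simp_all add: E_def D_def adj_def)
  have EE: "E * adj E = 1\<^sub>m n"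
  proof (rule eq_matI)
    fix i j assume ij: "i < dim_row (1\<^sub>m n :: complex mat)" "j < dim_col (1\<^sub>m n :: complex mat)"
    then have "(E * adj E) $$ (i, j) = (\<Sum>k<n. e k i * cnj (e k j))"
      using mult_index[OF c(1,3), of i j] adj_index[OF c(1)] by (simp add: E_def)
    then show "(E * adj E) $$ (i, j) = 1\<^sub>m n $$ (i, j)" using ij by (simp add: onb_complete[OF o] kd_def)
  qed (use carrier_matD[OF c(1)] carrier_matD[OF c(3)] in auto)
  have EE': "adj E * E = 1\<^sub>m n"
  proof (rule eq_matI)
    fix i j assume ij: "i < dim_row (1\<^sub>m n :: complex mat)" "j < dim_col (1\<^sub>m n :: complex mat)"
    then have "(adj E * E) $$ (i, j) = (\<Sum>k<n. cnj (e i k) * e j k)"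
      using mult_index[OF c(3,1), of i j] adj_index[OF c(1)] by (simp add: E_def)
    then show "(adj E * E) $$ (i, j) = 1\<^sub>m n $$ (i, j)" using ij by (simp add: onb_ortho[OF o] kd_def)
  qed (use carrier_matD[OF c(1)] carrier_matD[OF c(3)] in auto)
  have "A = E * D * adj E"
  proof (rule eq_matI)
    fix i j assume "i < dim_row (E * D * adj E)" "j < dim_col (E * D * adj E)"
    then have ij: "i < n" "j < n" using c by auto
    have "(E * D * adj E) $$ (i, j) = (\<Sum>k<n. e k i * (\<Sum>l<n. kd k l * (of_real (p k) * cnj (e l j))))"
      unfolding conj_index[OF c(1,2) ij] sum_distrib_left using ij
      by (intro sum.cong refl) (simp add: E_def D_def kd_def)
    also have "\<dots> = (\<Sum>k<n. e k i * (of_real (p k) * cnj (e k j)))"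
      by (intro sum.cong refl) simp
    also have "\<dots> = kern A i j" using ij by (simp add: eigsys_eq[OF e] mult_ac)
    finally show "A $$ (i, j) = (E * D * adj E) $$ (i, j)" by (simp add: kern_def)
  qed (use A carrier_matD[OF c(1)] carrier_matD[OF c(3)] in auto)
  then have "similar_mat A D"
    unfolding similar_mat_def using A c EE EE' by (intro exI) (rule similar_mat_witI)
  then have "char_poly A = char_poly D" by (rule char_poly_similar)
  also have "\<dots> = (\<Prod>a\<leftarrow>diag_mat D. [:- a, 1:])"
    by (rule char_poly_upper_triangular[OF c(2)]) (auto simp: D_def upper_triangular_def)
  also have "diag_mat D = map (\<lambda>k. of_real (p k)) [0..<n]"
    by (auto simp: diag_mat_def D_def)
  finally show ?thesis .
qed

text \<open>The order of a root is the number of its occurrences in the list of eigenvalues, so the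
  sum over distinct roots becomes a sum over the eigenbasis.\<close>

lemma spec_sum_eigsys:
  assumes A: "A \<in> carrier_mat n n" and e: "eigsys {..<n} {..<n} (kern A) e p"
  shows "spec_sum A f = (\<Sum>k<n. f (of_real (p k)))"
proof -
  let ?cs = "map (\<lambda>k. complex_of_real (p k)) [0..<n]"
  have "spec_sum A f = (\<Sum>a\<in>set ?cs. real (count_list ?cs a) * f a)"
    unfolding spec_sum_def char_poly_eigsys[OF A e] order_prod_linear by simp
  also have "\<dots> = sum_list (map f ?cs)" by (rule sum_count_list) auto
  also have "\<dots> = (\<Sum>k<n. f (of_real (p k)))"
    by (simp add: comp_def interv_sum_list_conv_sum_set_nat lessThan_atLeast0)
  finally show ?thesis .
qed

lemma vN_entropy_eq_ent:
  assumes A: "A \<in> carrier_mat n n" and h: "herm {..<n} (kern A)"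
  shows "vN_entropy A = ent {..<n} (kern A)"
proof -
  obtain e p where e: "eigsys {..<n} {..<n} (kern A) e p"
    using spectral_theorem[OF _ h] by auto
  show ?thesis unfolding vN_entropy_def spec_sum_eigsys[OF A e] ent_eq[OF e] by simp
qed

text \<open>For Hermitian D the product of its adjoint with D has the same eigenvectors and squared
  eigenvalues, whose roots are the moduli.\<close>

lemma trace_norm_eigsys:
  assumes D: "D \<in> carrier_mat n n" and e: "eigsys {..<n} {..<n} (kern D) e \<mu>"
  shows "trace_norm D = (\<Sum>k<n. \<bar>\<mu> k\<bar>)"
proof -
  have c: "adj D * D \<in> carrier_mat n n" using D by (meson adj_carrier mult_carrier_mat)
  have "eigsys {..<n} {..<n} (kern (adj D * D)) e (\<lambda>k. (\<mu> k)\<^sup>2)"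
    unfolding eigsys_def
  proof (intro conjI ballI eigsys_onb[OF e])
    fix i j assume ij: "i \<in> {..<n}" "j \<in> {..<n}"
    have "kern (adj D * D) i j = (\<Sum>l<n. cnj (kern D l i) * kern D l j)"
      unfolding kern_def using mult_index[OF adj_carrier[OF D] D, of i j] ij adj_index[OF D] by simp
    also have "\<dots> = (\<Sum>l<n. \<Sum>k<n. kern D i l * (of_real (\<mu> k) * e k l * cnj (e k j)))"
      unfolding sum_distrib_left[symmetric] using ij
      by (intro sum.cong refl) (simp add: herm_sym[OF eigsys_herm[OF e]] eigsys_eq[OF e, symmetric])
    also have "\<dots> = (\<Sum>k<n. of_real (\<mu> k) * cnj (e k j) * (\<Sum>l<n. kern D i l * e k l))"
      unfolding sum_distrib_left by (subst sum.swap) (intro sum.cong refl, simp only: mult_ac)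
    also have "\<dots> = (\<Sum>k<n. of_real ((\<mu> k)\<^sup>2) * e k i * cnj (e k j))"
      using ij by (intro sum.cong refl) (simp add: eigsys_apply[OF e] power2_eq_square)
    finally show "kern (adj D * D) i j = (\<Sum>k<n. of_real ((\<mu> k)\<^sup>2) * e k i * cnj (e k j))" .
  qed
  then show ?thesis unfolding trace_norm_def by (simp add: spec_sum_eigsys[OF c])
qed

lemma sum_qf_onb_red:
  assumes "onb K I e"
  shows "(\<Sum>k\<in>K. qf I (red T x) (e k)) = tr I (red T x)"
proof -
  have "(\<Sum>k\<in>K. qf I (red T x) (e k)) = (\<Sum>t\<in>T. \<Sum>k\<in>K. (cmod (\<Sum>a\<in>I. cnj (e k a) * x a t))\<^sup>2)"
    unfolding qf_red by (rule sum.swap)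
  also have "\<dots> = tr I (red T x)" unfolding onb_parseval[OF assms] tr_red by (rule sum.swap)
  finally show ?thesis .
qed

text \<open>All three bounds come from one eigenbasis of the difference. The first makes the
  supremum in \<open>diamond_dist\<close> finite; the last converts a small trace norm into a large
  expectation in v.\<close>

lemma trace_norm_diff:
  assumes M: "M \<in> carrier_mat n n" "\<forall>i<n. \<forall>j<n. kern M i j = red T x i j"
    and N: "N \<in> carrier_mat n n" "\<forall>i<n. \<forall>j<n. kern N i j = red S y i j"
  shows "trace_norm (M - N) \<le> tr {..<n} (red T x) + tr {..<n} (red S y)"
    and "0 \<le> trace_norm (M - N)"
    and "(\<Sum>i<n. (cmod (v i))\<^sup>2) = 1 \<Longrightarrow> - trace_norm (M - N) \<le> qf {..<n} (red T x) v - qf {..<n} (red S y) v"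
proof -
  define D where "D = (\<lambda>i j. red T x i j - red S y i j)"
  have c: "M - N \<in> carrier_mat n n" using N(1) by (rule minus_carrier_mat)
  have k: "kern (M - N) i j = D i j" if "i \<in> {..<n}" "j \<in> {..<n}" for i j
    using that M N by (simp add: D_def kern_def)
  have h: "herm {..<n} D" unfolding herm_def D_def
    by (simp add: red_def mult.commute)
  obtain e \<mu> where e: "eigsys {..<n} {..<n} D e \<mu>" using spectral_theorem[OF _ h] by auto
  have tn: "trace_norm (M - N) = (\<Sum>k<n. \<bar>\<mu> k\<bar>)"
    using trace_norm_eigsys[OF c eigsys_cong[OF e]] k by simp
  have qD: "qf {..<n} D v = qf {..<n} (red T x) v - qf {..<n} (red S y) v" for v
    by (simp add: D_def qf_def left_diff_distrib right_diff_distrib sum_subtractf)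
  note o = eigsys_onb[OF e]
  have "(\<Sum>k<n. \<bar>\<mu> k\<bar>) \<le> (\<Sum>k<n. qf {..<n} (red T x) (e k) + qf {..<n} (red S y) (e k))"
  proof (intro sum_mono)
    fix k assume "k \<in> {..<n}"
    then have "\<mu> k = qf {..<n} (red T x) (e k) - qf {..<n} (red S y) (e k)"
      using qf_eigenvector[OF e] qD by simp
    moreover have "0 \<le> qf {..<n} (red T x) (e k)" "0 \<le> qf {..<n} (red S y) (e k)"
      using pos_red by (auto simp: pos_def)
    ultimately show "\<bar>\<mu> k\<bar> \<le> qf {..<n} (red T x) (e k) + qf {..<n} (red S y) (e k)" by linarith
  qed
  then show "trace_norm (M - N) \<le> tr {..<n} (red T x) + tr {..<n} (red S y)"
    unfolding tn by (simp add: sum.distrib sum_qf_onb_red[OF o])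
  show "0 \<le> trace_norm (M - N)" unfolding tn by (intro sum_nonneg) auto
  assume v: "(\<Sum>i<n. (cmod (v i))\<^sup>2) = 1"
  have w: "(\<Sum>k<n. (cmod (\<Sum>a<n. cnj (e k a) * v a))\<^sup>2) = 1" using onb_parseval[OF o, of v] v by simp
  have "- \<bar>\<mu> k\<bar> \<le> \<mu> k * (cmod (\<Sum>a<n. cnj (e k a) * v a))\<^sup>2" if "k < n" for k
  proof -
    let ?w = "(cmod (\<Sum>a<n. cnj (e k a) * v a))\<^sup>2"
    have "?w \<le> 1" unfolding w[symmetric] using that by (intro member_le_sum) auto
    then have "\<bar>\<mu> k\<bar> * ?w \<le> \<bar>\<mu> k\<bar> * 1" by (intro mult_left_mono) auto
    moreover have "- (\<bar>\<mu> k\<bar> * ?w) \<le> \<mu> k * ?w"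
      using mult_right_mono[of "- \<bar>\<mu> k\<bar>" "\<mu> k" ?w] by (simp add: abs_le_iff)
    ultimately show ?thesis by simp
  qed
  then have "(\<Sum>k<n. - \<bar>\<mu> k\<bar>) \<le> qf {..<n} D v" unfolding qf_eigsys[OF e] by (intro sum_mono) auto
  then show "- trace_norm (M - N) \<le> qf {..<n} (red T x) v - qf {..<n} (red S y) v"
    unfolding tn qD by (simp add: sum_negf)
qed

subsection \<open>Density matrices and the diamond distance\<close>

text \<open>The form is tested on e_i + c e_j with c equal to 0, 1 and the imaginary unit; that its
  values are real forces hermiticity by polarisation.\<close>

lemma psd_pos:
  assumes A: "A \<in> carrier_mat n n" and p: "psd A"
  shows "pos {..<n} (kern A)"
proof -
  let ?q = "\<lambda>v. \<Sum>i<n. \<Sum>j<n. cnj (v i) * kern A i j * v j"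
  have q: "Im (?q v) = 0" "Re (?q v) \<ge> 0" for v
    using p A unfolding psd_def Let_def kern_def by auto
  have ev: "?q (\<lambda>k. kd i k + c * kd j k) = kern A i i + c * kern A i j + cnj c * kern A j i + cnj c * c * kern A j j"
    if ij: "i < n" "j < n" for i j c
  proof -
    have 1: "(\<Sum>b<n. F b * (kd i b + c * kd j b)) = F i + c * F j" for F
    proof -
      have "(\<Sum>b<n. F b * (kd i b + c * kd j b)) = (\<Sum>b<n. kd i b * F b) + c * (\<Sum>b<n. kd j b * F b)"
        unfolding sum_distrib_left sum.distrib[symmetric] by (intro sum.cong refl) (simp add: algebra_simps)
      then show ?thesis using ij by simp
    qed
    define h where "h a = kern A a i + c * kern A a j" for a
    have "?q (\<lambda>k. kd i k + c * kd j k) = (\<Sum>a<n. cnj (kd i a + c * kd j a) * h a)"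
      unfolding 1 by (intro sum.cong refl) (simp add: h_def algebra_simps)
    also have "\<dots> = (\<Sum>a<n. kd i a * h a) + cnj c * (\<Sum>a<n. kd j a * h a)"
      unfolding sum_distrib_left sum.distrib[symmetric] by (intro sum.cong refl) (simp add: algebra_simps)
    also have "\<dots> = h i + cnj c * h j" using ij by simp
    also have "\<dots> = kern A i i + c * kern A i j + cnj c * kern A j i + cnj c * c * kern A j j"
      by (simp add: h_def algebra_simps)
    finally show ?thesis .
  qed
  have "herm {..<n} (kern A)"
    unfolding herm_def
  proof (intro ballI)
    fix i j assume "i \<in> {..<n}" "j \<in> {..<n}"
    then have ij: "i < n" "j < n" by auto
    have Eq: "Im (kern A i i + c * kern A i j + cnj c * kern A j i + cnj c * c * kern A j j) = 0" if "i < n" "j < n" for i j c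
      using q(1)[of "\<lambda>l. kd i l + c * kd j l"] unfolding ev[OF that] .
    have "Im (kern A k k) = 0" if "k < n" for k using Eq[OF that that, of 0] by simp
    then have "Im (kern A i i) = 0" "Im (kern A j j) = 0" using ij by auto
    then have "Im (kern A i j) + Im (kern A j i) = 0" "Re (kern A i j) - Re (kern A j i) = 0"
      using Eq[OF ij, of 1] Eq[OF ij, of \<i>] by simp_all
    then show "kern A j i = cnj (kern A i j)" by (simp add: complex_eq_iff)
  qed
  then show ?thesis using q(2) by (simp add: pos_def qf_def)
qed

text \<open>Purification by scaling each eigenvector with the root of its eigenvalue; the purifying
  label set is a copy of I.\<close>

lemma pos_obtain_red:
  assumes "finite I" "pos I M"
  obtains x where "\<And>a b. a \<in> I \<Longrightarrow> b \<in> I \<Longrightarrow> M a b = red I x a b"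
proof -
  obtain e p where e: "eigsys I I M e p" and p: "\<And>k. k \<in> I \<Longrightarrow> 0 \<le> p k"
    using pos_obtain_eigsys[OF assms] by blast
  have "M a b = red I (\<lambda>a k. of_real (sqrt (p k)) * e k a) a b" if ab: "a \<in> I" "b \<in> I" for a b
    unfolding eigsys_eq[OF e ab] red_def
  proof (intro sum.cong refl)
    fix k assume "k \<in> I"
    then have "complex_of_real (p k) = of_real (sqrt (p k)) * of_real (sqrt (p k))"
      using p unfolding of_real_mult[symmetric] by simp
    then show "of_real (p k) * e k a * cnj (e k b) = of_real (sqrt (p k)) * e k a * cnj (of_real (sqrt (p k)) * e k b)"
      by (simp add: mult_ac)
  qed
  then show ?thesis using that by blast
qed

lemma density_obtain_red:
  assumes "density n X"
  obtains x where "\<forall>i<n. \<forall>j<n. kern X i j = red {..<n} x i j"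
    "(\<Sum>i<n. \<Sum>t<n. (cmod (x i t))\<^sup>2) = 1"
proof -
  have X: "X \<in> carrier_mat n n" "psd X" "mtrace X = 1" using assms by (simp_all add: density_def)
  obtain x where x: "\<And>i j. i \<in> {..<n} \<Longrightarrow> j \<in> {..<n} \<Longrightarrow> kern X i j = red {..<n} x i j"
    using pos_obtain_red[OF _ psd_pos[OF X(1,2)]] by auto
  have "(\<Sum>i<n. \<Sum>t<n. (cmod (x i t))\<^sup>2) = tr {..<n} (kern X)"
    unfolding tr_red[symmetric] unfolding tr_def by (intro sum.cong refl) (simp add: x)
  also have "\<dots> = 1" using X by (simp add: mtrace_def tr_def kern_def flip: Re_sum)
  finally show ?thesis using that x by auto
qed

text \<open>The Kraus operators act on the last tensor factor of each vector x, so the output is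
  again of the form \<open>red\<close>, with the Kraus label added to the environment. The trace
  clause applies the isometry property for each reference index.\<close>

lemma ext_id_red:
  assumes N: "krep n m N E g" and E: "finite E" and X: "X \<in> carrier_mat (d * n) (d * n)"
    and x: "\<forall>i<d * n. \<forall>j<d * n. kern X i j = red T x i j"
  defines "y \<equiv> \<lambda>i t. \<Sum>k<n. g (i mod m) k (snd t) * x (i div m * n + k) (fst t)"
  shows "ext_id d n m N X \<in> carrier_mat (d * m) (d * m)"
    and "\<forall>i<d * m. \<forall>j<d * m. kern (ext_id d n m N X) i j = red (T \<times> E) y i j"
    and "isom {..<n} ({..<m} \<times> E) (\<lambda>k z. g (fst z) k (snd z)) \<Longrightarrow> tr {..<d * m} (red (T \<times> E) y) = tr {..<d * n} (red T x)"
proof -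
  show "ext_id d n m N X \<in> carrier_mat (d * m) (d * m)" by (simp add: ext_id_def)
  show "\<forall>i<d * m. \<forall>j<d * m. kern (ext_id d n m N X) i j = red (T \<times> E) y i j"
  proof (intro allI impI)
    fix i j assume ij: "i < d * m" "j < d * m"
    note di = div_mod_less[OF ij(1)] and dj = div_mod_less[OF ij(2)]
    let ?B = "mat n n (\<lambda>(a, b). X $$ ((i div m) * n + a, (j div m) * n + b))"
    have B: "?B $$ (k, l) = (\<Sum>t\<in>T. x (i div m * n + k) t * cnj (x (j div m * n + l) t))" if "k < n" "l < n" for k l
      using that x index_less[OF di(1) that(1)] index_less[OF dj(1) that(2)] by (simp add: kern_def red_def)
    have "kern (ext_id d n m N X) i j = N ?B $$ (i mod m, j mod m)"
      using ij by (simp add: kern_def ext_id_def)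
    also have "\<dots> = (\<Sum>e\<in>E. \<Sum>k<n. \<Sum>l<n. g (i mod m) k e * ?B $$ (k, l) * cnj (g (j mod m) l e))"
      using N di dj unfolding krep_def by simp
    also have "\<dots> = (\<Sum>e\<in>E. \<Sum>k<n. \<Sum>l<n. \<Sum>t\<in>T. (g (i mod m) k e * x (i div m * n + k) t)
        * (cnj (g (j mod m) l e) * cnj (x (j div m * n + l) t)))"
      by (intro sum.cong refl, subst B) (simp_all add: sum_distrib_left sum_distrib_right mult_ac)
    also have "\<dots> = (\<Sum>e\<in>E. \<Sum>t\<in>T. \<Sum>k<n. \<Sum>l<n. (g (i mod m) k e * x (i div m * n + k) t)
        * (cnj (g (j mod m) l e) * cnj (x (j div m * n + l) t)))"
      by (intro sum.cong refl) (subst sum.swap[of _ T], intro sum.cong refl sum.swap)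
    also have "\<dots> = (\<Sum>t\<in>T. \<Sum>e\<in>E. y i (t, e) * cnj (y j (t, e)))"
      unfolding y_def cnj_sum sum_product fst_conv snd_conv by (subst sum.swap) simp
    finally show "kern (ext_id d n m N X) i j = red (T \<times> E) y i j" by (simp add: red_def sum_Times)
  qed
  assume iso: "isom {..<n} ({..<m} \<times> E) (\<lambda>k z. g (fst z) k (snd z))"
  have "tr {..<d * m} (red (T \<times> E) y) = (\<Sum>r<d. \<Sum>j<m. \<Sum>t\<in>T. \<Sum>e\<in>E. (cmod (\<Sum>k<n. g j k e * x (r * n + k) t))\<^sup>2)"
    unfolding tr_red sum_lessThan_times sum_Times y_def fst_conv snd_conv
    by (intro sum.cong refl) (simp add: index_div_mod)
  also have "\<dots> = (\<Sum>r<d. \<Sum>t\<in>T. \<Sum>z\<in>{..<m} \<times> E. (cmod (\<Sum>k<n. g (fst z) k (snd z) * x (r * n + k) t))\<^sup>2)"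
    unfolding sum_Times fst_conv snd_conv by (intro sum.cong refl sum.swap)
  also have "\<dots> = (\<Sum>r<d. \<Sum>t\<in>T. \<Sum>k<n. (cmod (x (r * n + k) t))\<^sup>2)"
    unfolding isom_norm[OF iso] ..
  also have "\<dots> = tr {..<d * n} (red T x)"
    unfolding tr_red sum_lessThan_times by (intro sum.cong refl sum.swap)
  finally show "tr {..<d * m} (red (T \<times> E) y) = tr {..<d * n} (red T x)" .
qed

lemma unitary_gram:
  assumes "unitary n U" "k < n" "l < n"
  shows "(\<Sum>i<n. cnj (U $$ (i, k)) * U $$ (i, l)) = kd k l"
proof -
  have U: "U \<in> carrier_mat n n" "adj U * U = 1\<^sub>m n" using assms by (simp_all add: unitary_def)
  have "(\<Sum>i<n. cnj (U $$ (i, k)) * U $$ (i, l)) = (adj U * U) $$ (k, l)"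
    using mult_index[OF adj_carrier[OF U(1)] U(1) assms(2,3)] adj_index[OF U(1)] assms by simp
  then show ?thesis using assms by (simp add: U(2) kd_def)
qed

lemma unitary_krep_isom:
  assumes "unitary n U"
  shows "isom {..<n} ({..<n} \<times> {()}) (\<lambda>k z. U $$ (fst z, k))"
  unfolding isom_def using unitary_gram[OF assms] by (simp add: sum_Times)

text \<open>The pure input x has the pure ideal output u. The ideal output has expectation 1 in u,
  so by the bound on the trace norm the actual one has expectation at least 1 - \<epsilon>.\<close>

lemma diamond_dist_fidelity:
  assumes N: "krep n n N E g" and E: "finite E" and iso: "isom {..<n} ({..<n} \<times> E) (\<lambda>k z. g (fst z) k (snd z))"
    and U: "unitary n U" and dist: "diamond_dist n n N (\<lambda>\<rho>. U * \<rho> * adj U) \<le> \<epsilon>"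
    and x: "(\<Sum>i<d * n. (cmod (x i))\<^sup>2) = 1"
  defines "u \<equiv> \<lambda>i. \<Sum>k<n. U $$ (i mod n, k) * x (i div n * n + k)"
  shows "0 \<le> \<epsilon>"
    and "1 - \<epsilon> \<le> (\<Sum>e\<in>E. (cmod (\<Sum>i<d * n. cnj (u i) * (\<Sum>k<n. g (i mod n) k e * x (i div n * n + k))))\<^sup>2)"
proof -
  let ?V = "\<lambda>\<rho>. U * \<rho> * adj U"
  have Uc: "U \<in> carrier_mat n n" using U by (simp add: unitary_def)
  have finite_unit: "finite {()}" by simp
  note Uk = krep_unitary[OF Uc] and Ui = unitary_krep_isom[OF U]
  let ?A = "{trace_norm (ext_id d n n N X - ext_id d n n ?V X) | d X. density (d * n) X}"
  \<comment> \<open>The real supremum dominates its members only once the set is known to be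
    bounded; the difference of two states has trace norm at most 2.\<close>
  have "z \<le> 2" if "z \<in> ?A" for z
  proof -
    obtain d X where z: "z = trace_norm (ext_id d n n N X - ext_id d n n ?V X)" and X: "density (d * n) X"
      using \<open>z \<in> ?A\<close> by blast
    have Xc: "X \<in> carrier_mat (d * n) (d * n)" using X by (simp add: density_def)
    obtain y where y: "\<forall>i<d * n. \<forall>j<d * n. kern X i j = red {..<d * n} y i j"
      "(\<Sum>i<d * n. \<Sum>t<d * n. (cmod (y i t))\<^sup>2) = 1"
      using density_obtain_red[OF X] by blast
    note e1 = ext_id_red[OF N E Xc y(1)] and e2 = ext_id_red[OF Uk finite_unit Xc y(1)]
    show ?thesis
      unfolding z using trace_norm_diff(1)[OF e1(1,2) e2(1,2)] e1(3)[OF iso] e2(3)[OF Ui] y(2)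
      by (simp add: tr_red)
  qed
  then have bdd: "bdd_above ?A" by (rule bdd_aboveI)
  define X where "X = mat (d * n) (d * n) (\<lambda>(i, j). x i * cnj (x j))"
  have Xc: "X \<in> carrier_mat (d * n) (d * n)" by (simp add: X_def)
  define y where "y i t = x i" for i and t :: unit
  have y: "\<forall>i<d * n. \<forall>j<d * n. kern X i j = red {()} y i j"
    by (simp add: kern_def X_def red_def y_def)
  have X: "density (d * n) X"
    unfolding density_def
  proof (intro conjI Xc)
    have "mtrace X = of_real (\<Sum>i<d * n. (cmod (x i))\<^sup>2)"
      unfolding mtrace_def using Xc by (simp add: X_def mult_cnj_self)
    then show "mtrace X = 1" using x by simp
    show "psd X" unfolding psd_def Let_def
    proof (intro conjI allI)
      fix v :: "nat \<Rightarrow> complex"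
      have "(\<Sum>i<dim_row X. \<Sum>j<dim_row X. cnj (v i) * X $$ (i, j) * v j) = (\<Sum>i<d * n. cnj (v i) * x i) * cnj (\<Sum>i<d * n. cnj (v i) * x i)"
        unfolding cnj_sum sum_product using Xc by (intro sum.cong refl) (auto simp: X_def)
      then have "(\<Sum>i<dim_row X. \<Sum>j<dim_row X. cnj (v i) * X $$ (i, j) * v j) = of_real ((cmod (\<Sum>i<d * n. cnj (v i) * x i))\<^sup>2)"
        unfolding mult_cnj_self .
      then show "Im (\<Sum>i<dim_row X. \<Sum>j<dim_row X. cnj (v i) * X $$ (i, j) * v j) = 0"
        "0 \<le> Re (\<Sum>i<dim_row X. \<Sum>j<dim_row X. cnj (v i) * X $$ (i, j) * v j)" by simp_all
    qed (use Xc in auto)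
  qed
  note e1 = ext_id_red[OF N E Xc y, unfolded y_def] and e2 = ext_id_red[OF Uk finite_unit Xc y, unfolded y_def]
  have "trace_norm (ext_id d n n N X - ext_id d n n ?V X) \<in> ?A" using X by blast
  then have "trace_norm (ext_id d n n N X - ext_id d n n ?V X) \<le> diamond_dist n n N ?V"
    unfolding diamond_dist_def using bdd by (rule cSup_upper)
  then have le: "trace_norm (ext_id d n n N X - ext_id d n n ?V X) \<le> \<epsilon>" using dist by simp
  have t: "0 \<le> trace_norm (ext_id d n n N X - ext_id d n n ?V X)"
    by (rule trace_norm_diff(2)[OF e1(1,2) e2(1,2)])
  then show "0 \<le> \<epsilon>" using le by simp
  have un: "(\<Sum>i<d * n. (cmod (u i))\<^sup>2) = 1"
    using e2(3)[OF Ui] x by (simp add: tr_red u_def)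
  have "- trace_norm (ext_id d n n N X - ext_id d n n ?V X)
    \<le> qf {..<d * n} (red ({()} \<times> E) (\<lambda>i t. \<Sum>k<n. g (i mod n) k (snd t) * x (i div n * n + k))) u
      - qf {..<d * n} (red ({()} \<times> {()}) (\<lambda>i t. \<Sum>k<n. U $$ (i mod n, k) * x (i div n * n + k))) u"
    by (rule trace_norm_diff(3)[OF e1(1,2) e2(1,2) un])
  also have "qf {..<d * n} (red ({()} \<times> {()}) (\<lambda>i t. \<Sum>k<n. U $$ (i mod n, k) * x (i div n * n + k))) u = 1"
  proof -
    have "(\<Sum>i<d * n. cnj (u i) * u i) = 1" unfolding sum_cnj_mult_self un by simp
    moreover have "qf {..<d * n} (red ({()} \<times> {()}) (\<lambda>i t. \<Sum>k<n. U $$ (i mod n, k) * x (i div n * n + k))) u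
      = (cmod (\<Sum>i<d * n. cnj (u i) * u i))\<^sup>2"
      by (simp add: qf_red sum_Times u_def)
    ultimately show ?thesis by simp
  qed
  also have "qf {..<d * n} (red ({()} \<times> E) (\<lambda>i t. \<Sum>k<n. g (i mod n) k (snd t) * x (i div n * n + k))) u
    = (\<Sum>e\<in>E. (cmod (\<Sum>i<d * n. cnj (u i) * (\<Sum>k<n. g (i mod n) k e * x (i div n * n + k))))\<^sup>2)"
    by (simp add: qf_red sum_Times)
  finally show "1 - \<epsilon> \<le> (\<Sum>e\<in>E. (cmod (\<Sum>i<d * n. cnj (u i) * (\<Sum>k<n. g (i mod n) k e * x (i div n * n + k))))\<^sup>2)"
    using le by simp
qed

subsection \<open>Translation of the information quantities\<close>

lemma kron_one_left_apply:
  assumes M: "M \<in> carrier_mat m n" and i: "c < d" "i < m"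
  shows "(\<Sum>k<d * n. kron (1\<^sub>m d) M $$ (c * m + i, k) * f k) = (\<Sum>k<n. M $$ (i, k) * f (c * n + k))"
proof -
  have "(\<Sum>k<d * n. kron (1\<^sub>m d) M $$ (c * m + i, k) * f k) = (\<Sum>k<d. \<Sum>l<n. (1\<^sub>m d) $$ (c, k) * M $$ (i, l) * f (k * n + l))"
    using assms by (intro kron_apply[of _ d]) auto
  also have "\<dots> = (\<Sum>k<d. kd c k * (\<Sum>l<n. M $$ (i, l) * f (k * n + l)))"
    unfolding sum_distrib_left using i by (intro sum.cong refl) (simp add: kd_def)
  finally show ?thesis using i by simp
qed

lemma dyads_kron:
  assumes d: "dyads m M T x x" and d': "dyads n N S y y"
  shows "dyads (m * n) (kron M N) (T \<times> S) (\<lambda>i t. x (i div n) (fst t) * y (i mod n) (snd t)) (\<lambda>i t. x (i div n) (fst t) * y (i mod n) (snd t))"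
  unfolding dyads_def
proof (intro conjI allI impI)
  note M = dyads_carrier[OF d] and N = dyads_carrier[OF d']
  show "kron M N \<in> carrier_mat (m * n) (m * n)" using M N by simp
  fix i j assume ij: "i < m * n" "j < m * n"
  note di = div_mod_less[OF ij(1)] div_mod_less[OF ij(2)]
  have "kron M N $$ (i div n * n + i mod n, j div n * n + j mod n) = M $$ (i div n, j div n) * N $$ (i mod n, j mod n)"
    using di by (intro kron_index[OF M N]) auto
  also have "\<dots> = (\<Sum>t\<in>T. \<Sum>s\<in>S. (x (i div n) t * cnj (x (j div n) t)) * (y (i mod n) s * cnj (y (j mod n) s)))"
    using di by (simp add: dyads_index[OF d] dyads_index[OF d'] sum_product)
  finally show "kron M N $$ (i, j) = (\<Sum>t\<in>T \<times> S. x (i div n) (fst t) * y (i mod n) (snd t) * cnj (x (j div n) (fst t) * y (j mod n) (snd t)))"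
    by (simp add: sum_Times mult_ac)
qed

lemma vN_entropy_composite:
  assumes M: "M \<in> carrier_mat (m * n) (m * n)"
    and x: "\<And>a b. a \<in> {..<m} \<times> {..<n} \<Longrightarrow> b \<in> {..<m} \<times> {..<n} \<Longrightarrow> kern M (fst a * n + snd a) (fst b * n + snd b) = red T x a b"
  shows "vN_entropy M = ent ({..<m} \<times> {..<n}) (red T x)"
proof -
  have h: "herm {..<m * n} (kern M)"
    unfolding herm_def
  proof (intro ballI)
    fix i j assume ij: "i \<in> {..<m * n}" "j \<in> {..<m * n}"
    then have *: "(i div n, i mod n) \<in> {..<m} \<times> {..<n}" "(j div n, j mod n) \<in> {..<m} \<times> {..<n}"
      using div_mod_less by auto
    show "kern M j i = cnj (kern M i j)"
      using x[OF *] x[OF *(2,1)] by (simp add: red_def mult.commute)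
  qed
  have "vN_entropy M = ent ({..<m} \<times> {..<n}) (\<lambda>a b. kern M (fst a * n + snd a) (fst b * n + snd b))"
    unfolding vN_entropy_eq_ent[OF M h] by (rule ent_reindex[OF index_bij _ h, symmetric]) simp
  also have "\<dots> = ent ({..<m} \<times> {..<n}) (red T x)" by (rule ent_cong) (rule x)
  finally show ?thesis .
qed

text \<open>I(Q:A) = S(Q) - S(Q|A), with S(Q) kept in matrix form; the second clause exposes that
  marginal so that its independence of Bob's input can be shown.\<close>

lemma mutual_info_eq_cent:
  assumes M: "M \<in> carrier_mat (dQ * dA * dB) (dQ * dA * dB)"
    and x: "\<And>q a b q' a' b'. q < dQ \<Longrightarrow> a < dA \<Longrightarrow> b < dB \<Longrightarrow> q' < dQ \<Longrightarrow> a' < dA \<Longrightarrow> b' < dB \<Longrightarrow>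
      kern M ((q * dA + a) * dB + b) ((q' * dA + a') * dB + b') = (\<Sum>t\<in>T. x (q, a) (b, t) * cnj (x (q', a') (b', t)))"
  shows "mutual_info_QA dQ dA dB M
    = vN_entropy (ptr_right dQ dA (ptr_right (dQ * dA) dB M)) - cent {..<dQ} {..<dA} (red ({..<dB} \<times> T) x)"
    and "q < dQ \<Longrightarrow> q' < dQ \<Longrightarrow> ptr_right dQ dA (ptr_right (dQ * dA) dB M) $$ (q, q')
      = (\<Sum>a<dA. red ({..<dB} \<times> T) x (q, a) (q', a))"
proof -
  let ?R = "ptr_right (dQ * dA) dB M"
  have R: "kern ?R (q * dA + a) (q' * dA + a') = red ({..<dB} \<times> T) x (q, a) (q', a')"
    if "q < dQ" "a < dA" "q' < dQ" "a' < dA" for q a q' a'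
  proof -
    have "q * dA + a < dQ * dA" "q' * dA + a' < dQ * dA" using that by (auto intro: index_less)
    then have "kern ?R (q * dA + a) (q' * dA + a') = (\<Sum>b<dB. kern M ((q * dA + a) * dB + b) ((q' * dA + a') * dB + b))"
      by (simp add: kern_def ptr_right_def)
    then show ?thesis using that by (simp add: x red_def sum_Times)
  qed
  have Rc: "?R \<in> carrier_mat (dQ * dA) (dQ * dA)" by (simp add: ptr_right_def)
  have 1: "vN_entropy ?R = ent ({..<dQ} \<times> {..<dA}) (red ({..<dB} \<times> T) x)"
    by (rule vN_entropy_composite[OF Rc]) (auto simp: R)
  have L: "kern (ptr_left dQ dA ?R) a a' = marg {..<dQ} (red ({..<dB} \<times> T) x) a a'"
    if "a < dA" "a' < dA" for a a'
  proof -
    have "kern (ptr_left dQ dA ?R) a a' = (\<Sum>q<dQ. kern ?R (q * dA + a) (q * dA + a'))"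
      using that by (simp add: kern_def ptr_left_def)
    then show ?thesis using that by (simp add: R marg_def)
  qed
  have p: "pos {..<dA} (marg {..<dQ} (red ({..<dB} \<times> T) x))" by (intro pos_marg pos_red) simp
  have p': "pos {..<dA} (kern (ptr_left dQ dA ?R))" by (rule pos_cong[OF p]) (simp add: L)
  then have "vN_entropy (ptr_left dQ dA ?R) = ent {..<dA} (kern (ptr_left dQ dA ?R))"
    by (intro vN_entropy_eq_ent) (auto simp: ptr_left_def pos_def)
  also have "\<dots> = ent {..<dA} (marg {..<dQ} (red ({..<dB} \<times> T) x))" by (rule ent_cong) (simp add: L)
  finally show "mutual_info_QA dQ dA dB M = vN_entropy (ptr_right dQ dA ?R) - cent {..<dQ} {..<dA} (red ({..<dB} \<times> T) x)"
    by (simp add: mutual_info_QA_def Let_def cent_def 1)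
  assume q: "q < dQ" "q' < dQ"
  then have "ptr_right dQ dA ?R $$ (q, q') = (\<Sum>a<dA. kern ?R (q * dA + a) (q' * dA + a))"
    by (simp add: ptr_right_def[of dQ] kern_def)
  then show "ptr_right dQ dA ?R $$ (q, q') = (\<Sum>a<dA. red ({..<dB} \<times> T) x (q, a) (q', a))"
    using q by (simp add: R)
qed

text \<open>With x = 2 sqrt \<epsilon> the quantity 2x in the entropy term is y = 4 sqrt \<epsilon>,
  so \<open>Delta\<close> is the continuity bound at vector distance y.\<close>

lemma Delta_eq: "Delta (2 * sqrt \<epsilon>) n = 2 * (4 * sqrt \<epsilon>) * n + etagap (4 * sqrt \<epsilon>)" if "0 \<le> \<epsilon>"
proof -
  define y where "y = 4 * sqrt \<epsilon>"
  have y: "y \<ge> 0" using that by (simp add: y_def)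
  have "(1 + y) * bin_entropy (y / (1 + y)) = etagap y"
  proof (cases "y = 0")
    case False
    then have y0: "y > 0" using y by simp
    have 1: "1 - y / (1 + y) = 1 / (1 + y)" using y0 by (simp add: field_simps)
    have "eta (y / (1 + y)) = y / (1 + y) * log 2 (1 + y) - y / (1 + y) * log 2 y"
      using y0 by (simp add: eta_def log_divide right_diff_distrib)
    moreover have "eta (1 / (1 + y)) = 1 / (1 + y) * log 2 (1 + y)"
      using y0 by (simp add: eta_def log_divide)
    ultimately have "(1 + y) * bin_entropy (y / (1 + y)) = (1 + y) * (y / (1 + y) * log 2 (1 + y) - y / (1 + y) * log 2 y + 1 / (1 + y) * log 2 (1 + y))"
      by (simp only: bin_entropy_def 1)
    also have "\<dots> = y * log 2 (1 + y) - y * log 2 y + log 2 (1 + y)"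
    proof -
      have "w * (y / w * L - y / w * L' + 1 / w * L) = y * L - y * L' + L" if "w \<noteq> 0" for w L L' :: real
        using that by (simp add: field_simps)
      then show ?thesis using y0 by simp
    qed
    also have "\<dots> = etagap y"
    proof -
      have "eta y = - (y * log 2 y)" "eta (1 + y) = - ((1 + y) * log 2 (1 + y))"
        using y0 by (simp_all only: eta_def add_pos_pos zero_less_one if_True mult_minus_left)
      then show ?thesis unfolding etagap_def by (simp only:) (simp add: algebra_simps)
    qed
    finally show ?thesis .
  qed (simp add: bin_entropy_def etagap_def)
  then show ?thesis by (simp add: Delta_def y_def)
qed

lemma unitary_isom:
  assumes "unitary (m * n) U"
  shows "isom ({..<m} \<times> {..<n}) ({..<m} \<times> {..<n}) (\<lambda>x z. U $$ (fst z * n + snd z, fst x * n + snd x))"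
  unfolding isom_def
proof (intro conjI ballI)
  fix x y assume xy: "x \<in> {..<m} \<times> {..<n}" "y \<in> {..<m} \<times> {..<n}"
  have "(\<Sum>z\<in>{..<m} \<times> {..<n}. cnj (U $$ (fst z * n + snd z, fst x * n + snd x)) * U $$ (fst z * n + snd z, fst y * n + snd y))
    = kd (fst x * n + snd x) (fst y * n + snd y)"
    using xy unfolding unitary_gram[OF assms index_less index_less, symmetric]
    by (subst unitary_gram[OF assms, symmetric]) (auto intro: index_less simp: sum_Times sum_lessThan_times)
  also have "\<dots> = kd x y" using xy by (auto simp: kd_index kd_pair)
  finally show "(\<Sum>z\<in>{..<m} \<times> {..<n}. cnj (U $$ (fst z * n + snd z, fst x * n + snd x)) * U $$ (fst z * n + snd z, fst y * n + snd y)) = kd x y" .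
qed auto

section \<open>From the matrix protocol to the kernel bound\<close>

context nlqc
begin

definition Uk :: "complex mat \<Rightarrow> nat \<times> nat \<Rightarrow> nat \<times> nat \<Rightarrow> complex" where
  "Uk U x z = U $$ (fst z * dB + snd z, fst x * dB + snd x)"

text \<open>The diamond distance is tested on the purified product input, whose reference consists
  of Q and the two purifying systems; the remaining work identifies indices.\<close>

lemma faithful_of_diamond:
  fixes dQ dP dS :: nat
  assumes U: "unitary (dA*dB) U"
    and dist: "diamond_dist (dA*dB) (dA*dB) (nlqc_map dA dB dL dR dKa dMa dKb dMb Vs Vs' Ws Ws' (outer \<psi>)) (\<lambda>\<rho>. U * \<rho> * adj U) \<le> \<epsilon>"
    and \<pi>: "(\<Sum>q<dQ. \<Sum>a<dA. \<Sum>p<dP. (cmod (\<pi> q a p))\<^sup>2) = 1"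
    and \<phi>: "(\<Sum>b<dB. \<Sum>s<dS. (cmod (\<phi> b s))\<^sup>2) = 1"
  shows "faithful {..<dQ} {..<dP} {..<dS} (Uk U) \<pi> \<phi> \<epsilon>" and "0 \<le> \<epsilon>"
proof -
  let ?n = "dA*dB"
  let ?E = "({..<length Vs} \<times> {..<length Vs'}) \<times> {..<length Ws} \<times> {..<length Ws'}"
  \<comment> \<open>The reference is ordered Q P S and is followed by A B; x is the product vector
    in this order.\<close>
  define d where "d = (dQ * dP) * dS"
  define x where "x i = \<pi> (i div ?n div dS div dP) (i mod ?n div dB) (i div ?n div dS mod dP) * \<phi> (i mod ?n mod dB) (i div ?n mod dS)" for i
  have x: "x (((q * dP + p) * dS + s) * ?n + (a * dB + b)) = \<pi> q a p * \<phi> b s"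
    if "p < dP" "s < dS" "a < dA" "b < dB" for q p s a b
    unfolding x_def by (simp only: index_div_mod[OF index_less[OF that(3,4)]] index_div_mod[OF that(4)] index_div_mod[OF that(2)] index_div_mod[OF that(1)])
  have sm: "(\<Sum>i<d * ?n. F i) = (\<Sum>q<dQ. \<Sum>p<dP. \<Sum>s<dS. \<Sum>a<dA. \<Sum>b<dB. F (((q * dP + p) * dS + s) * ?n + (a * dB + b)))" for F :: "nat \<Rightarrow> 'z :: comm_monoid_add"
    unfolding d_def sum_lessThan_times ..
  have "(\<Sum>i<d * ?n. (cmod (x i))\<^sup>2) = (\<Sum>q<dQ. \<Sum>p<dP. \<Sum>s<dS. \<Sum>a<dA. \<Sum>b<dB. (cmod (\<pi> q a p))\<^sup>2 * (cmod (\<phi> b s))\<^sup>2)"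
    unfolding sm by (intro sum.cong refl) (simp add: x norm_mult power_mult_distrib)
  also have "\<dots> = (\<Sum>q<dQ. \<Sum>a<dA. \<Sum>p<dP. (cmod (\<pi> q a p))\<^sup>2) * (\<Sum>b<dB. \<Sum>s<dS. (cmod (\<phi> b s))\<^sup>2)"
    unfolding sum_product[symmetric] unfolding sum_distrib_left[symmetric] sum_distrib_right[symmetric]
      unfolding sum.swap[of _ "{..<dS}" "{..<dB}"] sum.swap[of _ "{..<dP}" "{..<dA}"] ..
  also have "\<dots> = 1" by (simp add: \<pi> \<phi>)
  finally have nx: "(\<Sum>i<d * ?n. (cmod (x i))\<^sup>2) = 1" .
  have E: "finite ?E" by simp
  note D = diamond_dist_fidelity[OF nlqc_krep E g_isom U dist nx]
  show "0 \<le> \<epsilon>" by (rule D(1))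
  define u where "u i = (\<Sum>k<?n. U $$ (i mod ?n, k) * x (i div ?n * ?n + k))" for i
  define v where "v e i = (\<Sum>k<?n. g (i mod ?n) k e * x (i div ?n * ?n + k))" for e i
  have u: "u (((q * dP + p) * dS + s) * ?n + (\<alpha> * dB + \<beta>)) = ideal (Uk U) \<pi> \<phi> (q, \<alpha>) (\<beta>, p, s)"
    if "p < dP" "s < dS" "\<alpha> < dA" "\<beta> < dB" for q p s \<alpha> \<beta>
    unfolding u_def index_div_mod[OF index_less[OF that(3,4)]] ideal_def Uk_def sum_lessThan_times sum_Times fst_conv snd_conv
    by (intro sum.cong refl) (simp add: x that)
  have v: "v ((e1, e2), (e3, e4)) (((q * dP + p) * dS + s) * ?n + (\<alpha> * dB + \<beta>)) = amp \<pi> \<phi> (q, \<alpha>, e3) ((\<beta>, p, s), e4, e1, e2)"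
    if "p < dP" "s < dS" "\<alpha> < dA" "\<beta> < dB" for q p s \<alpha> \<beta> e1 e2 e3 e4
    unfolding v_def index_div_mod[OF index_less[OF that(3,4)]] amp_def g_def sum_lessThan_times sum_Times fst_conv snd_conv
    by (intro sum.cong refl) (simp add: x that index_div_mod)
  have "1 - \<epsilon> \<le> (\<Sum>e\<in>?E. (cmod (\<Sum>i<d * ?n. cnj (u i) * v e i))\<^sup>2)"
    using D(2) unfolding u_def v_def .
  also have "\<dots> = (\<Sum>e\<in>{..<length Ws} \<times> {..<length Ws'} \<times> {..<length Vs} \<times> {..<length Vs'}.
      (cmod (\<Sum>i<d * ?n. cnj (u i) * v (snd (snd e), (fst e, fst (snd e))) i))\<^sup>2)"
    by (rule sum.reindex_bij_witness[of _ "\<lambda>e. (snd (snd e), (fst e, fst (snd e)))" "\<lambda>e. (fst (snd e), (snd (snd e), fst e))"]) auto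
  also have "\<dots> = (\<Sum>e<length Ws. \<Sum>f\<in>{..<length Ws'} \<times> {..<length Vs} \<times> {..<length Vs'}.
      (cmod (\<Sum>i<d * ?n. cnj (u i) * v (snd f, (e, fst f)) i))\<^sup>2)"
    unfolding sum_Times[of _ "{..<length Ws}"] by simp
  also have "\<dots> = (\<Sum>e<length Ws. \<Sum>f\<in>{..<length Ws'} \<times> {..<length Vs} \<times> {..<length Vs'}.
     (cmod (\<Sum>i\<in>{..<dQ} \<times> {..<dA}. \<Sum>y\<in>{..<dB} \<times> {..<dP} \<times> {..<dS}. cnj (ideal (Uk U) \<pi> \<phi> i y) * amp \<pi> \<phi> (fst i, snd i, e) (y, f)))\<^sup>2)"
  proof (intro sum.cong refl arg_cong[where f="\<lambda>z. (cmod z)\<^sup>2"])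
    fix e and f :: "nat \<times> nat \<times> nat"
    let ?F = "\<lambda>q p s \<alpha> \<beta>. cnj (ideal (Uk U) \<pi> \<phi> (q, \<alpha>) (\<beta>, p, s)) * amp \<pi> \<phi> (q, \<alpha>, e) ((\<beta>, p, s), f)"
    have "(\<Sum>i<d * ?n. cnj (u i) * v (snd f, (e, fst f)) i) = (\<Sum>q<dQ. \<Sum>p<dP. \<Sum>s<dS. \<Sum>a<dA. \<Sum>b<dB. ?F q p s a b)"
      unfolding sm by (intro sum.cong refl) (cases f, simp add: u v)
    also have "\<dots> = (\<Sum>i\<in>{..<dQ} \<times> {..<dP} \<times> {..<dS} \<times> {..<dA} \<times> {..<dB}.
        ?F (fst i) (fst (snd i)) (fst (snd (snd i))) (fst (snd (snd (snd i)))) (snd (snd (snd (snd i)))))"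
      unfolding sum_Times by simp
    also have "\<dots> = (\<Sum>i\<in>({..<dQ} \<times> {..<dA}) \<times> ({..<dB} \<times> {..<dP} \<times> {..<dS}).
        ?F (fst (fst i)) (fst (snd (snd i))) (snd (snd (snd i))) (snd (fst i)) (fst (snd i)))"
      by (rule sum.reindex_bij_witness[of _ "\<lambda>i. (fst (fst i), fst (snd (snd i)), snd (snd (snd i)), snd (fst i), fst (snd i))"
          "\<lambda>i. ((fst i, fst (snd (snd (snd i)))), (snd (snd (snd (snd i))), fst (snd i), fst (snd (snd i))))"]) auto
    also have "\<dots> = (\<Sum>i\<in>{..<dQ} \<times> {..<dA}. \<Sum>y\<in>{..<dB} \<times> {..<dP} \<times> {..<dS}. cnj (ideal (Uk U) \<pi> \<phi> i y) * amp \<pi> \<phi> (fst i, snd i, e) (y, f))"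
      unfolding sum_Times[of _ "{..<dQ} \<times> {..<dA}"] by simp
    finally show "(\<Sum>i<d * ?n. cnj (u i) * v (snd f, (e, fst f)) i)
      = (\<Sum>i\<in>{..<dQ} \<times> {..<dA}. \<Sum>y\<in>{..<dB} \<times> {..<dP} \<times> {..<dS}. cnj (ideal (Uk U) \<pi> \<phi> i y) * amp \<pi> \<phi> (fst i, snd i, e) (y, f))" .
  qed
  finally show "faithful {..<dQ} {..<dP} {..<dS} (Uk U) \<pi> \<phi> \<epsilon>" unfolding faithful_def .
qed

text \<open>U does not act on the reference, so its isometry property reduces the marginal on Q to
  that of P, whatever \<phi> is.\<close>

lemma ideal_mutual_info:
  fixes dP dS :: nat
  assumes U: "unitary (dA*dB) U"
    and P: "P \<in> carrier_mat (dA*dA) (dA*dA)" "\<forall>i<dA*dA. \<forall>j<dA*dA. kern P i j = red {..<dP} x i j"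
    and F: "F \<in> carrier_mat dB dB" "\<forall>i<dB. \<forall>j<dB. kern F i j = red {..<dS} \<phi> i j"
    and \<phi>: "(\<Sum>b<dB. \<Sum>s<dS. (cmod (\<phi> b s))\<^sup>2) = 1"
  defines "\<pi> \<equiv> \<lambda>q a p. x (q * dA + a) p"
    and "IU \<equiv> kron (1\<^sub>m dA) U"
  shows "mutual_info_QA dA dA dB (IU * kron P F * adj IU)
    = vN_entropy (ptr_right dA dA P) - cent {..<dA} {..<dA} (red ({..<dB} \<times> {..<dP} \<times> {..<dS}) (ideal (Uk U) \<pi> \<phi>))"
proof -
  have Uc: "U \<in> carrier_mat (dA*dB) (dA*dB)" using U by (simp add: unitary_def)
  define M where "M = IU * kron P F * adj IU"
  have "dyads (dA*dA) P {..<dP} x x" "dyads dB F {..<dS} \<phi> \<phi>"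
    using P F by (auto simp: dyads_def kern_def red_def)
  note k = dyads_kron[OF this]
  have IU: "IU \<in> carrier_mat ((dA*dA)*dB) ((dA*dA)*dB)"
    using kron_carrier[OF one_carrier_mat Uc, of dA] by (simp add: IU_def mult.assoc)
  define y where "y i t = (\<Sum>k<(dA*dA)*dB. IU $$ (i, k) * (x (k div dB) (fst t) * \<phi> (k mod dB) (snd t)))" for i and t :: "nat \<times> nat"
  have d: "dyads ((dA*dA)*dB) M ({..<dP} \<times> {..<dS}) y y"
    unfolding M_def y_def by (rule dyads_conj[OF k IU])
  have y: "y ((q * dA + a) * dB + b) t = ideal (Uk U) \<pi> \<phi> (q, a) (b, t)" if "q < dA" "a < dA" "b < dB" for q a b t
  proof -
    have i: "a * dB + b < dA * dB" using that by (intro index_less)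
    have "y ((q * dA + a) * dB + b) t = (\<Sum>k<dA*(dA*dB). kron (1\<^sub>m dA) U $$ (q * (dA*dB) + (a * dB + b), k) * (x (k div dB) (fst t) * \<phi> (k mod dB) (snd t)))"
      unfolding y_def IU_def by (simp add: algebra_simps)
    also have "\<dots> = (\<Sum>k<dA*dB. U $$ (a * dB + b, k) * (x ((q * (dA*dB) + k) div dB) (fst t) * \<phi> ((q * (dA*dB) + k) mod dB) (snd t)))"
      by (rule kron_one_left_apply[OF Uc that(1) i])
    also have "\<dots> = (\<Sum>c<dA. \<Sum>e<dB. U $$ (a * dB + b, c * dB + e) * (x (q * dA + c) (fst t) * \<phi> e (snd t)))"
      unfolding sum_lessThan_times
    proof (intro sum.cong refl)
      fix c e assume "e \<in> {..<dB}"
      then have e: "e < dB" by simp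
      have "q * (dA*dB) + (c * dB + e) = (q * dA + c) * dB + e" by (simp add: algebra_simps)
      then have "(q * (dA*dB) + (c * dB + e)) div dB = q * dA + c" "(q * (dA*dB) + (c * dB + e)) mod dB = e"
        by (simp_all only: index_div_mod[OF e])
      then show "U $$ (a * dB + b, c * dB + e) * (x ((q * (dA*dB) + (c * dB + e)) div dB) (fst t) * \<phi> ((q * (dA*dB) + (c * dB + e)) mod dB) (snd t))
        = U $$ (a * dB + b, c * dB + e) * (x (q * dA + c) (fst t) * \<phi> e (snd t))" by simp
    qed
    finally show ?thesis by (simp add: ideal_def Uk_def sum_Times \<pi>_def)
  qed
  have Mx: "kern M ((q * dA + a) * dB + b) ((q' * dA + a') * dB + b')
      = (\<Sum>t\<in>{..<dP} \<times> {..<dS}. ideal (Uk U) \<pi> \<phi> (q, a) (b, t) * cnj (ideal (Uk U) \<pi> \<phi> (q', a') (b', t)))"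
    if "q < dA" "a < dA" "b < dB" "q' < dA" "a' < dA" "b' < dB" for q a b q' a' b'
    unfolding kern_def using that
    by (subst dyads_index[OF d]) (auto intro!: index_less simp: y)
  note mi = mutual_info_eq_cent[OF dyads_carrier[OF d] Mx]
  have "ptr_right dA dA (ptr_right (dA * dA) dB M) = ptr_right dA dA P"
  proof (rule eq_matI)
    fix q q' assume "q < dim_row (ptr_right dA dA P)" "q' < dim_col (ptr_right dA dA P)"
    then have q: "q < dA" "q' < dA" by (simp_all add: ptr_right_def)
    let ?i = "ideal (Uk U) \<pi> \<phi>"
    have Ui: "isom ({..<dA} \<times> {..<dB}) ({..<dA} \<times> {..<dB}) (Uk U)"
      using unitary_isom[OF U] unfolding Uk_def .
    have "ptr_right dA dA (ptr_right (dA * dA) dB M) $$ (q, q')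
      = (\<Sum>a<dA. \<Sum>b<dB. \<Sum>t\<in>{..<dP} \<times> {..<dS}. ?i (q, a) (b, t) * cnj (?i (q', a) (b, t)))"
      using mi(2)[OF _ _ _ _ _ _ q] by (simp add: red_def sum_Times)
    also have "\<dots> = (\<Sum>t\<in>{..<dP} \<times> {..<dS}. \<Sum>z\<in>{..<dA} \<times> {..<dB}. ?i (q, fst z) (snd z, t) * cnj (?i (q', fst z) (snd z, t)))"
      by (subst sum.swap, subst sum_Times) (simp add: sum.swap[of _ "{..<dP} \<times> {..<dS}"])
    also have "\<dots> = (\<Sum>t\<in>{..<dP} \<times> {..<dS}. \<Sum>z\<in>{..<dA} \<times> {..<dB}. (\<pi> q (fst z) (fst t) * \<phi> (snd z) (snd t)) * cnj (\<pi> q' (fst z) (fst t) * \<phi> (snd z) (snd t)))"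
      unfolding ideal_def fst_conv snd_conv prod.collapse by (intro sum.cong refl isom_gram[OF Ui])
    also have "\<dots> = (\<Sum>p<dP. \<Sum>s<dS. \<Sum>a<dA. \<Sum>b<dB. (\<pi> q a p * cnj (\<pi> q' a p)) * (\<phi> b s * cnj (\<phi> b s)))"
      unfolding sum_Times by (intro sum.cong refl) simp
    also have "\<dots> = (\<Sum>p<dP. \<Sum>a<dA. \<pi> q a p * cnj (\<pi> q' a p)) * (\<Sum>s<dS. \<Sum>b<dB. \<phi> b s * cnj (\<phi> b s))"
      unfolding sum_product[symmetric] unfolding sum_distrib_left[symmetric] sum_distrib_right[symmetric] ..
    also have "(\<Sum>s<dS. \<Sum>b<dB. \<phi> b s * cnj (\<phi> b s)) = 1"
      by (subst sum.swap) (use \<phi> in \<open>simp add: mult_cnj_self flip: of_real_power of_real_sum\<close>)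
    also have "(\<Sum>p<dP. \<Sum>a<dA. \<pi> q a p * cnj (\<pi> q' a p)) * 1 = (\<Sum>a<dA. kern P (q * dA + a) (q' * dA + a))"
      using q P(2) by (simp add: index_less red_def \<pi>_def sum.swap[of _ "{..<dP}"])
    also have "\<dots> = ptr_right dA dA P $$ (q, q')" using q by (simp add: ptr_right_def kern_def)
    finally show "ptr_right dA dA (ptr_right (dA * dA) dB M) $$ (q, q') = ptr_right dA dA P $$ (q, q')" .
  qed (simp_all add: ptr_right_def)
  then show ?thesis using mi(1) by (simp add: M_def)
qed

lemma resource_entropy: "vN_entropy (ptr_left dL dR (outer \<psi>)) = ent {..<dR} (red {..<dL} (\<lambda>r l. \<psi> $ (l * dR + r)))"
proof -
  let ?S = "ptr_left dL dR (outer \<psi>)"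
  have dpsi: "dim_vec \<psi> = dL*dR" using psi by (simp add: unit_cvec_def)
  have k: "kern ?S r r' = red {..<dL} (\<lambda>r l. \<psi> $ (l * dR + r)) r r'" if "r < dR" "r' < dR" for r r'
    using that by (simp add: kern_def ptr_left_def outer_def dpsi index_less red_def)
  have "pos {..<dR} (kern ?S)" by (rule pos_cong[OF pos_red]) (simp add: k)
  then have "vN_entropy ?S = ent {..<dR} (kern ?S)"
    by (intro vN_entropy_eq_ent) (auto simp: ptr_left_def pos_def)
  also have "\<dots> = ent {..<dR} (red {..<dL} (\<lambda>r l. \<psi> $ (l * dR + r)))" by (rule ent_cong) (simp add: k)
  finally show ?thesis .
qed

end

theorem mainTheorem4:
  fixes dA dB dL dR dKa dMa dKb dMb :: nat
    and U :: "complex mat" and l1 l2 \<epsilon> :: real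
    and Vs Vs' Ws Ws' :: "complex mat list" and \<psi> :: "complex vec"
  assumes dims: "0 < dA" "0 < dB" "0 < dL" "0 < dR" "0 < dKa" "0 < dMa" "0 < dKb" "0 < dMb"
    and U: "unitary (dA*dB) U"
    and cc: "controllable_correlation dA dB U l1 l2"
    and V: "kraus_channel (dA*dL) (dKa*dMb) Vs"
    and V': "kraus_channel (dR*dB) (dMa*dKb) Vs'"
    and W: "kraus_channel (dKa*dMa) dA Ws"
    and W': "kraus_channel (dMb*dKb) dB Ws'"
    and psi: "unit_cvec (dL*dR) \<psi>"
    and eps: "\<epsilon> < 1/4"
    and correct: "diamond_dist (dA*dB) (dA*dB)
                    (nlqc_map dA dB dL dR dKa dMa dKb dMb Vs Vs' Ws Ws' (outer \<psi>))
                    (\<lambda>\<rho>. U * \<rho> * adj U) \<le> \<epsilon>"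
  shows "vN_entropy (ptr_left dL dR (outer \<psi>))
           \<ge> (l1 - l2) / 2 - Delta (2 * sqrt \<epsilon>) (log 2 (real dA))"
proof -
  interpret nlqc dA dB dL dR dKa dMa dKb dMb Vs Vs' Ws Ws' \<psi>
    using V V' W W' psi by unfold_locales
  let ?IU = "kron (1\<^sub>m dA) U"
  obtain P F1 F2 where P: "density (dA*dA) P" and F1: "density dB F1" and F2: "density dB F2"
    and l: "l1 = mutual_info_QA dA dA dB (?IU * kron P F1 * adj ?IU)" "l2 = mutual_info_QA dA dA dB (?IU * kron P F2 * adj ?IU)"
    using cc unfolding controllable_correlation_def Let_def by blast
  have c: "P \<in> carrier_mat (dA*dA) (dA*dA)" "F1 \<in> carrier_mat dB dB" "F2 \<in> carrier_mat dB dB"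
    using P F1 F2 by (simp_all add: density_def)
  obtain x where x: "\<forall>i<dA*dA. \<forall>j<dA*dA. kern P i j = red {..<dA*dA} x i j" "(\<Sum>i<dA*dA. \<Sum>t<dA*dA. (cmod (x i t))\<^sup>2) = 1"
    using density_obtain_red[OF P] by blast
  obtain f1 where f1: "\<forall>i<dB. \<forall>j<dB. kern F1 i j = red {..<dB} f1 i j" "(\<Sum>i<dB. \<Sum>t<dB. (cmod (f1 i t))\<^sup>2) = 1"
    using density_obtain_red[OF F1] by blast
  obtain f2 where f2: "\<forall>i<dB. \<forall>j<dB. kern F2 i j = red {..<dB} f2 i j" "(\<Sum>i<dB. \<Sum>t<dB. (cmod (f2 i t))\<^sup>2) = 1"
    using density_obtain_red[OF F2] by blast
  define \<pi> where "\<pi> q a p = x (q * dA + a) p" for q a p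
  have \<pi>: "(\<Sum>q<dA. \<Sum>a<dA. \<Sum>p<dA*dA. (cmod (\<pi> q a p))\<^sup>2) = 1"
    using x(2) unfolding \<pi>_def by (subst (asm) sum_lessThan_times)
  have Ui: "isom ({..<dA} \<times> {..<dB}) ({..<dA} \<times> {..<dB}) (Uk U)"
    using unitary_isom[OF U] unfolding Uk_def .
  note faithful1 = faithful_of_diamond[OF U correct \<pi> f1(2)] and faithful2 = faithful_of_diamond[OF U correct \<pi> f2(2)]
  note eps0 = faithful1(2)
  let ?C = "\<lambda>f. cent {..<dA} {..<dA} (red ({..<dB} \<times> {..<dA*dA} \<times> {..<dB}) (ideal (Uk U) \<pi> f))"
  let ?n = "log 2 (real dA)"
  have "l1 - l2 = ?C f2 - ?C f1"
    unfolding l ideal_mutual_info[OF U c(1) x(1) c(2) f1, folded \<pi>_def] ideal_mutual_info[OF U c(1) x(1) c(3) f2, folded \<pi>_def] by simp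
  also have "\<dots> \<le> 2 * vN_entropy (ptr_left dL dR (outer \<psi>)) + 2 * (2 * sqrt (2 * \<epsilon>) * ?n + etagap (sqrt (2 * \<epsilon>)))"
    using resource_entropy_bound[OF Ui _ _ _ \<pi> f1(2) f2(2) faithful1(1) faithful2(1) eps0] eps
    by (simp add: resource_entropy)
  also have "\<dots> \<le> 2 * vN_entropy (ptr_left dL dR (outer \<psi>)) + 2 * Delta (2 * sqrt \<epsilon>) ?n"
  proof -
    \<comment> \<open>The argument produces the error at distance sqrt (2\<epsilon>); monotonicity
      of the error term lets the distance grow to 4 sqrt \<epsilon>.\<close>
    have "sqrt 2 \<le> 4" by (rule real_le_lsqrt) auto
    then have s: "sqrt (2 * \<epsilon>) \<le> 4 * sqrt \<epsilon>" using eps0 by (simp add: real_sqrt_mult mult_right_mono)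
    have n: "0 \<le> ?n" using dims(1) by simp
    have "2 * sqrt (2 * \<epsilon>) * ?n \<le> 2 * (4 * sqrt \<epsilon>) * ?n"
      using s n by (intro mult_right_mono) auto
    moreover have "etagap (sqrt (2 * \<epsilon>)) \<le> etagap (4 * sqrt \<epsilon>)" using s eps0 by (intro etagap_mono) auto
    ultimately have "2 * sqrt (2 * \<epsilon>) * ?n + etagap (sqrt (2 * \<epsilon>)) \<le> Delta (2 * sqrt \<epsilon>) ?n"
      unfolding Delta_eq[OF eps0] by (rule add_mono)
    then show ?thesis by simp
  qed
  finally show ?thesis by (simp add: field_simps)
qed

end
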